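(* If $u$ and $v$ are entropy solutions of the initial-boundary value problem for the Ostrovsky--Hunter equation with initial data $u_0$ and $v_0$ respectively (and the same boundary data $\alpha,\beta$), then $$\|u(\cdot,T)-v(\cdot,T)\|_{\mathrm{L}^1(0,1)}\le e^{\gamma T}\,\|u_0-v_0\|_{\mathrm{L}^1(0,1)}.$$ In particular, entropy solutions to the initial-boundary value problem are unique.
   Context: **Problem.** Let $T>0$, $f\in\mathcal{C}^2(\mathbb{R})$, $\gamma>0$. The initial-boundary value problem for the Ostrovsky--Hunter equation on $[0,1]\times[0,T]$ is $$u_t+f(u)_x=\gamma P[u],\quad P[u](x,t)=\int_0^x u(y,t)\,dy,\quad u(x,0)=u_0(x),\quad u(0,t)=\alpha(t),\quad u(1,t)=\beta(t).$$ Standing assumption: the initial data belong to $\mathrm{BV}(0,1)$ and the boundary data satisfy $\alpha,\beta\in\mathrm{BV}(0,T)$. **Entropy solution.** A function $u\in \mathcal{C}([0,T];\mathrm{L}^1(0,1))\cap \mathrm{L}^\infty((0,1)\times(0,T))$ is an entropy solution of this problem if for all entropy pairs $(\eta,q)$, i.e. $\eta\in\mathcal{C}^2(\mathbb{R})$ convex and $q$ with $q'=\eta'f'$, $$\int_0^T\!\!\int_0^1\big(\eta(u)\phi_t+q(u)\phi_x+\gamma\eta'(u)P[u]\phi\big)\,dx\,dt+\int_0^1\eta(u_0(x))\phi(x,0)\,dx-\int_0^1\eta(u(x,T))\phi(x,T)\,dx\ge 0$$ for all nonnegative $\phi\in\mathcal{C}_c^\infty((0,1)\times\mathbb{R})$,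 and $$q(u_0^\tau(t))-q(\alpha(t))-\eta'(\alpha(t))\big(f(u_0^\tau(t))-f(\alpha(t))\big)\le 0\le q(u_1^\tau(t))-q(\beta(t))-\eta'(\beta(t))\big(f(u_1^\tau(t))-f(\beta(t))\big)$$ for a.e. $t\in(0,T)$. Here $u_0^\tau$ and $u_1^\tau$ denote the strong ($\mathrm{L}^1$ in time) traces of $u$ at $x=0$ and $x=1$ respectively. *)

theory Defs
  imports "HOL-Analysis.Analysis"
begin

text \<open>
  Elements of \<open>L\<^sup>1\<close>, \<open>L\<^sup>\<infinity>\<close>, \<open>BV\<close> and \<open>C([0,T]; L\<^sup>1)\<close> are given by Borel measurable
  representatives (every class has one); all notions below depend only on the class.
  A function of space and time is curried, space first: \<open>u x t\<close>.
\<close>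

section \<open>Smooth functions and test functions\<close>

definition C_k :: "nat \<Rightarrow> (real \<Rightarrow> real) \<Rightarrow> bool" where
  "C_k k g \<longleftrightarrow>
     (\<forall>i<k. \<forall>x. (deriv ^^ i) g differentiable (at x)) \<and> continuous_on UNIV ((deriv ^^ k) g)"

definition dx :: "(real \<Rightarrow> real \<Rightarrow> real) \<Rightarrow> real \<Rightarrow> real \<Rightarrow> real" where
  "dx \<phi> x t = deriv (\<lambda>y. \<phi> y t) x"

definition dt :: "(real \<Rightarrow> real \<Rightarrow> real) \<Rightarrow> real \<Rightarrow> real \<Rightarrow> real" where
  "dt \<phi> x t = deriv (\<lambda>s. \<phi> x s) t"

primrec C_k2 :: "nat \<Rightarrow> (real \<Rightarrow> real \<Rightarrow> real) \<Rightarrow> bool" where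
  "C_k2 0 \<phi> \<longleftrightarrow> continuous_on UNIV (\<lambda>(x, t). \<phi> x t)"
| "C_k2 (Suc k) \<phi> \<longleftrightarrow>
     continuous_on UNIV (\<lambda>(x, t). \<phi> x t) \<and>
     (\<forall>x t. (\<lambda>y. \<phi> y t) differentiable (at x)) \<and>
     (\<forall>x t. (\<lambda>s. \<phi> x s) differentiable (at t)) \<and>
     C_k2 k (dx \<phi>) \<and> C_k2 k (dt \<phi>)"

definition C_inf2 :: "(real \<Rightarrow> real \<Rightarrow> real) \<Rightarrow> bool" where
  "C_inf2 \<phi> \<longleftrightarrow> (\<forall>k. C_k2 k \<phi>)"

text \<open>\<open>C\<^sub>c\<^sup>\<infinity>((0,1) \<times> \<real>)\<close>, the functions being extended by zero to the plane.\<close>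

definition test_function :: "(real \<Rightarrow> real \<Rightarrow> real) \<Rightarrow> bool" where
  "test_function \<phi> \<longleftrightarrow> C_inf2 \<phi> \<and>
     compact (closure {(x, t). \<phi> x t \<noteq> 0}) \<and>
     closure {(x, t). \<phi> x t \<noteq> 0} \<subseteq> {0<..<1} \<times> UNIV"


section \<open>Function spaces\<close>

definition L1_norm :: "real set \<Rightarrow> (real \<Rightarrow> real) \<Rightarrow> real" where
  "L1_norm S g = (LINT x:S|lborel. \<bar>g x\<bar>)"

text \<open>
  \<open>BV(a,b)\<close> in the usual distributional sense: \<open>g \<in> L\<^sup>1(a,b)\<close> and the total variation
  \<open>sup {\<integral> g \<psi>' | \<psi> \<in> C\<^sub>c\<^sup>1(a,b), \<bar>\<psi>\<bar> \<le> 1}\<close> is finite.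
\<close>

definition BV :: "real \<Rightarrow> real \<Rightarrow> (real \<Rightarrow> real) \<Rightarrow> bool" where
  "BV a b g \<longleftrightarrow> set_integrable lborel {a<..<b} g \<and>
     bdd_above {LINT x:{a<..<b}|lborel. g x * deriv \<psi> x | \<psi>.
       C_k 1 \<psi> \<and> (\<forall>x. \<bar>\<psi> x\<bar> \<le> 1) \<and>
       compact (closure {x. \<psi> x \<noteq> 0}) \<and> closure {x. \<psi> x \<noteq> 0} \<subseteq> {a<..<b}}"

definition in_C_L1 :: "real \<Rightarrow> (real \<Rightarrow> real \<Rightarrow> real) \<Rightarrow> bool" where
  "in_C_L1 T u \<longleftrightarrow>
     (\<forall>t\<in>{0..T}. set_integrable lborel {0<..<1} (\<lambda>x. u x t)) \<and>
     (\<forall>s\<in>{0..T}. ((\<lambda>t. L1_norm {0<..<1} (\<lambda>x. u x t - u x s)) \<longlongrightarrow> 0) (at s within {0..T}))"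

definition in_Linf :: "real \<Rightarrow> (real \<Rightarrow> real \<Rightarrow> real) \<Rightarrow> bool" where
  "in_Linf T u \<longleftrightarrow>
     set_borel_measurable lborel ({0<..<1} \<times> {0<..<T}) (\<lambda>(x, t). u x t) \<and>
     (\<exists>M. AE (x, t) in lborel. x \<in> {0<..<1} \<and> t \<in> {0<..<T} \<longrightarrow> \<bar>u x t\<bar> \<le> M)"

text \<open>
  \<open>\<tau> \<in> L\<^sup>1(0,T)\<close> is the strong trace of \<open>u\<close> at the boundary point \<open>a \<in> {0, 1}\<close>:
  \<open>ess lim \<parallel>u(x,\<cdot>) - \<tau>\<parallel> = 0\<close> in \<open>L\<^sup>1(0,T)\<close> as \<open>x \<rightarrow> a\<close>, \<open>x \<in> (0,1)\<close>. The limit is essential,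
  i.e. up to a null set \<open>N\<close> of points \<open>x\<close>, since \<open>u\<close> is only defined almost everywhere.
\<close>

definition strong_trace ::
  "real \<Rightarrow> real \<Rightarrow> (real \<Rightarrow> real \<Rightarrow> real) \<Rightarrow> (real \<Rightarrow> real) \<Rightarrow> bool" where
  "strong_trace T a u \<tau> \<longleftrightarrow> set_integrable lborel {0<..<T} \<tau> \<and>
     (\<exists>N\<in>null_sets lborel.
        (\<forall>x\<in>{0<..<1} - N. set_integrable lborel {0<..<T} (\<lambda>t. u x t)) \<and>
        ((\<lambda>x. L1_norm {0<..<T} (\<lambda>t. u x t - \<tau> t)) \<longlongrightarrow> 0) (at a within {0<..<1} - N))"


section \<open>Entropy solutions of the Ostrovsky--Hunter equation\<close>

definition P_op :: "(real \<Rightarrow> real \<Rightarrow> real) \<Rightarrow> real \<Rightarrow> real \<Rightarrow> real" where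
  "P_op u x t = (LINT y:{0<..<x}|lborel. u y t)"

definition entropy_pair :: "(real \<Rightarrow> real) \<Rightarrow> (real \<Rightarrow> real) \<Rightarrow> (real \<Rightarrow> real) \<Rightarrow> bool" where
  "entropy_pair f \<eta> q \<longleftrightarrow> C_k 2 \<eta> \<and> convex_on UNIV \<eta> \<and>
     (\<forall>x. (q has_real_derivative deriv \<eta> x * deriv f x) (at x))"

definition entropy_inequality ::
  "real \<Rightarrow> real \<Rightarrow> (real \<Rightarrow> real) \<Rightarrow> (real \<Rightarrow> real \<Rightarrow> real) \<Rightarrow>
     (real \<Rightarrow> real) \<Rightarrow> (real \<Rightarrow> real) \<Rightarrow> (real \<Rightarrow> real \<Rightarrow> real) \<Rightarrow> bool" where
  "entropy_inequality T \<gamma> u0 u \<eta> q \<phi> \<longleftrightarrow>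
     (LINT t:{0<..<T}|lborel. LINT x:{0<..<1}|lborel.
         \<eta> (u x t) * dt \<phi> x t + q (u x t) * dx \<phi> x t + \<gamma> * deriv \<eta> (u x t) * P_op u x t * \<phi> x t)
     + (LINT x:{0<..<1}|lborel. \<eta> (u0 x) * \<phi> x 0)
     - (LINT x:{0<..<1}|lborel. \<eta> (u x T) * \<phi> x T) \<ge> 0"

definition entropy_solution ::
  "real \<Rightarrow> real \<Rightarrow> (real \<Rightarrow> real) \<Rightarrow> (real \<Rightarrow> real) \<Rightarrow> (real \<Rightarrow> real) \<Rightarrow>
     (real \<Rightarrow> real) \<Rightarrow> (real \<Rightarrow> real \<Rightarrow> real) \<Rightarrow> bool" where
  "entropy_solution T \<gamma> f \<alpha> \<beta> u0 u \<longleftrightarrow>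
     in_C_L1 T u \<and> in_Linf T u \<and>
     (\<forall>\<eta> q \<phi>. entropy_pair f \<eta> q \<longrightarrow> test_function \<phi> \<longrightarrow> (\<forall>x t. 0 \<le> \<phi> x t) \<longrightarrow>
        entropy_inequality T \<gamma> u0 u \<eta> q \<phi>) \<and>
     (\<exists>\<tau>\<^sub>0 \<tau>\<^sub>1. strong_trace T 0 u \<tau>\<^sub>0 \<and> strong_trace T 1 u \<tau>\<^sub>1 \<and>
        (\<forall>\<eta> q. entropy_pair f \<eta> q \<longrightarrow>
           (AE t in lborel. t \<in> {0<..<T} \<longrightarrow>
              q (\<tau>\<^sub>0 t) - q (\<alpha> t) - deriv \<eta> (\<alpha> t) * (f (\<tau>\<^sub>0 t) - f (\<alpha> t)) \<le> 0 \<and>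
              0 \<le> q (\<tau>\<^sub>1 t) - q (\<beta> t) - deriv \<eta> (\<beta> t) * (f (\<tau>\<^sub>1 t) - f (\<beta> t)))))"

end

theory Submission
  imports Defs
begin

text \<open>
  The theorem is Kruzkov's contraction principle. For two entropy solutions \<open>u\<close>, \<open>v\<close> with the same
  boundary data the distance \<open>w(t) = \<integral> \<bar>u - v\<bar> dx\<close> satisfies \<open>w' \<le> \<gamma> w\<close> in the sense of
  distributions on \<open>(0,T)\<close>; since \<open>w\<close> is continuous on \<open>[0,T]\<close> and the initial data are attained,
  the estimate follows.

  The differential inequality comes in three steps. Letting smooth convex entropies tend to
  \<open>\<bar>w - k\<bar>\<close> gives Kruzkov's inequality for every constant \<open>k\<close>
  (\<open>kruzkov_solution_of_entropy\<close>). Next, \<open>k\<close> is replaced by the value of the other solution at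
  another point, and the two points are made to coincide (\<open>kruzkov_doubling\<close>):
  \<open>\<integral>\<integral> \<bar>u - v\<bar> a b' + F(u,v) a' b + \<gamma> \<bar>P[u] - P[v]\<bar> a b \<ge> 0\<close> with \<open>F(u,v) = sgn(u - v) (f(u) - f(v))\<close>,
  for all cut-offs \<open>a(x) b(t) \<ge> 0\<close> inside the rectangle. The passage to the diagonal is controlled by
  the continuity of translations in \<open>L\<^sup>1\<close>. Finally \<open>a\<close> tends to \<open>1\<close>; then \<open>a'\<close> concentrates at the
  two ends, and there the strong traces appear in \<open>F\<close>. The boundary entropy condition says
  that between \<open>\<alpha>\<close> and the trace \<open>\<tau>\<close> at \<open>x = 0\<close> the flux is extremal at \<open>\<tau>\<close> (a minimum if
  \<open>\<alpha> < \<tau>\<close>, a maximum if \<open>\<tau> < \<alpha>\<close>), which gives \<open>F \<le> 0\<close> for the traces of two solutions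
  (\<open>tent_condition_flux\<close>); at \<open>x = 1\<close> the sign is reversed. Both boundary terms can
  therefore be dropped (\<open>boundary_flux_inequality\<close>), and \<open>\<bar>P[u] - P[v]\<bar> \<le> w(t)\<close> closes the estimate.

  Every test function is a product \<open>A(x) B(t)\<close>, also in the doubling argument, where
  \<open>a(x) \<delta>(x - y) b(t) \<delta>(t - s)\<close> is a product in \<open>(x,t)\<close> for fixed \<open>(y,s)\<close> and conversely. Hence
  smoothness is needed for functions of one variable only.
\<close>

section \<open>Smooth cut-off functions\<close>

text \<open>
  Differentiability to order \<open>n\<close> as a recursion on \<open>n\<close>: closure under products and primitives
  then needs no formula for iterated derivatives.
\<close>

primrec diff_order :: "nat \<Rightarrow> (real \<Rightarrow> real) \<Rightarrow> bool" where
  "diff_order 0 g \<longleftrightarrow> True"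
| "diff_order (Suc n) g \<longleftrightarrow> (\<exists>g'. (\<forall>x. (g has_real_derivative g' x) (at x)) \<and> diff_order n g')"

definition smooth :: "(real \<Rightarrow> real) \<Rightarrow> bool" where
  "smooth g \<longleftrightarrow> (\<forall>n. diff_order n g)"

lemma diff_order_SucD: "diff_order (Suc n) g \<Longrightarrow> diff_order n g"
proof (induction n arbitrary: g)
  case (Suc n)
  then obtain g' where "\<forall>x. (g has_real_derivative g' x) (at x)" "diff_order (Suc n) g'"
    by (metis diff_order.simps(2))
  with Suc.IH show ?case by (metis diff_order.simps(2))
qed simp

lemma diff_order_const: "diff_order n (\<lambda>x. c)"
proof (induction n arbitrary: c)
  case (Suc n)
  then show ?case by (auto intro!: exI[of _ "\<lambda>x. 0"])
qed simp

lemma diff_order_add: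
  "diff_order n g \<Longrightarrow> diff_order n h \<Longrightarrow> diff_order n (\<lambda>x. g x + h x)"
proof (induction n arbitrary: g h)
  case (Suc n)
  then obtain g' h' where
    "\<forall>x. (g has_real_derivative g' x) (at x)" "diff_order n g'"
    "\<forall>x. (h has_real_derivative h' x) (at x)" "diff_order n h'" by auto
  with Suc.IH[of g' h'] show ?case
    by (auto intro!: exI[of _ "\<lambda>x. g' x + h' x"] DERIV_add)
qed simp

lemma diff_order_mult:
  "diff_order n g \<Longrightarrow> diff_order n h \<Longrightarrow> diff_order n (\<lambda>x. g x * h x)"
proof (induction n arbitrary: g h)
  case (Suc n)
  then obtain g' h' where *:
    "\<forall>x. (g has_real_derivative g' x) (at x)" "diff_order n g'"
    "\<forall>x. (h has_real_derivative h' x) (at x)" "diff_order n h'" by auto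
  have "diff_order n (\<lambda>x. g' x * h x + h' x * g x)"
    by (intro diff_order_add Suc.IH * diff_order_SucD[OF Suc.prems(1)] diff_order_SucD[OF Suc.prems(2)])
  with * show ?case
    by (auto intro!: exI[of _ "\<lambda>x. g' x * h x + h' x * g x"] DERIV_mult)
qed simp

lemma diff_order_affine: "diff_order n g \<Longrightarrow> diff_order n (\<lambda>x. g (a * x + b))"
proof (induction n arbitrary: g)
  case (Suc n)
  then obtain g' where *:
    "\<forall>x. (g has_real_derivative g' x) (at x)" "diff_order n g'" by auto
  have "((\<lambda>x. g (a * x + b)) has_real_derivative g' (a * x + b) * a) (at x)" for x
    by (rule DERIV_chain2[where g="\<lambda>x. a * x + b"]) (use * in \<open>auto intro!: derivative_eq_intros\<close>)
  moreover have "diff_order n (\<lambda>x. g' (a * x + b) * a)"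
    using * Suc.IH by (intro diff_order_mult diff_order_const) auto
  ultimately show ?case
    by (auto intro!: exI[of _ "\<lambda>x. g' (a * x + b) * a"])
qed simp

lemma smooth_const: "smooth (\<lambda>x. c)"
  and smooth_add: "smooth g \<Longrightarrow> smooth h \<Longrightarrow> smooth (\<lambda>x. g x + h x)"
  and smooth_mult: "smooth g \<Longrightarrow> smooth h \<Longrightarrow> smooth (\<lambda>x. g x * h x)"
  and smooth_affine: "smooth g \<Longrightarrow> smooth (\<lambda>x. g (a * x + b))"
  by (auto simp: smooth_def diff_order_const diff_order_add diff_order_mult diff_order_affine)

lemma smooth_diff: "smooth g \<Longrightarrow> smooth h \<Longrightarrow> smooth (\<lambda>x. g x - h x)"
  using smooth_add[of g "\<lambda>x. (-1) * h x"] smooth_mult[OF smooth_const[of "-1"], of h] by simp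

lemma smooth_antiderivative:
  "(\<And>x. (G has_real_derivative g x) (at x)) \<Longrightarrow> smooth g \<Longrightarrow> smooth G"
  unfolding smooth_def by (metis diff_order.simps not0_implies_Suc)

lemma smooth_DERIV: assumes "smooth g" shows "(g has_real_derivative deriv g x) (at x)"
  and "smooth (deriv g)"
proof -
  have 1: "\<And>x. (g has_real_derivative deriv g x) (at x)"
    using assms unfolding smooth_def
    by (metis DERIV_imp_deriv diff_order.simps(2))
  then show "(g has_real_derivative deriv g x) (at x)" by simp
  have "diff_order n (deriv g)" for n
  proof -
    have "diff_order (Suc n) g" using assms by (simp add: smooth_def)
    then obtain g' where "\<forall>x. (g has_real_derivative g' x) (at x)" "diff_order n g'" by auto
    moreover from this have "deriv g = g'" by (auto intro!: DERIV_imp_deriv)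
    ultimately show ?thesis by simp
  qed
  then show "smooth (deriv g)" by (simp add: smooth_def)
qed

lemma continuous_on_real_derivative:
  fixes g :: "real \<Rightarrow> real"
  assumes "\<And>x. (g has_real_derivative g' x) (at x)"
  shows "continuous_on S g"
  by (rule DERIV_continuous_on) (rule has_field_derivative_at_within[OF assms])

lemma smooth_continuous: "smooth g \<Longrightarrow> continuous_on S g"
  by (rule continuous_on_real_derivative[OF smooth_DERIV(1)])

lemma smooth_exp: "smooth (\<lambda>x. exp (c * x))"
proof -
  have "diff_order n (\<lambda>x. exp (c * x))" for n
  proof (induction n)
    case (Suc n)
    have "((\<lambda>x. exp (c * x)) has_real_derivative exp (c * x) * c) (at x)" for x
      by (auto intro!: derivative_eq_intros)
    moreover have "diff_order n (\<lambda>x. exp (c * x) * c)"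
      by (intro diff_order_mult diff_order_const Suc)
    ultimately show ?case by (auto intro!: exI[of _ "\<lambda>x. exp (c * x) * c"])
  qed simp
  then show ?thesis by (simp add: smooth_def)
qed

text \<open>
  The functions \<open>exp(-1/x) / x^k\<close>, extended by zero. Taking all \<open>k\<close> together makes smoothness an
  induction, because the derivative of each is a linear combination of two others.
\<close>

definition flat :: "nat \<Rightarrow> real \<Rightarrow> real" where
  "flat k x = (if x > 0 then inverse x ^ k * exp (- inverse x) else 0)"

lemma flat_tendsto: "(flat k \<longlongrightarrow> 0) (at 0)"
proof -
  have "((\<lambda>y::real. y ^ k / exp y) \<longlongrightarrow> 0) at_top" by (rule tendsto_power_div_exp_0)
  then have "((\<lambda>x::real. inverse x ^ k / exp (inverse x)) \<longlongrightarrow> 0) (at_right 0)"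
    by (rule filterlim_compose[OF _ filterlim_inverse_at_top_right])
  then have r: "(flat k \<longlongrightarrow> 0) (at_right 0)"
    by (rule Lim_transform_eventually)
      (auto simp: flat_def eventually_at_filter exp_minus divide_inverse)
  have l: "(flat k \<longlongrightarrow> 0) (at_left 0)"
    by (rule Lim_transform_eventually[OF tendsto_const])
      (auto simp: flat_def eventually_at_filter)
  show ?thesis using l r by (simp add: filterlim_split_at)
qed

lemma flat_DERIV:
  "(flat k has_real_derivative flat (k + 2) x + (- real k) * flat (k + 1) x) (at x)"
proof (cases "x = 0")
  case True
  have "((\<lambda>h. (flat k (0 + h) - flat k 0) / h) \<longlongrightarrow> 0) (at 0)"
    by (rule Lim_transform_eventually[OF flat_tendsto[of "k+1"]])
      (auto simp: flat_def eventually_at_filter divide_inverse)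
  then show ?thesis using True by (simp add: DERIV_def flat_def)
next
  case False
  show ?thesis
  proof (cases "x > 0")
    case True
    have "((\<lambda>x. inverse x ^ k * exp (- inverse x)) has_real_derivative
        flat (k + 2) x + (- real k) * flat (k + 1) x) (at x)"
      using True
      by (auto intro!: derivative_eq_intros simp: flat_def power2_eq_square)
         (cases k; simp add: field_simps)
    then show ?thesis
      by (rule has_field_derivative_transform_within_open[where S="{0<..}"])
        (use True in \<open>auto simp: flat_def\<close>)
  next
    case 2: False
    have "((\<lambda>x. 0) has_real_derivative flat (k + 2) x + (- real k) * flat (k + 1) x) (at x)"
      using 2 by (simp add: flat_def)
    then show ?thesis
      by (rule has_field_derivative_transform_within_open[where S="{..<0}"])
        (use 2 False in \<open>auto simp: flat_def\<close>)
  qed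
qed

lemma smooth_flat: "smooth (flat k)"
proof -
  have "diff_order n (flat k)" for n
  proof (induction n arbitrary: k)
    case (Suc n)
    have "diff_order n (\<lambda>x. flat (k + 2) x + (- real k) * flat (k + 1) x)"
      by (intro diff_order_add diff_order_mult diff_order_const Suc)
    moreover have "\<forall>x. (flat k has_real_derivative flat (k + 2) x + (- real k) * flat (k + 1) x) (at x)"
      using flat_DERIV by blast
    ultimately show ?case unfolding diff_order.simps by (intro exI[of _ "\<lambda>x. flat (k + 2) x + (- real k) * flat (k + 1) x"] conjI)
  qed simp
  then show ?thesis by (simp add: smooth_def)
qed

definition mollifier :: "real \<Rightarrow> (real \<Rightarrow> real) \<Rightarrow> bool" where
  "mollifier e d \<longleftrightarrow> 0 < e \<and> smooth d \<and> (\<forall>x. 0 \<le> d x) \<and> (\<forall>x. e \<le> \<bar>x\<bar> \<longrightarrow> d x = 0) \<and>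
     (LINT x|lborel. d x) = 1"

lemma integrable_continuous_zero_outside:
  fixes g :: "real \<Rightarrow> real"
  assumes "continuous_on UNIV g" "\<And>x. x \<notin> {a..b} \<Longrightarrow> g x = 0"
  shows "integrable lborel g"
proof -
  have "set_integrable lborel {a..b} g"
    unfolding set_integrable_def
    by (rule borel_integrable_compact) (auto intro: continuous_on_subset[OF assms(1)])
  moreover have "(\<lambda>x. indicator {a..b} x *\<^sub>R g x) = g"
    using assms(2) by (auto simp: indicator_def fun_eq_iff)
  ultimately show ?thesis by (simp add: set_integrable_def)
qed

lemma mollifier_integrable: "mollifier e d \<Longrightarrow> integrable lborel d"
  by (rule integrable_continuous_zero_outside[of _ "-e" e])
     (auto simp: mollifier_def smooth_continuous)

lemma mollifier_exists: assumes "0 < e" shows "\<exists>d. mollifier e d"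
proof -
  define J where "J x = flat 0 (e + x) * flat 0 (e - x)" for x
  have sm: "smooth J"
    unfolding J_def
    using smooth_affine[OF smooth_flat, of 0 1 e] smooth_affine[OF smooth_flat, of 0 "-1" e]
    by (auto intro!: smooth_mult simp: add.commute)
  have nn: "0 \<le> J x" for x by (auto simp: J_def flat_def)
  have z: "J x = 0" if "e \<le> \<bar>x\<bar>" for x using that by (auto simp: J_def flat_def)
  have int: "integrable lborel J"
    by (rule integrable_continuous_zero_outside[of _ "-e" e]) (auto simp: sm smooth_continuous z)
  have "(LINT x|lborel. J x) \<noteq> 0"
  proof
    assume "(LINT x|lborel. J x) = 0"
    then have "AE x in lborel. J x = 0" using int nn by (subst (asm) integral_nonneg_eq_0_iff_AE) auto
    then have "AE x in lborel. x \<notin> {-e<..<e}"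
      by eventually_elim (auto simp: J_def flat_def)
    then have "{-e<..<e} \<in> null_sets lborel" by (simp add: AE_iff_null_sets)
    then show False using assms by (auto simp: null_sets_def)
  qed
  moreover have "0 \<le> (LINT x|lborel. J x)" using nn by simp
  ultimately have pos: "0 < (LINT x|lborel. J x)" by simp
  define c where "c = inverse (LINT x|lborel. J x)"
  have "mollifier e (\<lambda>x. c * J x)"
    using assms sm nn z pos int by (auto simp: mollifier_def c_def intro!: smooth_mult smooth_const)
  then show ?thesis by blast
qed

lemma continuous_antiderivative:
  fixes g :: "real \<Rightarrow> real"
  assumes "continuous_on UNIV g"
  shows "\<exists>G. G c = 0 \<and> (\<forall>x. (G has_real_derivative g x) (at x))"
proof -
  have "\<exists>F. \<forall>x. -\<infinity> < ereal x \<longrightarrow> ereal x < \<infinity> \<longrightarrow> (F has_vector_derivative g x) (at x)"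
    by (rule einterval_antiderivative) (use assms in \<open>auto simp: continuous_on_eq_continuous_at\<close>)
  then obtain F where F: "\<And>x. (F has_real_derivative g x) (at x)"
    by (auto simp: has_real_derivative_iff_has_vector_derivative)
  show ?thesis
    by (rule exI[of _ "\<lambda>x. F x - F c"]) (auto intro!: derivative_eq_intros F)
qed

lemma mollifier_step:
  assumes "mollifier e d"
  obtains S where "smooth S" "\<And>x. (S has_real_derivative d x) (at x)"
    "\<And>x. x \<le> -e \<Longrightarrow> S x = 0" "\<And>x. e \<le> x \<Longrightarrow> S x = 1" "mono S"
proof -
  have sm: "smooth d" and nn: "\<And>x. 0 \<le> d x" and z: "\<And>x. e \<le> \<bar>x\<bar> \<Longrightarrow> d x = 0" and
    i: "(LINT x|lborel. d x) = 1" and e: "0 < e" using assms by (auto simp: mollifier_def)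
  obtain S where S0: "S (-e) = 0" and SD: "\<And>x. (S has_real_derivative d x) (at x)"
    using continuous_antiderivative[OF smooth_continuous[OF sm], of "-e"] by auto
  have mono: "S x \<le> S y" if "x \<le> y" for x y
    by (rule DERIV_nonneg_imp_nondecreasing[OF that]) (use SD nn in blast)
  have left: "S x = 0" if "x \<le> -e" for x
  proof -
    have "S x = S (-e)"
    proof (cases "x = -e")
      case False
      show ?thesis
        using that False z
        by (intro DERIV_isconst2[of x "-e" S, symmetric])
          (auto intro!: continuous_at_imp_continuous_on DERIV_isCont SD
            intro: DERIV_cong[OF SD])
    qed simp
    then show ?thesis by (simp add: S0)
  qed
  have se: "S e = 1"
  proof -
    have "(LBINT x. d x * indicator {-e..e} x) = S e - S (-e)"
      by (rule integral_FTC_Icc_real)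
        (use e SD smooth_continuous[OF sm, of UNIV] in \<open>auto simp: continuous_on_eq_continuous_at\<close>)
    also have "(\<lambda>x. d x * indicator {-e..e} x) = d"
    proof
      fix x show "d x * indicator {-e..e} x = d x"
        using z[of x] by (cases "x \<in> {-e..e}") auto
    qed
    finally show ?thesis using i S0 by simp
  qed
  have right: "S x = 1" if "e \<le> x" for x
  proof (cases "x = e")
    case False
    have "S x = S e"
      using that False z e
      by (intro DERIV_isconst2[of e x S])
         (auto intro!: continuous_at_imp_continuous_on DERIV_isCont SD intro: DERIV_cong[OF SD])
    then show ?thesis using se by simp
  qed (simp add: se)
  show ?thesis using that[OF smooth_antiderivative[OF SD sm] SD left right] mono by (auto simp: mono_def)
qed

text \<open>
  The slopes of the plateau are translates of one mollifier, so that integrating against the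
  derivative evaluates the other factor near \<open>a\<close> and near \<open>b\<close>. This serves for the spatial cut-off
  near the ends of \<open>(0,1)\<close>, for the comparison of two times, and for the initial datum.
\<close>

lemma plateau:
  assumes m: "mollifier e d" and ab: "a + 2 * e \<le> b"
  obtains c where "smooth c" "\<And>x. (c has_real_derivative d (x - a) - d (x - b)) (at x)"
    "\<And>x. 0 \<le> c x" "\<And>x. c x \<le> 1" "\<And>x. x \<notin> {a - e..b + e} \<Longrightarrow> c x = 0"
    "\<And>x. x \<in> {a + e..b - e} \<Longrightarrow> c x = 1"
proof -
  obtain S where S: "smooth S" "\<And>x. (S has_real_derivative d x) (at x)"
    "\<And>x. x \<le> -e \<Longrightarrow> S x = 0" "\<And>x. e \<le> x \<Longrightarrow> S x = 1" and mono: "\<And>x y. x \<le> y \<Longrightarrow> S x \<le> S y"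
    using mollifier_step[OF m] by (metis mono_def)
  have e: "e > 0" using m by (simp add: mollifier_def)
  have S01: "0 \<le> S x" "S x \<le> 1" for x
    using S(3)[of "min x (-e)"] S(4)[of "max x e"] mono[of "min x (-e)" x] mono[of x "max x e"] by auto
  show ?thesis
  proof (rule that[of "\<lambda>x. S (x - a) - S (x - b)"])
    show "smooth (\<lambda>x. S (x - a) - S (x - b))"
      using smooth_diff[OF smooth_affine[OF S(1), of 1 "-a"] smooth_affine[OF S(1), of 1 "-b"]] by simp
    fix x
    show "((\<lambda>x. S (x - a) - S (x - b)) has_real_derivative d (x - a) - d (x - b)) (at x)"
      by (auto intro!: derivative_eq_intros DERIV_chain2[OF S(2)])
    show "0 \<le> S (x - a) - S (x - b)" using mono[of "x - b" "x - a"] ab e by simp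
    show "S (x - a) - S (x - b) \<le> 1" using S01[of "x - a"] S01[of "x - b"] by linarith
    show "S (x - a) - S (x - b) = 0" if "x \<notin> {a - e..b + e}"
      using that S(3)[of "x - a"] S(3)[of "x - b"] S(4)[of "x - a"] S(4)[of "x - b"] ab e by auto
    show "S (x - a) - S (x - b) = 1" if "x \<in> {a + e..b - e}"
      using that S(3)[of "x - b"] S(4)[of "x - a"] by auto
  qed
qed

lemma continuous_product:
  assumes "smooth A" "smooth B"
  shows "continuous_on UNIV (\<lambda>(x, t). A x * B t)"
proof -
  have "continuous_on UNIV (\<lambda>p::real \<times> real. A (fst p))" "continuous_on UNIV (\<lambda>p::real \<times> real. B (snd p))"
    using continuous_on_compose2[OF smooth_continuous[OF assms(1), of UNIV], of UNIV fst]
      continuous_on_compose2[OF smooth_continuous[OF assms(2), of UNIV], of UNIV snd]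
    by (auto simp: continuous_on_fst continuous_on_snd continuous_on_id)
  then show ?thesis by (simp add: case_prod_beta continuous_on_mult)
qed

lemma C_k2_product:
  "smooth A \<Longrightarrow> smooth B \<Longrightarrow> C_k2 k (\<lambda>x t. A x * B t)"
proof (induction k arbitrary: A B)
  case 0
  then show ?case using continuous_product by simp
next
  case (Suc k)
  have A: "\<And>x. (A has_real_derivative deriv A x) (at x)" and B: "\<And>x. (B has_real_derivative deriv B x) (at x)"
    using Suc.prems by (auto intro: smooth_DERIV)
  have "dx (\<lambda>x t. A x * B t) = (\<lambda>x t. deriv A x * B t)"
    unfolding dx_def by (intro ext DERIV_imp_deriv) (auto intro!: derivative_eq_intros A)
  moreover have "dt (\<lambda>x t. A x * B t) = (\<lambda>x t. A x * deriv B t)"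
    unfolding dt_def by (intro ext DERIV_imp_deriv) (auto intro!: derivative_eq_intros B)
  moreover have "(\<lambda>y. A y * B t) differentiable at x" "(\<lambda>s. A x * B s) differentiable at t" for x t
    using A[of x] B[of t] 
    by (auto simp: real_differentiable_def intro!: exI derivative_eq_intros)
  ultimately show ?case
    using Suc continuous_product by (simp add: smooth_DERIV(2))
qed

lemma
  assumes "smooth A" "smooth B"
  shows dx_product: "dx (\<lambda>x t. A x * B t) x t = deriv A x * B t"
    and dt_product: "dt (\<lambda>x t. A x * B t) x t = A x * deriv B t"
  using smooth_DERIV(1)[OF assms(1), of x] smooth_DERIV(1)[OF assms(2), of t]
  by (auto simp: dx_def dt_def intro!: DERIV_imp_deriv derivative_eq_intros)

text \<open>The class \<open>C\<^sub>c\<^sup>\<infinity>(a,b)\<close>.\<close>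

definition bump :: "real \<Rightarrow> real \<Rightarrow> (real \<Rightarrow> real) \<Rightarrow> bool" where
  "bump a b g \<longleftrightarrow> smooth g \<and> (\<exists>c d. a < c \<and> d < b \<and> (\<forall>x. x \<notin> {c..d} \<longrightarrow> g x = 0))"

lemma test_function_product:
  assumes "bump 0 1 A" "bump a b B"
  shows "test_function (\<lambda>x t. A x * B t)"
proof -
  obtain c d c' d' where cd: "0 < c" "d < 1" "\<And>x. x \<notin> {c..d} \<Longrightarrow> A x = 0"
    "\<And>x. x \<notin> {c'..d'} \<Longrightarrow> B x = 0" "smooth A" "smooth B"
    using assms by (auto simp: bump_def)
  have sub: "closure {(x, t). A x * B t \<noteq> 0} \<subseteq> {c..d} \<times> {c'..d'}"
  proof (rule closure_minimal)
    have "x \<in> {c..d}" "t \<in> {c'..d'}" if "A x * B t \<noteq> 0" for x t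
      using that cd(3)[of x] cd(4)[of t] by fastforce+
    then show "{(x, t). A x * B t \<noteq> 0} \<subseteq> {c..d} \<times> {c'..d'}" by auto
  qed (simp add: closed_Times)
  moreover have "compact (closure {(x, t). A x * B t \<noteq> 0})"
    using bounded_subset[OF bounded_Times[of "{c..d}" "{c'..d'}"] sub] by (simp add: compact_eq_bounded_closed)
  moreover have "{c..d} \<times> {c'..d'} \<subseteq> {0<..<1} \<times> UNIV" using cd by auto
  ultimately show ?thesis using cd
    by (auto simp: test_function_def C_inf2_def C_k2_product)
qed

section \<open>Continuity of translations in the mean\<close>

lemma nn_integral_lborel_translate:
  fixes h :: "'a::euclidean_space"
  assumes [measurable]: "F \<in> borel_measurable borel"
  shows "(\<integral>\<^sup>+x. F (x + h) \<partial>lborel) = (\<integral>\<^sup>+x. F x \<partial>lborel)"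
proof -
  have "(\<integral>\<^sup>+x. F x \<partial>lborel) = (\<integral>\<^sup>+x. F x \<partial>distr lborel borel ((+) h))"
    by (simp add: lborel_distr_plus)
  also have "\<dots> = (\<integral>\<^sup>+x. F (h + x) \<partial>lborel)"
    by (rule nn_integral_distr) auto
  finally show ?thesis by (simp add: add.commute)
qed

lemma nn_integral_lborel_reflect:
  fixes h :: "'a::euclidean_space"
  assumes [measurable]: "F \<in> borel_measurable borel"
  shows "(\<integral>\<^sup>+x. F (h - x) \<partial>lborel) = (\<integral>\<^sup>+x. F x \<partial>lborel)"
proof -
  have "(\<integral>\<^sup>+x. F x \<partial>lborel) = (\<integral>\<^sup>+x. F x \<partial>density (distr lborel borel (\<lambda>x. h + (-1) *\<^sub>R x)) (\<lambda>_. ennreal (\<bar>-1\<bar> ^ DIM('a))))"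
    using lborel_affine[of "-1" h] by simp
  also have "\<dots> = (\<integral>\<^sup>+x. F x \<partial>distr lborel borel (\<lambda>x. h + (-1) *\<^sub>R x))"
    by (simp add: density_1)
  also have "\<dots> = (\<integral>\<^sup>+x. F (h + (-1) *\<^sub>R x) \<partial>lborel)"
    by (rule nn_integral_distr) auto
  finally show ?thesis by simp
qed

definition translation_continuous :: "('a::euclidean_space \<Rightarrow> real) \<Rightarrow> bool" where
  "translation_continuous g \<longleftrightarrow>
     (\<forall>e>0. \<exists>d>0. \<forall>h. norm h < d \<longrightarrow> (\<integral>\<^sup>+x. ennreal \<bar>g (x + h) - g x\<bar> \<partial>lborel) \<le> ennreal e)"

lemma translation_continuousD:
  fixes g :: "'a::euclidean_space \<Rightarrow> real"
  assumes "translation_continuous g" "0 < e"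
  obtains d where "0 < d" "\<And>h. norm h < d \<Longrightarrow> (\<integral>\<^sup>+x. ennreal \<bar>g (x + h) - g x\<bar> \<partial>lborel) \<le> ennreal e"
  using assms unfolding translation_continuous_def by blast

text \<open>
  Translations preserve \<open>L\<^sup>1\<close> distances, so an approximation error is counted twice and the property
  passes to \<open>L\<^sup>1\<close> limits.
\<close>

lemma translation_continuous_approx:
  fixes g :: "'a::euclidean_space \<Rightarrow> real"
  assumes [measurable]: "g \<in> borel_measurable borel"
    and appr: "\<And>e. 0 < e \<Longrightarrow> \<exists>g'. g' \<in> borel_measurable borel \<and> translation_continuous g' \<and>
      (\<integral>\<^sup>+x. ennreal \<bar>g x - g' x\<bar> \<partial>lborel) \<le> ennreal e"
  shows "translation_continuous g"
  unfolding translation_continuous_def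
proof (intro allI impI)
  fix e :: real assume "0 < e"
  then obtain g' where [measurable]: "g' \<in> borel_measurable borel" and tc: "translation_continuous g'"
    and g': "(\<integral>\<^sup>+x. ennreal \<bar>g x - g' x\<bar> \<partial>lborel) \<le> ennreal (e/3)" using appr[of "e/3"] by auto
  have "0 < e/3" using \<open>0 < e\<close> by simp
  obtain d where "0 < d" and
    d: "\<And>h. norm h < d \<Longrightarrow> (\<integral>\<^sup>+x. ennreal \<bar>g' (x + h) - g' x\<bar> \<partial>lborel) \<le> ennreal (e/3)"
    using translation_continuousD[OF tc \<open>0 < e/3\<close>] by blast
  have "(\<integral>\<^sup>+x. ennreal \<bar>g (x + h) - g x\<bar> \<partial>lborel) \<le> ennreal e" if "norm h < d" for h
  proof -
    have "(\<integral>\<^sup>+x. ennreal \<bar>g (x + h) - g x\<bar> \<partial>lborel) \<le>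
       (\<integral>\<^sup>+x. ennreal \<bar>g (x + h) - g' (x + h)\<bar> + ennreal \<bar>g' (x + h) - g' x\<bar> + ennreal \<bar>g x - g' x\<bar> \<partial>lborel)"
      by (intro nn_integral_mono) (auto simp: ennreal_plus[symmetric] simp del: ennreal_plus intro!: ennreal_leI)
    also have "\<dots> = (\<integral>\<^sup>+x. ennreal \<bar>g (x + h) - g' (x + h)\<bar> \<partial>lborel) +
        (\<integral>\<^sup>+x. ennreal \<bar>g' (x + h) - g' x\<bar> \<partial>lborel) + (\<integral>\<^sup>+x. ennreal \<bar>g x - g' x\<bar> \<partial>lborel)"
      by (subst nn_integral_add, simp, simp, subst nn_integral_add) auto
    also have "(\<integral>\<^sup>+x. ennreal \<bar>g (x + h) - g' (x + h)\<bar> \<partial>lborel) = (\<integral>\<^sup>+x. ennreal \<bar>g x - g' x\<bar> \<partial>lborel)"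
      by (rule nn_integral_lborel_translate[where F="\<lambda>x. ennreal \<bar>g x - g' x\<bar>"]) simp
    also have "(\<integral>\<^sup>+x. ennreal \<bar>g x - g' x\<bar> \<partial>lborel) + (\<integral>\<^sup>+x. ennreal \<bar>g' (x + h) - g' x\<bar> \<partial>lborel)
        + (\<integral>\<^sup>+x. ennreal \<bar>g x - g' x\<bar> \<partial>lborel) \<le> ennreal (e/3) + ennreal (e/3) + ennreal (e/3)"
      by (intro add_mono g' d that)
    also have "\<dots> = ennreal e" using \<open>0 < e\<close> by (simp add: ennreal_plus[symmetric] del: ennreal_plus)
    finally show ?thesis .
  qed
  with \<open>0 < d\<close> show "\<exists>d>0. \<forall>h. norm h < d \<longrightarrow> (\<integral>\<^sup>+x. ennreal \<bar>g (x + h) - g x\<bar> \<partial>lborel) \<le> ennreal e"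
    by blast
qed

text \<open>
  Choose an open \<open>U \<supseteq> A\<close> of nearly the same measure. The points of \<open>A\<close> at distance at least \<open>1/n\<close>
  from the complement of \<open>U\<close> exhaust \<open>A\<close>; call this set \<open>K\<close>. A translation shorter than \<open>1/n\<close> keeps \<open>K\<close>
  inside \<open>U\<close>, so the indicator can change at \<open>x\<close> only if \<open>x\<close> or its translate lies in the small set
  \<open>(U - A) \<union> (A - K)\<close>.
\<close>

lemma translation_continuous_indicator:
  fixes A :: "'a::euclidean_space set" and c :: real
  assumes A[measurable]: "A \<in> sets borel" and fin: "emeasure lborel A < \<infinity>"
  shows "translation_continuous (\<lambda>x. indicator A x *\<^sub>R c)"
  unfolding translation_continuous_def
proof (intro allI impI)
  fix e :: real assume "0 < e"
  define e' where "e' = e / (4 * (\<bar>c\<bar> + 1))"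
  have "0 < e'" using \<open>0 < e\<close> by (simp add: e'_def)
  obtain U where U: "open U" "A \<subseteq> U" "emeasure lborel (U - A) < ennreal e'"
    using outer_regular_lborel[of A e'] A \<open>0 < e'\<close> by auto
  have [measurable]: "U \<in> sets borel" using U by auto
  define K where "K n = A \<inter> {x. ball x (1 / Suc n) \<subseteq> U}" for n
  have "closed {x. ball x (1 / Suc n) \<subseteq> U}" for n
  proof -
    have "- {x. ball x (1 / Suc n) \<subseteq> U} = (\<Union>y\<in>-U. ball y (1 / Suc n))"
      by (auto simp: subset_iff dist_commute)
    then show ?thesis by (metis closed_def open_UN open_ball)
  qed
  then have K[measurable]: "K n \<in> sets borel" for n unfolding K_def by auto
  have "decseq (\<lambda>n. A - K n)"
  proof (rule decseq_SucI)
    fix n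
    have "ball x (1 / Suc (Suc n)) \<subseteq> ball x (1 / Suc n)" for x :: 'a
      by (rule subset_ball) (simp add: frac_le)
    then show "A - K (Suc n) \<subseteq> A - K n" unfolding K_def by auto
  qed
  moreover have "(\<Inter>n. A - K n) = {}"
  proof -
    have "\<exists>n. x \<in> K n" if xA: "x \<in> A" for x
    proof -
      obtain r where "0 < r" "ball x r \<subseteq> U" using U xA by (meson openE subsetD)
      moreover obtain n where "1 / real (Suc n) < r"
        using nat_approx_posE[OF \<open>0 < r\<close>] by auto
      ultimately show ?thesis using xA subset_ball[of "1 / Suc n" r x] unfolding K_def by auto
    qed
    then show ?thesis by auto
  qed
  moreover have "emeasure lborel (A - K n) \<noteq> \<infinity>" for n
    using fin emeasure_mono[of "A - K n" A lborel] by (auto simp: top_unique)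
  ultimately have "(\<lambda>n. emeasure lborel (A - K n)) \<longlonglongrightarrow> emeasure lborel {}"
    using Lim_emeasure_decseq[of "\<lambda>n. A - K n" lborel] by (simp only: image_subset_iff) simp
  then have "eventually (\<lambda>n. emeasure lborel (A - K n) < ennreal e') sequentially"
    using \<open>0 < e'\<close> by (intro order_tendstoD) auto
  then obtain n where n: "emeasure lborel (A - K n) < ennreal e'"
    by (auto simp: eventually_sequentially)
  define D where "D = (U - A) \<union> (A - K n)"
  have D[measurable]: "D \<in> sets borel" unfolding D_def by auto
  have "emeasure lborel D \<le> emeasure lborel (U - A) + emeasure lborel (A - K n)"
    unfolding D_def by (rule emeasure_subadditive) auto
  also have "\<dots> \<le> ennreal e' + ennreal e'" using U n by (intro add_mono) auto
  also have "\<dots> = ennreal (2 * e')" using \<open>0 < e'\<close> by (simp add: ennreal_plus[symmetric] del: ennreal_plus)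
  finally have D2: "emeasure lborel D \<le> ennreal (2 * e')" .
  have "(\<integral>\<^sup>+x. ennreal \<bar>indicator A (x + h) *\<^sub>R c - indicator A x *\<^sub>R c\<bar> \<partial>lborel) \<le> ennreal e"
    if h: "norm h < 1 / Suc n" for h
  proof -
    have near: "y \<in> U" if "x \<in> K n" "dist x y < 1 / Suc n" for x y
      using that unfolding K_def by (auto simp: subset_iff)
    have "\<bar>indicator A (x + h) *\<^sub>R c - indicator A x *\<^sub>R c\<bar> \<le> \<bar>c\<bar> * (indicator D (x + h) + indicator D x)" for x
      using near[of x "x + h"] near[of "x + h" x] h U(2)
      by (auto simp: D_def indicator_def dist_norm split: if_splits)
    then have "(\<integral>\<^sup>+x. ennreal \<bar>indicator A (x + h) *\<^sub>R c - indicator A x *\<^sub>R c\<bar> \<partial>lborel) \<le>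
        (\<integral>\<^sup>+x. ennreal \<bar>c\<bar> * (indicator D (x + h) + indicator D x) \<partial>lborel)"
      by (intro nn_integral_mono) (auto simp: ennreal_mult[symmetric] ennreal_indicator[symmetric]
           ennreal_plus[symmetric] simp del: ennreal_plus intro!: ennreal_leI)
    also have "\<dots> = ennreal \<bar>c\<bar> * ((\<integral>\<^sup>+x. indicator D (x + h) \<partial>lborel) + (\<integral>\<^sup>+x. indicator D x \<partial>lborel))"
      by (simp add: nn_integral_cmult nn_integral_add)
    also have "(\<integral>\<^sup>+x. indicator D (x + h) \<partial>lborel) = (\<integral>\<^sup>+x. indicator D x \<partial>lborel)"
      by (rule nn_integral_lborel_translate) simp
    also have "ennreal \<bar>c\<bar> * ((\<integral>\<^sup>+x. indicator D x \<partial>lborel) + (\<integral>\<^sup>+x. indicator D x \<partial>lborel)) \<le>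
        ennreal \<bar>c\<bar> * (ennreal (2 * e') + ennreal (2 * e'))"
      by (intro mult_left_mono add_mono) (auto simp: D2)
    also have "\<dots> = ennreal (\<bar>c\<bar> * (4 * e'))"
      using \<open>0 < e'\<close> by (simp add: ennreal_plus[symmetric] ennreal_mult[symmetric] del: ennreal_plus)
    also have "\<dots> \<le> ennreal e"
      using \<open>0 < e\<close> by (intro ennreal_leI) (simp add: e'_def field_simps)
    finally show ?thesis .
  qed
  then show "\<exists>d>0. \<forall>h. norm h < d \<longrightarrow>
     (\<integral>\<^sup>+x. ennreal \<bar>indicator A (x + h) *\<^sub>R c - indicator A x *\<^sub>R c\<bar> \<partial>lborel) \<le> ennreal e"
    by (intro exI[of _ "1 / Suc n"]) auto
qed

lemma integrable_translation_continuous: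
  fixes g :: "'a::euclidean_space \<Rightarrow> real"
  assumes "integrable lborel g"
  shows "translation_continuous g"
  using assms
proof (induction rule: integrable_induct)
  case (base A c)
  then show ?case using translation_continuous_indicator by auto
next
  case (add f g)
  have [measurable]: "f \<in> borel_measurable borel" "g \<in> borel_measurable borel" using add by auto
  show ?case
    unfolding translation_continuous_def
  proof (intro allI impI)
    fix e :: real assume "0 < e"
    then have "0 < e/2" by simp
    obtain d1 where d1: "0 < d1"
      "\<And>h. norm h < d1 \<Longrightarrow> (\<integral>\<^sup>+x. ennreal \<bar>f (x + h) - f x\<bar> \<partial>lborel) \<le> ennreal (e/2)"
      using translation_continuousD[OF add(3) \<open>0 < e/2\<close>] by blast
    obtain d2 where d2: "0 < d2"
      "\<And>h. norm h < d2 \<Longrightarrow> (\<integral>\<^sup>+x. ennreal \<bar>g (x + h) - g x\<bar> \<partial>lborel) \<le> ennreal (e/2)"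
      using translation_continuousD[OF add(4) \<open>0 < e/2\<close>] by blast
    note d = d1 d2
    have "(\<integral>\<^sup>+x. ennreal \<bar>(f (x + h) + g (x + h)) - (f x + g x)\<bar> \<partial>lborel) \<le> ennreal e"
      if "norm h < min d1 d2" for h
    proof -
      have "(\<integral>\<^sup>+x. ennreal \<bar>(f (x + h) + g (x + h)) - (f x + g x)\<bar> \<partial>lborel) \<le>
        (\<integral>\<^sup>+x. ennreal \<bar>f (x + h) - f x\<bar> + ennreal \<bar>g (x + h) - g x\<bar> \<partial>lborel)"
        by (intro nn_integral_mono) (auto simp: ennreal_plus[symmetric] simp del: ennreal_plus intro!: ennreal_leI)
      also have "\<dots> = (\<integral>\<^sup>+x. ennreal \<bar>f (x + h) - f x\<bar> \<partial>lborel) + (\<integral>\<^sup>+x. ennreal \<bar>g (x + h) - g x\<bar> \<partial>lborel)"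
        by (rule nn_integral_add) auto
      also have "\<dots> \<le> ennreal (e/2) + ennreal (e/2)" using d that by (intro add_mono) auto
      also have "\<dots> = ennreal e" using \<open>0 < e\<close> by (simp add: ennreal_plus[symmetric] del: ennreal_plus)
      finally show ?thesis .
    qed
    with d show "\<exists>d>0. \<forall>h. norm h < d \<longrightarrow>
        (\<integral>\<^sup>+x. ennreal \<bar>(f (x + h) + g (x + h)) - (f x + g x)\<bar> \<partial>lborel) \<le> ennreal e"
      by (intro exI[of _ "min d1 d2"]) auto
  qed
next
  case (lim f s)
  have [measurable]: "f \<in> borel_measurable borel" "\<And>i. s i \<in> borel_measurable borel" using lim by auto
  have "(\<lambda>i. \<integral>\<^sup>+x. ennreal (norm (f x - s i x)) \<partial>lborel) \<longlonglongrightarrow> 0"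
  proof (rule nn_integral_dominated_convergence_norm[where w="\<lambda>x. 2 * norm (f x)"])
    show "(\<integral>\<^sup>+x. ennreal (2 * norm (f x)) \<partial>lborel) < \<infinity>"
      using \<open>integrable lborel f\<close> by (simp add: integrable_iff_bounded ennreal_mult' nn_integral_cmult ennreal_mult_less_top)
  qed (use lim in auto)
  then have ev: "eventually (\<lambda>i. (\<integral>\<^sup>+x. ennreal (norm (f x - s i x)) \<partial>lborel) < ennreal e) sequentially" if "0 < e" for e
    using that by (intro order_tendstoD) auto
  show ?case
  proof (rule translation_continuous_approx)
    fix e :: real assume "0 < e"
    then obtain i where "(\<integral>\<^sup>+x. ennreal (norm (f x - s i x)) \<partial>lborel) < ennreal e"
      using ev by (auto simp: eventually_sequentially)
    then show "\<exists>g'. g' \<in> borel_measurable borel \<and> translation_continuous g' \<and>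
        (\<integral>\<^sup>+x. ennreal \<bar>f x - g' x\<bar> \<partial>lborel) \<le> ennreal e"
      using lim by (intro exI[of _ "s i"]) auto
  qed simp
qed

text \<open>
  After the substitution \<open>q = p - z\<close> the double integral is an average, with weight \<open>J\<close>, of \<open>L\<^sup>1\<close>
  distances between \<open>g\<close> and its translates by \<open>-z\<close>. It quantifies both the passage to the diagonal
  in the doubling argument and the convergence of mollifications.
\<close>

lemma mollification_error:
  fixes g J :: "'a::euclidean_space \<Rightarrow> real"
  assumes [measurable]: "g \<in> borel_measurable borel" "J \<in> borel_measurable borel"
    and J: "\<And>z. 0 \<le> J z" "\<And>z. r \<le> norm z \<Longrightarrow> J z = 0"
    and r: "\<And>h. norm h < r \<Longrightarrow> (\<integral>\<^sup>+x. ennreal \<bar>g (x + h) - g x\<bar> \<partial>lborel) \<le> e"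
  shows "(\<integral>\<^sup>+p. \<integral>\<^sup>+q. ennreal (\<bar>g q - g p\<bar> * J (p - q)) \<partial>lborel \<partial>lborel) \<le> e * (\<integral>\<^sup>+z. ennreal (J z) \<partial>lborel)"
proof -
  have "(\<integral>\<^sup>+p. \<integral>\<^sup>+q. ennreal (\<bar>g q - g p\<bar> * J (p - q)) \<partial>lborel \<partial>lborel) =
      (\<integral>\<^sup>+p. \<integral>\<^sup>+z. ennreal (\<bar>g (p - z) - g p\<bar> * J z) \<partial>lborel \<partial>lborel)"
  proof (rule nn_integral_cong)
    fix p
    show "(\<integral>\<^sup>+q. ennreal (\<bar>g q - g p\<bar> * J (p - q)) \<partial>lborel) = (\<integral>\<^sup>+z. ennreal (\<bar>g (p - z) - g p\<bar> * J z) \<partial>lborel)"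
      using nn_integral_lborel_reflect[of "\<lambda>q. ennreal (\<bar>g q - g p\<bar> * J (p - q))" p] by simp
  qed
  also have "\<dots> = (\<integral>\<^sup>+z. \<integral>\<^sup>+p. ennreal (\<bar>g (p - z) - g p\<bar> * J z) \<partial>lborel \<partial>lborel)"
    by (rule lborel_pair.Fubini') simp
  also have "\<dots> = (\<integral>\<^sup>+z. ennreal (J z) * (\<integral>\<^sup>+p. ennreal \<bar>g (p + (- z)) - g p\<bar> \<partial>lborel) \<partial>lborel)"
    by (intro nn_integral_cong) (simp add: nn_integral_cmult[symmetric] ennreal_mult[symmetric] J mult.commute)
  also have "\<dots> \<le> (\<integral>\<^sup>+z. ennreal (J z) * e \<partial>lborel)"
  proof (rule nn_integral_mono)
    fix z :: 'a
    show "ennreal (J z) * (\<integral>\<^sup>+p. ennreal \<bar>g (p + (- z)) - g p\<bar> \<partial>lborel) \<le> ennreal (J z) * e"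
      using r[of "- z"] J(2)[of z] by (cases "norm z < r") (auto intro!: mult_left_mono)
  qed
  also have "\<dots> = e * (\<integral>\<^sup>+z. ennreal (J z) \<partial>lborel)"
    by (subst nn_integral_multc) (auto simp: mult.commute)
  finally show ?thesis .
qed

section \<open>Bounded representatives on the space-time rectangle\<close>

lemma abs_mult_le:
  fixes x y a b :: real
  shows "\<bar>x\<bar> \<le> a \<Longrightarrow> \<bar>y\<bar> \<le> b \<Longrightarrow> \<bar>x * y\<bar> \<le> a * b"
  unfolding abs_mult by (intro mult_mono) auto

lemma continuous_bounded:
  fixes h :: "real \<Rightarrow> real"
  assumes "continuous_on UNIV h"
  obtains C where "0 \<le> C" "\<And>w. \<bar>w\<bar> \<le> M \<Longrightarrow> \<bar>h w\<bar> \<le> C"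
proof -
  have "bounded (h ` {-M..M})"
    by (intro compact_imp_bounded compact_continuous_image continuous_on_subset[OF assms]) auto
  then obtain C where "\<forall>y\<in>h ` {-M..M}. norm y \<le> C" using bounded_iff by metis
  then have "\<bar>h w\<bar> \<le> max C 0" if "\<bar>w\<bar> \<le> M" for w
    using that by (auto simp: abs_le_iff le_max_iff_disj)
  then show ?thesis using that[of "max C 0"] by simp
qed

lemma integrable_bounded_support:
  fixes f :: "'a::euclidean_space \<Rightarrow> real"
  assumes "f \<in> borel_measurable borel" "\<And>x. \<bar>f x\<bar> \<le> C" "bounded S" "\<And>x. x \<notin> S \<Longrightarrow> f x = 0"
  shows "integrable lborel f"
proof -
  obtain r where "S \<subseteq> cball 0 r"
    using bounded_subset_ballD[OF assms(3), of 0] by (meson ball_subset_cball order_trans)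
  then have "f x = 0" if "x \<notin> cball 0 r" for x using assms(4) that by blast
  moreover have "emeasure lborel (cball (0::'a) r) < \<infinity>" by (rule emeasure_compact_finite) simp
  ultimately show ?thesis
    using assms(1,2) by (intro integrableI_bounded_set[where A="cball 0 r" and B=C]) (auto simp del: mem_cball)
qed

lemma AE_slices:
  fixes Q :: "real \<times> real \<Rightarrow> bool"
  assumes "AE p in lborel. Q p"
  shows "AE x in lborel. AE t in lborel. Q (x, t)" and "AE t in lborel. AE x in lborel. Q (x, t)"
proof -
  obtain N where N: "{p. \<not> Q p} \<subseteq> N" "N \<in> null_sets lborel"
    using assms by (auto simp: eventually_ae_filter)
  then have [measurable]: "N \<in> sets borel" by (auto simp: null_sets_def)
  have "AE p in lborel \<Otimes>\<^sub>M lborel. p \<notin> N" using N(2) by (simp add: AE_not_in lborel_prod)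
  then have 1: "AE x in lborel. AE t in lborel. (x, t) \<notin> N" by (rule lborel_pair.AE_pair)
  have "{p \<in> space (lborel \<Otimes>\<^sub>M lborel). (fst p, snd p) \<notin> N} \<in> sets (lborel \<Otimes>\<^sub>M lborel)"
    using borel_comp[OF \<open>N \<in> sets borel\<close>]
    unfolding lborel_prod by (simp add: Compl_eq)
  from lborel_pair.AE_commute[of "\<lambda>x t. (x, t) \<notin> N", OF this] 1
  have 2: "AE t in lborel. AE x in lborel. (x, t) \<notin> N" by simp
  show "AE x in lborel. AE t in lborel. Q (x, t)"
    using 1 by eventually_elim (erule eventually_mono, use N in auto)
  show "AE t in lborel. AE x in lborel. Q (x, t)"
    using 2 by eventually_elim (erule eventually_mono, use N in auto)
qed

lemma
  fixes F :: "real \<times> real \<Rightarrow> real"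
  assumes [measurable]: "F \<in> borel_measurable borel"
  shows borel_measurable_slice_fst: "(\<lambda>x. F (x, t)) \<in> borel_measurable borel"
    and borel_measurable_slice_snd: "(\<lambda>t. F (x, t)) \<in> borel_measurable borel"
    and borel_measurable_integral_fst: "(\<lambda>t. \<integral>x. F (x, t) \<partial>lborel) \<in> borel_measurable borel"
  by measurable

lemma integral_plane:
  fixes F :: "'a::euclidean_space \<times> 'b::euclidean_space \<Rightarrow> real"
  assumes "integrable lborel F"
  shows "(\<integral>t. \<integral>x. F (x, t) \<partial>lborel \<partial>lborel) = (\<integral>p. F p \<partial>lborel)"
    and "(\<integral>x. \<integral>t. F (x, t) \<partial>lborel \<partial>lborel) = (\<integral>p. F p \<partial>lborel)"
    and "integrable lborel (\<lambda>t. \<integral>x. F (x, t) \<partial>lborel)"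
    and "integrable lborel (\<lambda>x. \<integral>t. F (x, t) \<partial>lborel)"
proof -
  have i: "integrable (lborel \<Otimes>\<^sub>M lborel) (\<lambda>(x, t). F (x, t))" using assms by (simp add: lborel_prod)
  show "(\<integral>t. \<integral>x. F (x, t) \<partial>lborel \<partial>lborel) = (\<integral>p. F p \<partial>lborel)"
    using lborel_pair.integral_snd[OF i] by (simp add: lborel_prod)
  show "(\<integral>x. \<integral>t. F (x, t) \<partial>lborel \<partial>lborel) = (\<integral>p. F p \<partial>lborel)"
    using lborel_pair.integral_fst[OF i] by (simp add: lborel_prod)
  show "integrable lborel (\<lambda>t. \<integral>x. F (x, t) \<partial>lborel)"
    using lborel_pair.integrable_snd[OF i] by simp
  show "integrable lborel (\<lambda>x. \<integral>t. F (x, t) \<partial>lborel)"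
    using lborel_pair.integrable_fst[OF i] by simp
qed

lemma bump_deriv:
  assumes "bump a b A" shows "bump a b (deriv A)"
proof -
  obtain c d where cd: "a < c" "d < b" "\<And>x. x \<notin> {c..d} \<Longrightarrow> A x = 0" and sm: "smooth A"
    using assms by (auto simp: bump_def)
  have "deriv A x = 0" if "x \<notin> {c..d}" for x
  proof -
    have "((\<lambda>x. 0) has_real_derivative 0) (at x)" by simp
    then have "(A has_real_derivative 0) (at x)"
      by (rule has_field_derivative_transform_within_open[where S="- {c..d}"]) (use that cd in auto)
    then show ?thesis by (rule DERIV_imp_deriv)
  qed
  then show ?thesis using cd sm smooth_DERIV(2) unfolding bump_def by blast
qed

lemma bump_zero: "bump a b A \<Longrightarrow> x \<notin> {a<..<b} \<Longrightarrow> A x = 0"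
  unfolding bump_def by force

lemma bump_measurable: "bump a b A \<Longrightarrow> A \<in> borel_measurable borel"
  by (simp add: bump_def smooth_continuous borel_measurable_continuous_onI)

lemma bump_bounded: assumes "bump a b A" obtains C where "0 < C" "\<And>x. \<bar>A x\<bar> \<le> C"
proof -
  have "compact (A ` {a..b})"
    using assms by (intro compact_continuous_image) (auto simp: bump_def smooth_continuous)
  then obtain C where "\<forall>y\<in>A ` {a..b}. norm y \<le> C" 
    using compact_imp_bounded bounded_iff by metis
  then have C: "\<bar>A x\<bar> \<le> C" if "x \<in> {a..b}" for x using that by auto
  have "\<bar>A x\<bar> \<le> max C 1" for x
    using C[of x] bump_zero[OF assms, of x] by (cases "x \<in> {a..b}") auto
  then show ?thesis using that[of "max C 1"] by auto
qed

lemma integrable_mult_bump: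
  assumes k: "integrable lborel k" and A: "bump a b A"
  shows "integrable lborel (\<lambda>x. k x * A x)"
proof -
  obtain C where C: "0 < C" "\<And>x. \<bar>A x\<bar> \<le> C" using bump_bounded[OF A] by metis
  have m: "(\<lambda>x. k x * A x) \<in> borel_measurable lborel"
    using borel_measurable_integrable[OF k] bump_measurable[OF A] by simp
  have "norm (k x * A x) \<le> norm (C * k x)" for x
    using mult_left_mono[OF C(2)[of x], of "\<bar>k x\<bar>"] C(1) by (simp add: abs_mult mult.commute)
  then show ?thesis
    by (intro Bochner_Integration.integrable_bound[OF integrable_mult_right[OF k, of C] m]) simp
qed

lemma C_k_2D:
  assumes "C_k 2 g"
  shows "(g has_real_derivative deriv g x) (at x)"
    and "(deriv g has_real_derivative deriv (deriv g) x) (at x)"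
    and "continuous_on S g" "continuous_on S (deriv g)"
proof -
  have *: "(deriv ^^ i) g differentiable (at x)" if "i < 2" for i x
    using assms that by (auto simp: C_k_def)
  show 1: "(g has_real_derivative deriv g x) (at x)" for x
    using *[of 0 x] by (simp add: DERIV_deriv_iff_real_differentiable)
  show 2: "(deriv g has_real_derivative deriv (deriv g) x) (at x)" for x
    using *[of 1 x] by (simp add: DERIV_deriv_iff_real_differentiable)
  show "continuous_on S g" "continuous_on S (deriv g)"
    by (rule continuous_on_real_derivative[OF 1], rule continuous_on_real_derivative[OF 2])
qed

lemma C_k_2I:
  assumes "\<And>x. (g has_real_derivative g' x) (at x)"
    and "\<And>x. (g' has_real_derivative g'' x) (at x)" and "continuous_on UNIV g''"
  shows "C_k 2 g" and "deriv g = g'"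
proof -
  show 1: "deriv g = g'" using assms(1) by (auto intro: DERIV_imp_deriv)
  have 2: "deriv g' = g''" using assms(2) by (auto intro: DERIV_imp_deriv)
  have "(deriv ^^ i) g differentiable (at x)" if "i < 2" for i x
    using that assms(1,2) 1 by (cases i) (auto simp: real_differentiable_def less_Suc_eq numeral_2_eq_2)
  then show "C_k 2 g" using 1 2 assms(3) by (simp add: C_k_def numeral_2_eq_2)
qed

text \<open>
  The constant of integration in \<open>q\<close> is fixed by \<open>q k = 0\<close>, as in the Kruzkov entropy flux
  \<open>sgn(w - k) (f(w) - f(k))\<close>.
\<close>

lemma entropy_pair_exists:
  assumes f: "C_k 2 f"
    and d1: "\<And>x. (g has_real_derivative g' x) (at x)"
    and d2: "\<And>x. (g' has_real_derivative g'' x) (at x)"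
    and c: "continuous_on UNIV g''" and nn: "\<And>x. 0 \<le> g'' x"
  obtains q where "entropy_pair f g q" "q k = 0"
    "\<And>x. (q has_real_derivative g' x * deriv f x) (at x)" "deriv g = g'" "continuous_on UNIV q"
proof -
  note g = C_k_2I[OF d1 d2 c]
  have "continuous_on UNIV g'" by (rule continuous_on_real_derivative[OF d2])
  then have "continuous_on UNIV (\<lambda>x. g' x * deriv f x)"
    using C_k_2D(4)[OF f] by (intro continuous_intros)
  then obtain q where q: "q k = 0" "\<And>x. (q has_real_derivative g' x * deriv f x) (at x)"
    using continuous_antiderivative[of _ k] by blast
  have "convex_on UNIV g"
    by (rule f''_ge0_imp_convex[where f'=g' and f''=g'']) (use d1 d2 nn in auto)
  then have "entropy_pair f g q" using g q by (simp add: entropy_pair_def)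
  moreover have "continuous_on UNIV q"
    by (rule continuous_on_real_derivative[OF q(2)])
  ultimately show ?thesis using that q g(2) by blast
qed

definition rect :: "real \<Rightarrow> (real \<times> real) set" where
  "rect T = {0<..<1} \<times> {0<..<T}"

definition bounded_on_rect :: "real \<Rightarrow> real \<Rightarrow> (real \<times> real \<Rightarrow> real) \<Rightarrow> bool" where
  "bounded_on_rect T M U \<longleftrightarrow> U \<in> borel_measurable borel \<and> (\<forall>p. \<bar>U p\<bar> \<le> M) \<and> (\<forall>p. p \<notin> rect T \<longrightarrow> U p = 0)"

text \<open>
  The nonlocal term \<open>P[U]\<close> of the equation, cut off outside the rectangle to keep it bounded.
\<close>

definition primitive_x :: "real \<Rightarrow> (real \<times> real \<Rightarrow> real) \<Rightarrow> real \<times> real \<Rightarrow> real" where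
  "primitive_x T U p = indicator (rect T) p * (\<integral>y. indicator {0<..<fst p} y * U (y, snd p) \<partial>lborel)"

lemma rect_sets[measurable]: "rect T \<in> sets borel"
  by (simp add: rect_def open_Times borel_open)

lemma bounded_rect: "bounded (rect T)"
  unfolding rect_def by (intro bounded_Times) auto

lemma primitive_x_measurable[measurable]:
  assumes [measurable]: "U \<in> borel_measurable borel"
  shows "primitive_x T U \<in> borel_measurable borel"
proof -
  have eq: "indicator {0<..<fst p} y = (if 0 < y \<and> y < fst p then 1 else (0::real))" for p :: "real \<times> real" and y
    by (auto simp: indicator_def)
  have "(\<lambda>z. (snd z, snd (fst z))) \<in> (borel :: (real \<times> real) measure) \<Otimes>\<^sub>M (lborel :: real measure) \<rightarrow>\<^sub>M borel"
    "(\<lambda>z. fst (fst z)) \<in> (borel :: (real \<times> real) measure) \<Otimes>\<^sub>M (lborel :: real measure) \<rightarrow>\<^sub>M borel"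
    by (intro borel_measurable_Pair measurable_compose[OF measurable_fst] borel_measurable_continuous_onI
        continuous_intros; simp)+
  then have [measurable]: "(\<lambda>z. U (snd z, snd (fst z))) \<in> borel_measurable ((borel :: (real \<times> real) measure) \<Otimes>\<^sub>M (lborel :: real measure))"
    "(\<lambda>z. fst (fst z)) \<in> borel_measurable ((borel :: (real \<times> real) measure) \<Otimes>\<^sub>M (lborel :: real measure))"
    by (auto intro: measurable_compose[OF _ assms])
  have "(\<lambda>(p, y). (if 0 < y \<and> y < fst p then 1 else (0::real)) * U (y, snd p))
      \<in> borel_measurable ((borel :: (real \<times> real) measure) \<Otimes>\<^sub>M lborel)"
    unfolding case_prod_beta by measurable
  then have [measurable]: "(\<lambda>p. \<integral>y. (if 0 < y \<and> y < fst p then 1 else (0::real)) * U (y, snd p) \<partial>lborel)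
      \<in> borel_measurable borel"
    by (rule lborel.borel_measurable_lebesgue_integral)
  show ?thesis unfolding primitive_x_def[abs_def] eq by measurable
qed

lemma slice_integrable:
  assumes "bounded_on_rect T M U" shows "integrable lborel (\<lambda>x. U (x, t))"
proof -
  have [measurable]: "U \<in> borel_measurable borel" using assms by (simp add: bounded_on_rect_def)
  show ?thesis
    by (rule integrable_bounded_support[where C=M and S="{0<..<1}"])
      (use assms in \<open>auto simp: bounded_on_rect_def rect_def intro: borel_measurable_slice_fst\<close>)
qed

lemma primitive_x_bounded:
  assumes "bounded_on_rect T M U" shows "bounded_on_rect T M (primitive_x T U)"
proof -
  have [measurable]: "U \<in> borel_measurable borel" and M: "\<And>p. \<bar>U p\<bar> \<le> M" 
    using assms by (auto simp: bounded_on_rect_def)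
  have "0 \<le> M" using M[of 0] by linarith
  have "\<bar>primitive_x T U p\<bar> \<le> M" for p
  proof (cases "p \<in> rect T")
    case True
    then have x: "0 < fst p" "fst p < 1" by (auto simp: rect_def)
    have "\<bar>primitive_x T U p\<bar> = norm (\<integral>y. indicator {0<..<fst p} y * U (y, snd p) \<partial>lborel)"
      using True by (simp add: primitive_x_def)
    also have "\<dots> \<le> (\<integral>y. indicator {0<..<fst p} y * M \<partial>lborel)"
    proof (rule Bochner_Integration.integral_norm_bound_integral)
      show "integrable lborel (\<lambda>y. indicator {0<..<fst p} y * U (y, snd p))"
        using integrable_real_mult_indicator[OF _ slice_integrable[OF assms, of "snd p"], of "{0<..<fst p}"]
        by (simp add: mult.commute)
      show "integrable lborel (\<lambda>y. indicator {0<..<fst p} y * M)" using x by simp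
    qed (use M in \<open>auto simp: indicator_def\<close>)
    also have "\<dots> = fst p * M" using x by simp
    also have "\<dots> \<le> M" using x \<open>0 \<le> M\<close> by (simp add: mult_left_le_one_le)
    finally show ?thesis .
  qed (simp add: primitive_x_def \<open>0 \<le> M\<close>)
  then show ?thesis by (auto simp: bounded_on_rect_def primitive_x_def)
qed

section \<open>From smooth entropies to Kruzkov entropies\<close>

lemma
  fixes A :: "'a::euclidean_space \<Rightarrow> real"
  assumes A: "A \<in> borel_measurable borel"
  shows borel_measurable_comp_fst: "(\<lambda>p::'a \<times> 'b::euclidean_space. A (fst p)) \<in> borel_measurable borel"
    and borel_measurable_comp_snd: "(\<lambda>p::'b \<times> 'a. A (snd p)) \<in> borel_measurable borel"
  by (rule measurable_compose[OF borel_measurable_continuous_onI[OF continuous_on_fst[OF continuous_on_id]] A],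
      rule measurable_compose[OF borel_measurable_continuous_onI[OF continuous_on_snd[OF continuous_on_id]] A])

text \<open>
  A solution is bounded only almost everywhere and is arbitrary outside the rectangle. It is replaced
  by a Borel function that is bounded everywhere and vanishes outside, so that all integrals become
  integrals over the plane of bounded functions with bounded support.
\<close>

definition representative :: "real \<Rightarrow> real \<Rightarrow> (real \<Rightarrow> real \<Rightarrow> real) \<Rightarrow> (real \<times> real \<Rightarrow> real) \<Rightarrow> bool" where
  "representative T M u U \<longleftrightarrow> bounded_on_rect T M U \<and>
     (AE p in lborel. p \<in> rect T \<longrightarrow> U p = u (fst p) (snd p))"

lemma bounded_on_rect_mono: "bounded_on_rect T M U \<Longrightarrow> M \<le> M' \<Longrightarrow> bounded_on_rect T M' U"
  unfolding bounded_on_rect_def by (meson order_trans)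

lemma in_Linf_measurable:
  assumes "in_Linf T u"
  shows "(\<lambda>p. indicator (rect T) p * u (fst p) (snd p)) \<in> borel_measurable borel"
  using assms by (auto simp: in_Linf_def set_borel_measurable_def rect_def case_prod_beta)

lemma representative_exists:
  assumes "in_Linf T u" obtains M U where "representative T M u U"
proof -
  define u' where "u' p = indicator (rect T) p * u (fst p) (snd p)" for p
  have [measurable]: "u' \<in> borel_measurable borel"
    using in_Linf_measurable[OF assms] unfolding u'_def[abs_def] .
  obtain M where M: "AE p in lborel. p \<in> rect T \<longrightarrow> \<bar>u (fst p) (snd p)\<bar> \<le> M"
    using assms by (auto simp: in_Linf_def rect_def case_prod_beta mem_Times_iff)
  define U where "U p = (if \<bar>u' p\<bar> \<le> max M 0 then u' p else 0)" for p
  have "bounded_on_rect T (max M 0) U"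
    unfolding bounded_on_rect_def
  proof (intro conjI allI impI)
    show "U \<in> borel_measurable borel" unfolding U_def[abs_def] by measurable
    show "\<bar>U p\<bar> \<le> max M 0" for p by (simp add: U_def)
    show "U p = 0" if "p \<notin> rect T" for p using that by (simp add: U_def u'_def)
  qed
  moreover have "AE p in lborel. p \<in> rect T \<longrightarrow> U p = u (fst p) (snd p)"
    using M by eventually_elim (auto simp: U_def u'_def)
  ultimately show ?thesis using that unfolding representative_def by blast
qed

text \<open>
  The exceptional sets are slices here: on almost every time slice the two functions agree almost
  everywhere. This is the form in which the nonlocal term of a representative is related to that of
  the solution, since \<open>P[u](x,t)\<close> depends on the whole slice at time \<open>t\<close>.
\<close>

lemma integral_iterated_AE:
  fixes F G :: "real \<times> real \<Rightarrow> real"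
  assumes [measurable]: "F \<in> borel_measurable borel" and G: "integrable lborel G"
    and ae: "AE t in lborel. AE x in lborel. F (x, t) = G (x, t)"
  shows "(\<integral>t. \<integral>x. F (x, t) \<partial>lborel \<partial>lborel) = (\<integral>p. G p \<partial>lborel)"
proof -
  have [measurable]: "G \<in> borel_measurable borel" using G by auto
  have "AE t in lborel. (\<integral>x. F (x, t) \<partial>lborel) = (\<integral>x. G (x, t) \<partial>lborel)"
    using ae by eventually_elim (rule integral_cong_AE; simp add: borel_measurable_slice_fst)
  then have "(\<integral>t. \<integral>x. F (x, t) \<partial>lborel \<partial>lborel) = (\<integral>t. \<integral>x. G (x, t) \<partial>lborel \<partial>lborel)"
    by (intro integral_cong_AE) (simp_all add: borel_measurable_integral_fst)
  also have "\<dots> = (\<integral>p. G p \<partial>lborel)" by (rule integral_plane(1)[OF G])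
  finally show ?thesis .
qed

text \<open>
  The integrand of a weak inequality with entropy \<open>e\<close>, flux \<open>q\<close> and source \<open>s\<close>, tested with \<open>A(x) B(t)\<close>.
\<close>

abbreviation weak_form :: "(real \<Rightarrow> real) \<Rightarrow> (real \<Rightarrow> real) \<Rightarrow> real \<Rightarrow> real \<Rightarrow> real \<Rightarrow> real \<times> real \<Rightarrow> real" where
  "weak_form A B e q s p \<equiv>
     e * (A (fst p) * deriv B (snd p)) + q * (deriv A (fst p) * B (snd p)) + s * (A (fst p) * B (snd p))"

lemma entropy_integral_plane:
  assumes u: "in_Linf T u" and U: "representative T M u U"
    and c: "continuous_on UNIV g" "continuous_on UNIV q" "continuous_on UNIV g'"
    and A: "bump 0 1 A" and B: "bump a b B"
  shows "(LINT t:{0<..<T}|lborel. LINT x:{0<..<1}|lborel.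
         g (u x t) * dt (\<lambda>x t. A x * B t) x t + q (u x t) * dx (\<lambda>x t. A x * B t) x t
          + \<gamma> * g' (u x t) * P_op u x t * (A x * B t)) =
     (\<integral>p. indicator (rect T) p * (weak_form A B (g (U p)) (q (U p)) (\<gamma> * g' (U p) * primitive_x T U p) p) \<partial>lborel)"
    (is "?L = ?R")
    and "integrable lborel (\<lambda>p. indicator (rect T) p * (weak_form A B (g (U p)) (q (U p)) (\<gamma> * g' (U p) * primitive_x T U p) p))"
proof -
  define u' where "u' p = indicator (rect T) p * u (fst p) (snd p)" for p
  have mu[measurable]: "u' \<in> borel_measurable borel"
    using in_Linf_measurable[OF u] unfolding u'_def[abs_def] .
  have bU: "bounded_on_rect T M U" and aeU: "AE p in lborel. p \<in> rect T \<longrightarrow> U p = u (fst p) (snd p)"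
    using U by (auto simp: representative_def)
  have mU[measurable]: "U \<in> borel_measurable borel" using bU by (simp add: bounded_on_rect_def)
  have [measurable]: "g \<in> borel_measurable borel" "q \<in> borel_measurable borel" "g' \<in> borel_measurable borel"
    using c by (auto intro: borel_measurable_continuous_onI)
  have A': "bump 0 1 (deriv A)" and B': "bump a b (deriv B)" using A B by (auto intro: bump_deriv)
  note [measurable] = borel_measurable_comp_fst[OF bump_measurable[OF A]]
    borel_measurable_comp_snd[OF bump_measurable[OF B]]
    borel_measurable_comp_fst[OF bump_measurable[OF A']]
    borel_measurable_comp_snd[OF bump_measurable[OF B']]
  have sm: "smooth A" "smooth B" using A B by (auto simp: bump_def)
  define K where "K w s p = weak_form A B (g w) (q w) (\<gamma> * g' w * s) p" for w s p
  define F where "F p = indicator (rect T) p * K (u' p) (primitive_x T u' p) p" for p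
  define G where "G p = indicator (rect T) p * K (U p) (primitive_x T U p) p" for p
  have [measurable]: "F \<in> borel_measurable borel" "G \<in> borel_measurable borel"
    unfolding F_def[abs_def] G_def[abs_def] K_def by measurable
  note bW = primitive_x_bounded[OF bU]
  obtain CA where CA: "\<And>x. \<bar>A x\<bar> \<le> CA" using bump_bounded[OF A] by blast
  obtain CA' where CA': "\<And>x. \<bar>deriv A x\<bar> \<le> CA'" using bump_bounded[OF A'] by blast
  obtain CB where CB: "\<And>x. \<bar>B x\<bar> \<le> CB" using bump_bounded[OF B] by blast
  obtain CB' where CB': "\<And>x. \<bar>deriv B x\<bar> \<le> CB'" using bump_bounded[OF B'] by blast
  obtain C1 where C1: "\<And>w. \<bar>w\<bar> \<le> M \<Longrightarrow> \<bar>g w\<bar> \<le> C1" using continuous_bounded[OF c(1)] by metis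
  obtain C2 where C2: "\<And>w. \<bar>w\<bar> \<le> M \<Longrightarrow> \<bar>q w\<bar> \<le> C2" using continuous_bounded[OF c(2)] by metis
  obtain C3 where C3: "\<And>w. \<bar>w\<bar> \<le> M \<Longrightarrow> \<bar>g' w\<bar> \<le> C3" using continuous_bounded[OF c(3)] by metis
  have UM: "\<bar>U p\<bar> \<le> M" and WM: "\<bar>primitive_x T U p\<bar> \<le> M" for p
    using bU bW unfolding bounded_on_rect_def by blast+
  have bK: "\<bar>K (U p) (primitive_x T U p) p\<bar> \<le> C1 * (CA * CB') + C2 * (CA' * CB) + \<bar>\<gamma>\<bar> * C3 * M * (CA * CB)" for p
    unfolding K_def
    by (intro order_trans[OF abs_triangle_ineq] add_mono abs_mult_le C1 C2 C3 CA CA' CB CB' UM WM) auto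
  have iG: "integrable lborel G"
  proof (rule integrable_bounded_support[OF _ _ bounded_rect[of T]])
    show "\<bar>G p\<bar> \<le> \<bar>C1 * (CA * CB') + C2 * (CA' * CB) + \<bar>\<gamma>\<bar> * C3 * M * (CA * CB)\<bar>" for p
      using bK[of p] by (auto simp: G_def indicator_def)
  qed (auto simp: G_def)
  then show "integrable lborel (\<lambda>p. indicator (rect T) p * (weak_form A B (g (U p)) (q (U p)) (\<gamma> * g' (U p) * primitive_x T U p) p))"
    unfolding G_def[abs_def] K_def .
  have uU: "AE p in lborel. u' p = U p"
    using aeU by eventually_elim (use bU in \<open>auto simp: u'_def bounded_on_rect_def indicator_def\<close>)
  have "AE t in lborel. AE x in lborel. F (x, t) = G (x, t)"
    using AE_slices(2)[OF uU]
  proof eventually_elim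
    case (elim t)
    have "(\<integral>y. indicator {0<..<x} y * u' (y, t) \<partial>lborel) = (\<integral>y. indicator {0<..<x} y * U (y, t) \<partial>lborel)" for x
    proof (rule integral_cong_AE)
      show "AE y in lborel. indicator {0<..<x} y * u' (y, t) = indicator {0<..<x} y * U (y, t)"
        using elim by eventually_elim simp
    qed (use borel_measurable_slice_fst[OF mu] borel_measurable_slice_fst[OF mU] in auto)
    then have "primitive_x T u' (x, t) = primitive_x T U (x, t)" for x by (simp add: primitive_x_def)
    with elim show ?case by (auto simp: F_def G_def elim: eventually_mono)
  qed
  then have "(\<integral>t. \<integral>x. F (x, t) \<partial>lborel \<partial>lborel) = (\<integral>p. G p \<partial>lborel)"
    by (intro integral_iterated_AE iG) auto
  moreover have "?L = (\<integral>t. \<integral>x. F (x, t) \<partial>lborel \<partial>lborel)"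
  proof -
    have P: "P_op u x t = primitive_x T u' (x, t)" if "(x, t) \<in> rect T" for x t
      using that unfolding P_op_def set_lebesgue_integral_def primitive_x_def
      by (auto intro!: Bochner_Integration.integral_cong simp: u'_def rect_def indicator_def)
    have "indicator {0<..<T} t *\<^sub>R (indicator {0<..<1} x *\<^sub>R (g (u x t) * dt (\<lambda>x t. A x * B t) x t
          + q (u x t) * dx (\<lambda>x t. A x * B t) x t + \<gamma> * g' (u x t) * P_op u x t * (A x * B t))) = F (x, t)" for x t
    proof (cases "(x, t) \<in> rect T")
      case True
      then show ?thesis using P[OF True]
        by (simp add: F_def K_def u'_def dt_product[OF sm] dx_product[OF sm]) (simp add: rect_def)
    qed (auto simp: F_def rect_def indicator_def)
    then show ?thesis
      unfolding set_lebesgue_integral_def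
      by (simp add: integral_scaleR_right[symmetric] del: integral_scaleR_right scaleR_conv_of_real real_scaleR_def)
  qed
  ultimately show "?L = ?R" unfolding G_def[abs_def] K_def by simp
qed

definition soft_abs :: "real \<Rightarrow> real \<Rightarrow> real" where "soft_abs e w = sqrt (w\<^sup>2 + e\<^sup>2)"

lemma soft_abs_pos: "0 < e \<Longrightarrow> 0 < soft_abs e w"
  by (simp add: soft_abs_def add_nonneg_pos)

lemma soft_abs_bounds:
  assumes "0 < e" shows "\<bar>w\<bar> \<le> soft_abs e w" "soft_abs e w \<le> \<bar>w\<bar> + e"
proof -
  show "\<bar>w\<bar> \<le> soft_abs e w" unfolding soft_abs_def by (rule real_le_rsqrt) simp
  show "soft_abs e w \<le> \<bar>w\<bar> + e" unfolding soft_abs_def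
    by (rule real_le_lsqrt) (use assms in \<open>auto simp: power2_sum\<close>)
qed

lemma soft_abs_DERIV:
  assumes "0 < e"
  shows "((\<lambda>w. soft_abs e (w - k)) has_real_derivative (w - k) / soft_abs e (w - k)) (at w)"
    and "((\<lambda>w. (w - k) / soft_abs e (w - k)) has_real_derivative e\<^sup>2 / soft_abs e (w - k) ^ 3) (at w)"
proof -
  have p: "0 < (w - k)\<^sup>2 + e\<^sup>2" using assms by (simp add: add_nonneg_pos)
  show 1: "((\<lambda>w. soft_abs e (w - k)) has_real_derivative (w - k) / soft_abs e (w - k)) (at w)"
    unfolding soft_abs_def
    by (rule DERIV_cong[OF DERIV_chain2[where f=sqrt and g="\<lambda>w. (w - k)\<^sup>2 + e\<^sup>2", OF DERIV_real_sqrt[OF p]]])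
      (auto intro!: derivative_eq_intros simp: divide_simps)
  have s: "soft_abs e (w - k) ^ 2 = (w - k)\<^sup>2 + e\<^sup>2" using p by (simp add: soft_abs_def)
  have n: "soft_abs e (w - k) \<noteq> 0" using soft_abs_pos[OF assms, of "w - k"] by simp
  define r where "r = soft_abs e (w - k)"
  have "(1 * r - (w - k) * ((w - k) / r)) / (r * r) = e\<^sup>2 / r ^ 3"
  proof -
    have "(1 * r - (w - k) * ((w - k) / r)) / (r * r) = (r ^ 2 - (w - k)\<^sup>2) / r ^ 3"
      using n unfolding r_def[symmetric] by (simp add: field_simps power2_eq_square power3_eq_cube)
    then show ?thesis using s unfolding r_def[symmetric] by simp
  qed
  moreover have "((\<lambda>w. (w - k) / soft_abs e (w - k)) has_real_derivative
      (1 * r - (w - k) * ((w - k) / r)) / (r * r)) (at w)"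
    unfolding r_def by (rule DERIV_divide[OF _ 1 n]) (auto intro!: derivative_eq_intros)
  ultimately show "((\<lambda>w. (w - k) / soft_abs e (w - k)) has_real_derivative e\<^sup>2 / soft_abs e (w - k) ^ 3) (at w)"
    by (simp add: r_def)
qed

lemma soft_abs_deriv_le: "0 < e \<Longrightarrow> \<bar>w / soft_abs e w\<bar> \<le> 1"
  using soft_abs_bounds(1)[of e w] soft_abs_pos[of e w] by (simp add: abs_divide)

definition kruzkov_flux :: "(real \<Rightarrow> real) \<Rightarrow> real \<Rightarrow> real \<Rightarrow> real" where
  "kruzkov_flux f a b = sgn (a - b) * (f a - f b)"

text \<open>
  To the right of \<open>k\<close> the derivative of \<open>q - f\<close> is \<open>(s - 1) f'\<close> with \<open>s = (x - k) / soft_abs e (x - k)\<close>,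
  which is dominated by \<open>L (1 - s)\<close>. The latter has the primitive \<open>L (x - soft_abs e (x - k))\<close>, whose
  increment is at most \<open>L e\<close>. To the left of \<open>k\<close> the same holds with \<open>q + f\<close> and \<open>1 + s\<close>.
\<close>

lemma soft_flux_error:
  assumes f: "\<And>x. (f has_real_derivative f' x) (at x)" and e: "0 < e"
    and q: "\<And>x. (q has_real_derivative (x - k) / soft_abs e (x - k) * f' x) (at x)" "q k = 0"
    and L: "\<And>x. \<bar>x\<bar> \<le> K \<Longrightarrow> \<bar>f' x\<bar> \<le> L" and kw: "\<bar>k\<bar> \<le> K" "\<bar>w\<bar> \<le> K"
  shows "\<bar>q w - kruzkov_flux f w k\<bar> \<le> L * e"
proof -
  have L0: "0 \<le> L" using L[OF kw(1)] by linarith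
  define s where "s x = (x - k) / soft_abs e (x - k)" for x
  have s1: "\<bar>s x\<bar> \<le> 1" for x using soft_abs_deriv_le[OF e] by (simp add: s_def)
  have cont: "continuous_on S h" if "\<And>x. (h has_real_derivative h' x) (at x)" for h h' and S :: "real set"
    using that by (rule continuous_on_real_derivative)
  consider "w = k" | "k < w" | "w < k" by linarith
  then show ?thesis
  proof cases
    case 1 then show ?thesis using q(2) e L0 by (simp add: kruzkov_flux_def)
  next
    case 2
    have d1: "((\<lambda>x. q x - f x) has_real_derivative (s x - 1) * f' x) (at x)" for x
      by (rule derivative_eq_intros q f refl)+ (simp add: s_def algebra_simps)
    have d2: "((\<lambda>x. L * (x - soft_abs e (x - k))) has_real_derivative L * (1 - s x)) (at x)" for x
      by (rule derivative_eq_intros soft_abs_DERIV[OF e] refl)+ (simp add: s_def)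
    have "norm ((q w - f w) - (q k - f k)) \<le> L * (w - soft_abs e (w - k)) - L * (k - soft_abs e (k - k))"
    proof (rule differentiable_bound_general[OF 2 cont[OF d1] cont[OF d2]])
      fix x assume x: "k < x" "x < w"
      show "((\<lambda>x. q x - f x) has_vector_derivative (s x - 1) * f' x) (at x)"
        using d1 by (simp add: has_real_derivative_iff_has_vector_derivative)
      show "((\<lambda>x. L * (x - soft_abs e (x - k))) has_vector_derivative L * (1 - s x)) (at x)"
        using d2 by (simp add: has_real_derivative_iff_has_vector_derivative)
      have "\<bar>s x - 1\<bar> * \<bar>f' x\<bar> \<le> (1 - s x) * L"
        using s1[of x] x kw by (intro mult_mono L) auto
      then show "norm ((s x - 1) * f' x) \<le> L * (1 - s x)" by (simp add: abs_mult mult.commute)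
    qed
    also have "\<dots> = L * ((w - k) - soft_abs e (w - k) + e)"
      using e by (simp add: soft_abs_def algebra_simps)
    also have "\<dots> \<le> L * e" using soft_abs_bounds(1)[OF e, of "w - k"] L0 2
      by (intro mult_left_mono) auto
    finally show ?thesis using 2 q(2) by (simp add: kruzkov_flux_def)
  next
    case 3
    have d1: "((\<lambda>x. q x + f x) has_real_derivative (s x + 1) * f' x) (at x)" for x
      by (rule derivative_eq_intros q f refl)+ (simp add: s_def algebra_simps)
    have d2: "((\<lambda>x. L * (x + soft_abs e (x - k))) has_real_derivative L * (1 + s x)) (at x)" for x
      by (rule derivative_eq_intros soft_abs_DERIV[OF e] refl)+ (simp add: s_def)
    have "norm ((q k + f k) - (q w + f w)) \<le> L * (k + soft_abs e (k - k)) - L * (w + soft_abs e (w - k))"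
    proof (rule differentiable_bound_general[OF 3 cont[OF d1] cont[OF d2]])
      fix x assume x: "w < x" "x < k"
      show "((\<lambda>x. q x + f x) has_vector_derivative (s x + 1) * f' x) (at x)"
        using d1 by (simp add: has_real_derivative_iff_has_vector_derivative)
      show "((\<lambda>x. L * (x + soft_abs e (x - k))) has_vector_derivative L * (1 + s x)) (at x)"
        using d2 by (simp add: has_real_derivative_iff_has_vector_derivative)
      have "\<bar>s x + 1\<bar> * \<bar>f' x\<bar> \<le> (1 + s x) * L"
        using s1[of x] x kw by (intro mult_mono L) auto
      then show "norm ((s x + 1) * f' x) \<le> L * (1 + s x)" by (simp add: abs_mult mult.commute)
    qed
    also have "\<dots> = L * ((k - w) - soft_abs e (w - k) + e)"
      using e by (simp add: soft_abs_def algebra_simps)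
    also have "\<dots> \<le> L * e" using soft_abs_bounds(1)[OF e, of "w - k"] L0 3
      by (intro mult_left_mono) auto
    finally show ?thesis using 3 q(2) by (simp add: kruzkov_flux_def)
  qed
qed


text \<open>
  Kruzkov's form of the entropy inequality in the interior of the rectangle, with a source \<open>S\<close>
  given as a function of space and time.
\<close>

definition kruzkov_solution ::
  "real \<Rightarrow> (real \<Rightarrow> real) \<Rightarrow> (real \<times> real \<Rightarrow> real) \<Rightarrow> (real \<times> real \<Rightarrow> real) \<Rightarrow> bool" where
  "kruzkov_solution T f U S \<longleftrightarrow>
     (\<forall>k A B. bump 0 1 A \<longrightarrow> bump 0 T B \<longrightarrow> (\<forall>x. 0 \<le> A x) \<longrightarrow> (\<forall>t. 0 \<le> B t) \<longrightarrow>
        0 \<le> (\<integral>p. weak_form A B \<bar>U p - k\<bar> (kruzkov_flux f (U p) k) (sgn (U p - k) * S p) p \<partial>lborel))"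

lemma bump_product_outside:
  assumes "bump 0 1 A" "bump 0 T B" "p \<notin> rect T"
  shows "A (fst p) * B (snd p) = 0"
  using assms bump_zero[OF assms(1), of "fst p"] bump_zero[OF assms(2), of "snd p"]
  by (cases p) (auto simp: rect_def)

lemma soft_sgn_tendsto: "(\<lambda>n. w / soft_abs (1 / real (Suc n)) w) \<longlonglongrightarrow> sgn w"
proof (cases "w = 0")
  case False
  have "(\<lambda>n. soft_abs (1 / real (Suc n)) w) \<longlonglongrightarrow> sqrt (w\<^sup>2 + 0\<^sup>2)"
    unfolding soft_abs_def by (intro tendsto_intros LIMSEQ_Suc[OF lim_1_over_n])
  then have "(\<lambda>n. soft_abs (1 / real (Suc n)) w) \<longlonglongrightarrow> \<bar>w\<bar>" by simp
  then have "(\<lambda>n. w / soft_abs (1 / real (Suc n)) w) \<longlonglongrightarrow> w / \<bar>w\<bar>"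
    using False by (intro tendsto_intros) auto
  then show ?thesis using False by (simp add: sgn_real_def abs_if split: if_splits)
qed simp

text \<open>
  The entropies \<open>soft_abs e (w - k)\<close> are convex and tend to \<open>\<bar>w - k\<bar>\<close>, with derivatives tending to
  \<open>sgn (w - k)\<close> pointwise and boundedly; by \<open>soft_flux_error\<close> their fluxes tend to the Kruzkov
  flux. Dominated convergence on the rectangle gives the claim.
\<close>

lemma kruzkov_solution_of_entropy:
  assumes f: "C_k 2 f" and bU: "bounded_on_rect T M U" and bS: "bounded_on_rect T M' S"
    and ent: "\<And>g q A B. entropy_pair f g q \<Longrightarrow> bump 0 1 A \<Longrightarrow> bump 0 T B \<Longrightarrow>
      (\<And>x. 0 \<le> A x) \<Longrightarrow> (\<And>t. 0 \<le> B t) \<Longrightarrow>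
      0 \<le> (\<integral>p. indicator (rect T) p * (weak_form A B (g (U p)) (q (U p)) (deriv g (U p) * S p) p) \<partial>lborel)"
  shows "kruzkov_solution T f U S"
  unfolding kruzkov_solution_def
proof (intro allI impI)
  fix k A B
  assume A: "bump 0 1 A" and B: "bump 0 T B" and nn: "\<forall>x. 0 \<le> A x" "\<forall>t. 0 \<le> B t"
  define e where "e n = 1 / real (Suc n)" for n
  have e0: "0 < e n" and e1: "e n \<le> 1" for n by (auto simp: e_def divide_simps)
  have e_lim: "e \<longlonglongrightarrow> 0" unfolding e_def[abs_def] by (rule LIMSEQ_Suc[OF lim_1_over_n])
  have d2c: "continuous_on UNIV (\<lambda>w. (e n)\<^sup>2 / soft_abs (e n) (w - k) ^ 3)" for n
    using soft_abs_pos[OF e0, of n] e0[of n] unfolding soft_abs_def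
    by (intro continuous_intros) (auto simp: less_imp_neq[symmetric])
  define good where "good n q \<longleftrightarrow> entropy_pair f (\<lambda>w. soft_abs (e n) (w - k)) q \<and> q k = 0 \<and>
      (\<forall>x. (q has_real_derivative (x - k) / soft_abs (e n) (x - k) * deriv f x) (at x)) \<and>
      deriv (\<lambda>w. soft_abs (e n) (w - k)) = (\<lambda>w. (w - k) / soft_abs (e n) (w - k)) \<and> continuous_on UNIV q" for n q
  have "\<exists>q. good n q" for n
  proof -
    have "0 \<le> (e n)\<^sup>2 / soft_abs (e n) (w - k) ^ 3" for w
      using soft_abs_pos[OF e0, of n "w - k"] by simp
    from entropy_pair_exists[OF f soft_abs_DERIV[OF e0[of n], of k] d2c this, of k]
    show ?thesis unfolding good_def by blast
  qed
  then obtain q where good: "\<And>n. good n (q n)" by metis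
  have q: "entropy_pair f (\<lambda>w. soft_abs (e n) (w - k)) (q n)" "q n k = 0"
      "(q n has_real_derivative (x - k) / soft_abs (e n) (x - k) * deriv f x) (at x)"
      "deriv (\<lambda>w. soft_abs (e n) (w - k)) = (\<lambda>w. (w - k) / soft_abs (e n) (w - k))"
      "continuous_on UNIV (q n)" for n x
    using good[of n] unfolding good_def by - ((elim conjE allE[of _ x], assumption)+)
  define K where "K = max M \<bar>k\<bar>"
  obtain L where L0: "0 \<le> L" and L: "\<And>x. \<bar>x\<bar> \<le> K \<Longrightarrow> \<bar>deriv f x\<bar> \<le> L"
    using continuous_bounded[OF C_k_2D(4)[OF f]] by metis
  have UM: "\<bar>U p\<bar> \<le> M" and SM: "\<bar>S p\<bar> \<le> M'" for p
    using bU bS unfolding bounded_on_rect_def by blast+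
  have fl: "\<bar>q n (U p) - kruzkov_flux f (U p) k\<bar> \<le> L * e n" for n p
    by (rule soft_flux_error[where K=K, OF C_k_2D(1)[OF f] e0 q(3,2) L]) (use UM[of p] in \<open>auto simp: K_def\<close>)
  have [measurable]: "U \<in> borel_measurable borel" "S \<in> borel_measurable borel"
    using bU bS by (auto simp: bounded_on_rect_def)
  have "f \<in> borel_measurable borel" using C_k_2D(3)[OF f] by (rule borel_measurable_continuous_onI)
  then have [measurable]: "(\<lambda>p. kruzkov_flux f (U p) k) \<in> borel_measurable borel"
    unfolding kruzkov_flux_def by measurable
  have A': "bump 0 1 (deriv A)" and B': "bump 0 T (deriv B)" using A B by (auto intro: bump_deriv)
  note [measurable] = borel_measurable_comp_fst[OF bump_measurable[OF A]]
    borel_measurable_comp_snd[OF bump_measurable[OF B]]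
    borel_measurable_comp_fst[OF bump_measurable[OF A']]
    borel_measurable_comp_snd[OF bump_measurable[OF B']]
  obtain CA where CA: "\<And>x. \<bar>A x\<bar> \<le> CA" using bump_bounded[OF A] by blast
  obtain CA' where CA': "\<And>x. \<bar>deriv A x\<bar> \<le> CA'" using bump_bounded[OF A'] by blast
  obtain CB where CB: "\<And>x. \<bar>B x\<bar> \<le> CB" using bump_bounded[OF B] by blast
  obtain CB' where CB': "\<And>x. \<bar>deriv B x\<bar> \<le> CB'" using bump_bounded[OF B'] by blast
  have [measurable]: "q n \<in> borel_measurable borel" "(\<lambda>w. soft_abs (e n) (w - k)) \<in> borel_measurable borel" for n
    using q(5) unfolding soft_abs_def by (auto intro!: borel_measurable_continuous_onI)
  define G where "G n p = indicator (rect T) p * (weak_form A B (soft_abs (e n) (U p - k)) (q n (U p)) ((U p - k) / soft_abs (e n) (U p - k) * S p) p)" for n p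
  define G' where "G' p = indicator (rect T) p * (weak_form A B \<bar>U p - k\<bar> (kruzkov_flux f (U p) k) (sgn (U p - k) * S p) p)" for p
  have G'_eq: "G' p = weak_form A B \<bar>U p - k\<bar> (kruzkov_flux f (U p) k) (sgn (U p - k) * S p) p" for p
    unfolding G'_def
    using bump_product_outside[OF A B', of p] bump_product_outside[OF A' B, of p] bump_product_outside[OF A B, of p]
    by (cases "p \<in> rect T") auto
  define f2 where "f2 = 2 * L * K + L"
  have bq: "\<bar>q n (U p)\<bar> \<le> f2" for n p
  proof -
    have "\<bar>f (U p) - f k\<bar> \<le> L * \<bar>U p - k\<bar>"
      by (rule field_differentiable_bound[of "{-K..K}" f "deriv f" L "U p" k, unfolded real_norm_def])
        (use C_k_2D(1)[OF f] L UM[of p] in \<open>auto simp: K_def abs_le_iff intro: has_field_derivative_at_within\<close>)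
    also have "\<dots> \<le> L * (2 * K)"
      using L0 UM[of p] by (intro mult_left_mono) (auto simp: K_def abs_le_iff)
    finally have "\<bar>kruzkov_flux f (U p) k\<bar> \<le> L * (2 * K)"
      unfolding kruzkov_flux_def abs_mult by (auto simp: abs_sgn_eq)
    moreover have "L * e n \<le> L * 1" using L0 e1 by (intro mult_left_mono) auto
    ultimately show ?thesis using fl[of n p] by (auto simp: f2_def algebra_simps)
  qed
  have bs: "\<bar>soft_abs (e n) (U p - k)\<bar> \<le> 2 * K + 1" for n p
    using soft_abs_bounds(2)[OF e0, of n "U p - k"] soft_abs_pos[OF e0, of n "U p - k"] UM[of p] e1[of n]
    by (auto simp: K_def)
  have bd: "\<bar>weak_form A B (soft_abs (e n) (U p - k)) (q n (U p)) ((U p - k) / soft_abs (e n) (U p - k) * S p) p\<bar>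
       \<le> (2 * K + 1) * (CA * CB') + f2 * (CA' * CB) + 1 * M' * (CA * CB)" (is "_ \<le> ?C") for n p
    by (intro order_trans[OF abs_triangle_ineq] add_mono abs_mult_le bs bq CA CA' CB CB' SM soft_abs_deriv_le[OF e0])
  have "(\<lambda>n. \<integral>p. G n p \<partial>lborel) \<longlonglongrightarrow> (\<integral>p. G' p \<partial>lborel)"
  proof (rule integral_dominated_convergence[where w="\<lambda>p. indicator (rect T) p * ?C"])
    show "G' \<in> borel_measurable lborel" unfolding G'_def[abs_def] by measurable
    show "G n \<in> borel_measurable lborel" for n unfolding G_def[abs_def] by measurable
    show "integrable lborel (\<lambda>p. indicator (rect T) p * ?C)"
      by (rule integrable_bounded_support[OF _ _ bounded_rect[of T], where C="\<bar>?C\<bar>"]) (auto simp: indicator_def)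
    show "AE p in lborel. norm (G n p) \<le> indicator (rect T) p * ?C" for n
      using bd by (auto simp: G_def indicator_def)
    show "AE p in lborel. (\<lambda>n. G n p) \<longlonglongrightarrow> G' p"
    proof (rule AE_I2)
      fix p
      have l: "h \<longlonglongrightarrow> c" if "\<And>n. \<bar>h n - c\<bar> \<le> d * e n" for h c d
      proof (rule LIM_zero_cancel, rule Lim_null_comparison)
        show "(\<lambda>n. d * e n) \<longlonglongrightarrow> 0" using tendsto_mult_left[OF e_lim, of d] by simp
      qed (use that in auto)
      have 1: "(\<lambda>n. soft_abs (e n) (U p - k)) \<longlonglongrightarrow> \<bar>U p - k\<bar>"
      proof (rule l)
        fix n
        show "\<bar>soft_abs (e n) (U p - k) - \<bar>U p - k\<bar>\<bar> \<le> 1 * e n"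
          using soft_abs_bounds(1)[OF e0, of "U p - k" n] soft_abs_bounds(2)[OF e0, of n "U p - k"] by linarith
      qed
      have 2: "(\<lambda>n. q n (U p)) \<longlonglongrightarrow> kruzkov_flux f (U p) k" by (rule l[OF fl])
      show "(\<lambda>n. G n p) \<longlonglongrightarrow> G' p"
        unfolding G_def G'_def
        by (intro tendsto_intros 1 2 soft_sgn_tendsto[folded e_def])
    qed
  qed
  moreover have "0 \<le> (\<integral>p. G n p \<partial>lborel)" for n
    using ent[OF q(1) A B, of n] nn unfolding G_def q(4) by auto
  ultimately have "0 \<le> (\<integral>p. G' p \<partial>lborel)" by (intro LIMSEQ_le_const) auto
  then show "0 \<le> (\<integral>p. weak_form A B \<bar>U p - k\<bar> (kruzkov_flux f (U p) k) (sgn (U p - k) * S p) p \<partial>lborel)"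
    unfolding G'_eq .
qed

section \<open>Doubling of the variables\<close>

lemma kruzkov_flux_commute: "kruzkov_flux f a b = kruzkov_flux f b a"
  by (auto simp: kruzkov_flux_def sgn_real_def)

lemma lipschitz_on_symmetric_interval:
  fixes f :: "real \<Rightarrow> real"
  assumes "L-lipschitz_on {-M..M} f" "\<bar>a\<bar> \<le> M" "\<bar>b\<bar> \<le> M"
  shows "\<bar>f a - f b\<bar> \<le> L * \<bar>a - b\<bar>"
  using lipschitz_onD[OF assms(1), of a b] assms(2,3) by (simp add: dist_real_def abs_le_iff)

text \<open>
  The sign jumps exactly where \<open>f a - f b\<close> vanishes. If \<open>a\<close> lies between \<open>b\<close> and \<open>c\<close>, the two contributions
  add up to at most \<open>L \<bar>b - a\<bar> + L \<bar>a - c\<bar> = L \<bar>b - c\<bar>\<close>.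
\<close>

lemma kruzkov_flux_Lipschitz:
  assumes lip: "L-lipschitz_on {-M..M} f"
    and M: "\<bar>a\<bar> \<le> M" "\<bar>b\<bar> \<le> M" "\<bar>c\<bar> \<le> M"
  shows "\<bar>kruzkov_flux f a b - kruzkov_flux f a c\<bar> \<le> L * \<bar>b - c\<bar>"
proof -
  have "\<bar>f a - f b\<bar> \<le> L * \<bar>a - b\<bar>" "\<bar>f a - f c\<bar> \<le> L * \<bar>a - c\<bar>" "\<bar>f b - f c\<bar> \<le> L * \<bar>b - c\<bar>"
    by (auto intro: lipschitz_on_symmetric_interval[OF lip] M)
  moreover have "L * \<bar>a - b\<bar> + L * \<bar>a - c\<bar> = L * \<bar>b - c\<bar>" if "b \<le> a \<and> a \<le> c \<or> c \<le> a \<and> a \<le> b"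
    using that by (auto simp: algebra_simps)
  ultimately show ?thesis
    unfolding kruzkov_flux_def sgn_real_def
    by (cases a b rule: linorder_cases; cases a c rule: linorder_cases) (auto simp: abs_le_iff)
qed

lemma kruzkov_flux_bound:
  assumes lip: "L-lipschitz_on {-M..M} f" and M: "\<bar>a\<bar> \<le> M" "\<bar>b\<bar> \<le> M"
  shows "\<bar>kruzkov_flux f a b\<bar> \<le> L * (2 * M)"
proof -
  have "\<bar>kruzkov_flux f a b\<bar> \<le> \<bar>f a - f b\<bar>"
    unfolding kruzkov_flux_def abs_mult by (auto simp: abs_sgn_eq)
  also have "\<dots> \<le> L * \<bar>a - b\<bar>" by (intro lipschitz_on_symmetric_interval[OF lip] M)
  also have "\<dots> \<le> L * (2 * M)" using lipschitz_on_nonneg[OF lip] M by (intro mult_left_mono) auto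
  finally show ?thesis .
qed

text \<open>
  The functions of two points \<open>z = (p, q)\<close> that arise when the doubled test function
  \<open>a(x) b(t) d(x - y) d(t - s)\<close>, \<open>p = (x,t)\<close>, \<open>q = (y,s)\<close>, is differentiated.
\<close>

definition pair_kernel :: "(real \<Rightarrow> real) \<Rightarrow> (real \<Rightarrow> real) \<Rightarrow> (real \<Rightarrow> real) \<Rightarrow> (real \<Rightarrow> real) \<Rightarrow>
    (real \<times> real) \<times> (real \<times> real) \<Rightarrow> real" where
  "pair_kernel a b d d' z = a (fst (fst z)) * b (snd (fst z))
     * (d (fst (fst z) - fst (snd z)) * d' (snd (fst z) - snd (snd z)))"

lemma pair_kernel_measurable:
  assumes "bump 0 1 a" "bump 0 T b" "bump l l' d" "bump l l' d'"
  shows "pair_kernel a b d d' \<in> borel_measurable borel"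
proof -
  have "smooth a" "smooth b" "smooth d" "smooth d'" using assms by (auto simp: bump_def)
  note c = this[THEN smooth_continuous[where S=UNIV]]
  have "continuous_on UNIV (pair_kernel a b d d')"
    unfolding pair_kernel_def
    by (intro continuous_on_mult continuous_on_compose2[OF c(1)] continuous_on_compose2[OF c(2)]
        continuous_on_compose2[OF c(3)] continuous_on_compose2[OF c(4)]
        continuous_on_diff continuous_on_fst continuous_on_snd continuous_on_id) auto
  then show ?thesis by (rule borel_measurable_continuous_onI)
qed

lemma integrable_pair_kernel:
  assumes [measurable]: "g \<in> borel_measurable borel" and C: "\<And>z. \<bar>g z\<bar> \<le> C"
    and b: "bump 0 1 a" "bump 0 T b" "bump (- l) l d" "bump (- l) l d'"
  shows "integrable lborel (\<lambda>z. g z * pair_kernel a b d d' z)"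
proof -
  obtain C1 where C1: "\<And>x. \<bar>a x\<bar> \<le> C1" using bump_bounded[OF b(1)] by blast
  obtain C2 where C2: "\<And>x. \<bar>b x\<bar> \<le> C2" using bump_bounded[OF b(2)] by blast
  obtain C3 where C3: "\<And>x. \<bar>d x\<bar> \<le> C3" using bump_bounded[OF b(3)] by blast
  obtain C4 where C4: "\<And>x. \<bar>d' x\<bar> \<le> C4" using bump_bounded[OF b(4)] by blast
  let ?S = "rect T \<times> ({- l..1 + l} \<times> {- l..T + l})"
  note [measurable] = pair_kernel_measurable[OF b]
  show ?thesis
  proof (rule integrable_bounded_support)
    show "\<bar>g z * pair_kernel a b d d' z\<bar> \<le> C * (C1 * C2 * (C3 * C4))" for z
      unfolding pair_kernel_def by (intro abs_mult_le C C1 C2 C3 C4)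
    show "bounded ?S" by (intro bounded_Times bounded_rect) auto
    fix z :: "(real \<times> real) \<times> (real \<times> real)" assume "z \<notin> ?S"
    obtain x t y s where z: "z = ((x, t), (y, s))" by (metis surj_pair)
    have "x \<notin> {0<..<1} \<or> t \<notin> {0<..<T} \<or> x - y \<notin> {-l<..<l} \<or> t - s \<notin> {-l<..<l}"
      using \<open>z \<notin> ?S\<close> unfolding z rect_def by auto
    then show "g z * pair_kernel a b d d' z = 0"
      using bump_zero[OF b(1), of x] bump_zero[OF b(2), of t] bump_zero[OF b(3), of "x - y"] bump_zero[OF b(4), of "t - s"]
      by (auto simp: z pair_kernel_def)
  qed simp
qed

lemma mollifier_bump: "mollifier h d \<Longrightarrow> bump (- (2 * h)) (2 * h) d"
  unfolding bump_def mollifier_def by (intro conjI exI[of _ "-h"] exI[of _ h]) auto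

text \<open>
  The inequality for \<open>U\<close> with \<open>k = V q\<close> is integrated over \<open>q\<close>, the one for \<open>V\<close> with \<open>k = U p\<close> over \<open>p\<close>, and
  the two are added. The kernel \<open>d(x - y) d(t - s)\<close> depends on differences only, so its derivatives in
  \<open>p\<close> and in \<open>q\<close> are opposite. As \<open>\<bar>U p - V q\<bar>\<close> and the Kruzkov flux are symmetric, all terms with a
  derivative of \<open>d\<close> cancel and only derivatives of \<open>a\<close> and \<open>b\<close> remain. Moving \<open>V q\<close> and \<open>Z q\<close> to \<open>p\<close> costs the
  \<open>L\<^sup>1\<close> modulus of translation of \<open>V\<close> and \<open>Z\<close>, since the entropy and the flux are Lipschitz.
\<close>

lemma kruzkov_doubling:
  assumes lip: "L-lipschitz_on {-M..M} f" and U: "bounded_on_rect T M U" and V: "bounded_on_rect T M V"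
    and S: "bounded_on_rect T N S" and Z: "bounded_on_rect T N Z"
    and kU: "kruzkov_solution T f U S" and kV: "kruzkov_solution T f V Z"
    and f[measurable]: "f \<in> borel_measurable borel"
    and a: "bump 0 1 a" "\<And>x. 0 \<le> a x" and b: "bump 0 T b" "\<And>t. 0 \<le> b t"
  shows "0 \<le> (\<integral>p. weak_form a b \<bar>U p - V p\<bar> (kruzkov_flux f (U p) (V p)) \<bar>S p - Z p\<bar> p \<partial>lborel)"
    (is "0 \<le> (\<integral>p. ?G p \<partial>lborel)")
proof (rule field_le_epsilon)
  fix e :: real assume e: "0 < e"
  have [measurable]: "U \<in> borel_measurable borel" "V \<in> borel_measurable borel"
      "S \<in> borel_measurable borel" "Z \<in> borel_measurable borel"
    and M: "\<And>p. \<bar>U p\<bar> \<le> M" "\<And>p. \<bar>V p\<bar> \<le> M" "\<And>p. \<bar>S p\<bar> \<le> N" "\<And>p. \<bar>Z p\<bar> \<le> N"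
    using U V S Z unfolding bounded_on_rect_def by blast+
  have M0: "0 \<le> M" using M(1)[of 0] by linarith
  have N0: "0 \<le> N" using M(3)[of 0] by linarith
  have ints: "integrable lborel V" "integrable lborel Z"
    using V Z by (auto intro!: integrable_bounded_support[OF _ _ bounded_rect[of T]] M simp: bounded_on_rect_def)
  obtain c1 d1 where cd1: "0 < c1" "d1 < 1" "\<And>x. x \<notin> {c1..d1} \<Longrightarrow> a x = 0" and sa: "smooth a"
    using a by (auto simp: bump_def)
  obtain c2 d2 where cd2: "0 < c2" "d2 < T" "\<And>x. x \<notin> {c2..d2} \<Longrightarrow> b x = 0" and sb: "smooth b"
    using b by (auto simp: bump_def)
  have a': "bump 0 1 (deriv a)" and b': "bump 0 T (deriv b)" using a b by (auto intro: bump_deriv)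
  obtain Ca where Ca: "0 < Ca" "\<And>x. \<bar>a x\<bar> \<le> Ca" using bump_bounded[OF a(1)] by metis
  obtain Ca' where Ca': "0 < Ca'" "\<And>x. \<bar>deriv a x\<bar> \<le> Ca'" using bump_bounded[OF a'] by metis
  obtain Cb where Cb: "0 < Cb" "\<And>x. \<bar>b x\<bar> \<le> Cb" using bump_bounded[OF b(1)] by metis
  obtain Cb' where Cb': "0 < Cb'" "\<And>x. \<bar>deriv b x\<bar> \<le> Cb'" using bump_bounded[OF b'] by metis
  have L0: "0 \<le> L" using lip by (rule lipschitz_on_nonneg)
  define C1 where "C1 = Ca * Cb' + L * (Ca' * Cb)"
  define C2 where "C2 = Ca * Cb"
  have C0: "0 \<le> C1" "0 \<le> C2" using Ca Ca' Cb Cb' L0 by (auto simp: C1_def C2_def)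
  define e' where "e' = e / (C1 + C2 + 1)"
  have e': "0 < e'" using e C0 by (simp add: e'_def)
  have "(C1 + C2 + 1) * e' = e" using C0 by (simp add: e'_def)
  then have e'e: "C1 * e' + C2 * e' \<le> e" using e' by (simp add: algebra_simps)
  obtain r1 where r1: "0 < r1"
    "\<And>h. norm h < r1 \<Longrightarrow> (\<integral>\<^sup>+x. ennreal \<bar>V (x + h) - V x\<bar> \<partial>lborel) \<le> ennreal e'"
    using translation_continuousD[OF integrable_translation_continuous[OF ints(1)] e'] by blast
  obtain r2 where r2: "0 < r2"
    "\<And>h. norm h < r2 \<Longrightarrow> (\<integral>\<^sup>+x. ennreal \<bar>Z (x + h) - Z x\<bar> \<partial>lborel) \<le> ennreal e'"
    using translation_continuousD[OF integrable_translation_continuous[OF ints(2)] e'] by blast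
  define r where "r = min r1 r2"
  \<comment> \<open>The kernel must live where the translations are controlled, and the supports of \<open>a\<close> and \<open>b\<close>
    enlarged by \<open>h\<close> must stay inside the rectangle.\<close>
  define h where "h = Min {r / 2, c1 / 2, (1 - d1) / 2, c2 / 2, (T - d2) / 2}"
  have "0 < r" using r1(1) r2(1) by (simp add: r_def)
  have h0: "0 < h" using \<open>0 < r\<close> cd1 cd2 by (simp add: h_def)
  have hl: "h \<le> r / 2" "h \<le> c1 / 2" "h \<le> (1 - d1) / 2" "h \<le> c2 / 2" "h \<le> (T - d2) / 2"
    unfolding h_def by (rule Min_le; simp)+
  have h: "0 < h" "2 * h \<le> r" "h < c1" "d1 + h < 1" "h < c2" "d2 + h < T"
    using h0 hl cd1(1,2) cd2(1,2) by (simp_all add: field_simps)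
  obtain d where d: "mollifier h d" using mollifier_exists[OF h(1)] by blast
  have sd: "smooth d" and dn: "\<And>x. 0 \<le> d x" and dz: "\<And>x. h \<le> \<bar>x\<bar> \<Longrightarrow> d x = 0" and di: "(\<integral>x. d x \<partial>lborel) = 1"
    using d by (auto simp: mollifier_def)
  note bd = mollifier_bump[OF d]
  note bd' = bump_deriv[OF bd]
  have D: "(a has_real_derivative deriv a x) (at x)" "(b has_real_derivative deriv b x) (at x)"
    "(d has_real_derivative deriv d x) (at x)" for x
    using sa sb sd by (auto intro: smooth_DERIV)

  \<comment> \<open>\<open>H1\<close> is the integrand of the inequality for \<open>U\<close>, \<open>H2\<close> that for \<open>V\<close>; in the sum the kernels
    with \<open>deriv d\<close> cancel.\<close>
  define g1 where "g1 z = \<bar>U (fst z) - V (snd z)\<bar>" for z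
  define g2 where "g2 z = kruzkov_flux f (U (fst z)) (V (snd z))" for z
  define g3 where "g3 z = sgn (U (fst z) - V (snd z)) * S (fst z)" for z
  define g4 where "g4 z = sgn (U (fst z) - V (snd z)) * Z (snd z)" for z
  note [measurable] = borel_measurable_comp_fst[of U] borel_measurable_comp_fst[of S]
     borel_measurable_comp_snd[of V] borel_measurable_comp_snd[of Z]
     borel_measurable_comp_fst[of V] borel_measurable_comp_fst[of Z]
  have gm[measurable]: "g1 \<in> borel_measurable borel" "g2 \<in> borel_measurable borel"
     "g3 \<in> borel_measurable borel" "g4 \<in> borel_measurable borel"
    unfolding g1_def[abs_def] g2_def[abs_def] g3_def[abs_def] g4_def[abs_def] kruzkov_flux_def by measurable
  have gb1: "\<bar>g1 z\<bar> \<le> 2 * M" for z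
    using M(1)[of "fst z"] M(2)[of "snd z"] by (auto simp: g1_def)
  have gb2: "\<bar>g2 z\<bar> \<le> L * (2 * M)" for z
    unfolding g2_def by (intro kruzkov_flux_bound[OF lip] M)
  have gb3: "\<bar>g3 z\<bar> \<le> N" "\<bar>g4 z\<bar> \<le> N" for z
    unfolding g3_def g4_def abs_mult using M N0 by (auto simp: abs_sgn_eq)
  let ?k = "pair_kernel a b d d" and ?kt = "pair_kernel a (deriv b) d d" and ?kx = "pair_kernel (deriv a) b d d"
    and ?kdt = "pair_kernel a b d (deriv d)" and ?kdx = "pair_kernel a b (deriv d) d"
  have I: "integrable lborel (\<lambda>z. g1 z * ?kt z)" "integrable lborel (\<lambda>z. g1 z * ?kdt z)"
    "integrable lborel (\<lambda>z. g2 z * ?kx z)" "integrable lborel (\<lambda>z. g2 z * ?kdx z)"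
    "integrable lborel (\<lambda>z. g3 z * ?k z)" "integrable lborel (\<lambda>z. g4 z * ?k z)"
    by (rule integrable_pair_kernel[OF gm(1) gb1] integrable_pair_kernel[OF gm(2) gb2]
        integrable_pair_kernel[OF gm(3) gb3(1)] integrable_pair_kernel[OF gm(4) gb3(2)], (rule a b a' b' bd bd')+)+
  define H1 where "H1 z = g1 z * ?kt z + g1 z * ?kdt z + (g2 z * ?kx z + g2 z * ?kdx z) + g3 z * ?k z" for z
  define H2 where "H2 z = - (g1 z * ?kdt z) - g2 z * ?kdx z - g4 z * ?k z" for z
  have iH: "integrable lborel H1" "integrable lborel H2"
    unfolding H1_def[abs_def] H2_def[abs_def] using I by auto
  have K1: "0 \<le> (\<integral>p. H1 (p, q) \<partial>lborel)" for q
  proof -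
    define A where "A x = a x * d (x - fst q)" for x
    define B where "B t = b t * d (t - snd q)" for t
    have "((\<lambda>x. d (x - c)) has_real_derivative deriv d (x - c)) (at x)" for x c
      by (auto intro!: derivative_eq_intros DERIV_cong[OF DERIV_chain2[OF D(3)]])
    then have A': "deriv A x = deriv a x * d (x - fst q) + a x * deriv d (x - fst q)"
      and B': "deriv B t = deriv b t * d (t - snd q) + b t * deriv d (t - snd q)" for x t
      unfolding A_def B_def by (auto intro!: DERIV_imp_deriv derivative_eq_intros D)
    have "bump 0 1 A" "bump 0 T B"
      unfolding bump_def A_def[abs_def] B_def[abs_def]
      using smooth_affine[OF sd, of 1 "- fst q"] smooth_affine[OF sd, of 1 "- snd q"] cd1 cd2 sa sb
      by (auto intro!: smooth_mult)
    moreover have "0 \<le> A x" "0 \<le> B x" for x using a b dn by (auto simp: A_def B_def)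
    ultimately have "0 \<le> (\<integral>p. weak_form A B \<bar>U p - V q\<bar> (kruzkov_flux f (U p) (V q)) (sgn (U p - V q) * S p) p \<partial>lborel)"
      using kU unfolding kruzkov_solution_def by blast
    also have "\<dots> = (\<integral>p. H1 (p, q) \<partial>lborel)"
    proof (rule Bochner_Integration.integral_cong)
      fix p
      show "weak_form A B \<bar>U p - V q\<bar> (kruzkov_flux f (U p) (V q)) (sgn (U p - V q) * S p) p = H1 (p, q)"
        unfolding A' B'
        by (simp add: H1_def g1_def g2_def g3_def pair_kernel_def A_def B_def algebra_simps)
    qed simp
    finally show ?thesis .
  qed
  have K2: "0 \<le> (\<integral>q. H2 (p, q) \<partial>lborel)" for p
  proof -
    define A where "A y = a (fst p) * d (fst p - y)" for y
    define B where "B s = b (snd p) * d (snd p - s)" for s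
    have dd: "((\<lambda>y. d (c - y)) has_real_derivative - deriv d (c - y)) (at y)" for y c
      by (auto intro!: derivative_eq_intros DERIV_cong[OF DERIV_chain2[OF D(3)]])
    then have A': "deriv A y = a (fst p) * (- deriv d (fst p - y))"
      and B': "deriv B s = b (snd p) * (- deriv d (snd p - s))" for y s
      unfolding A_def B_def by (auto intro!: DERIV_imp_deriv derivative_eq_intros)
    have "bump 0 1 A"
    proof -
      have "A y = 0" if "y \<notin> {c1 - h..d1 + h}" for y
      proof -
        have "fst p \<notin> {c1..d1} \<or> h \<le> \<bar>fst p - y\<bar>" using that h(1) by (auto simp: abs_if)
        then show ?thesis using cd1(3) dz by (auto simp: A_def)
      qed
      moreover have "smooth A"
        using smooth_mult[OF smooth_const smooth_affine[OF sd, of "-1" "fst p"]] by (simp add: A_def[abs_def])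
      ultimately show ?thesis using h unfolding bump_def by (intro conjI exI[of _ "c1 - h"] exI[of _ "d1 + h"]) auto
    qed
    moreover have "bump 0 T B"
    proof -
      have "B y = 0" if "y \<notin> {c2 - h..d2 + h}" for y
      proof -
        have "snd p \<notin> {c2..d2} \<or> h \<le> \<bar>snd p - y\<bar>" using that h(1) by (auto simp: abs_if)
        then show ?thesis using cd2(3) dz by (auto simp: B_def)
      qed
      moreover have "smooth B"
        using smooth_mult[OF smooth_const smooth_affine[OF sd, of "-1" "snd p"]] by (simp add: B_def[abs_def])
      ultimately show ?thesis using h unfolding bump_def by (intro conjI exI[of _ "c2 - h"] exI[of _ "d2 + h"]) auto
    qed
    moreover have "0 \<le> A x" "0 \<le> B x" for x using a b dn by (auto simp: A_def B_def)
    ultimately have "0 \<le> (\<integral>q. weak_form A B \<bar>V q - U p\<bar> (kruzkov_flux f (V q) (U p)) (sgn (V q - U p) * Z q) q \<partial>lborel)"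
      using kV unfolding kruzkov_solution_def by blast
    also have "\<dots> = (\<integral>q. H2 (p, q) \<partial>lborel)"
    proof (rule Bochner_Integration.integral_cong)
      fix q
      have s: "sgn (V q - U p) = - sgn (U p - V q)" by (simp add: sgn_real_def)
      show "weak_form A B \<bar>V q - U p\<bar> (kruzkov_flux f (V q) (U p)) (sgn (V q - U p) * Z q) q = H2 (p, q)"
        unfolding s A' B' kruzkov_flux_commute[of f "V q"] abs_minus_commute[of "V q"]
        by (simp add: H2_def g1_def g2_def g4_def pair_kernel_def A_def B_def algebra_simps)
    qed simp
    finally show ?thesis .
  qed
  have "0 \<le> (\<integral>z. H1 z \<partial>lborel) + (\<integral>z. H2 z \<partial>lborel)"
    unfolding integral_plane(1)[OF iH(1), symmetric] integral_plane(2)[OF iH(2), symmetric]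
    by (intro add_nonneg_nonneg Bochner_Integration.integral_nonneg K1 K2)
  also have "\<dots> = (\<integral>z. H1 z + H2 z \<partial>lborel)" using iH by simp
  finally have H: "0 \<le> (\<integral>z. H1 z + H2 z \<partial>lborel)" .

  define J where "J w = d (fst w) * d (snd w)" for w :: "real \<times> real"
  have J_cont: "continuous_on UNIV J"
    using continuous_product[OF sd sd] by (simp add: J_def[abs_def] case_prod_beta)
  have [measurable]: "J \<in> borel_measurable borel"
    by (rule borel_measurable_continuous_onI[OF J_cont])
  have "continuous_on UNIV (\<lambda>z::(real \<times> real) \<times> (real \<times> real). J (fst z - snd z))"
    by (rule continuous_on_compose2[OF J_cont]) (auto intro!: continuous_on_diff continuous_on_fst continuous_on_snd continuous_on_id)
  then have Jm[measurable]: "(\<lambda>z::(real \<times> real) \<times> (real \<times> real). J (fst z - snd z)) \<in> borel_measurable borel"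
    by (rule borel_measurable_continuous_onI)
  have Jn: "0 \<le> J w" for w using dn by (simp add: J_def)
  have Jz: "J w = 0" if "r \<le> norm w" for w
  proof -
    have "norm w \<le> \<bar>fst w\<bar> + \<bar>snd w\<bar>" using norm_Pair_le[of "fst w" "snd w"] by simp
    then have "h \<le> \<bar>fst w\<bar> \<or> h \<le> \<bar>snd w\<bar>" using that h by linarith
    then show ?thesis using dz by (auto simp: J_def)
  qed
  have Ji: "(\<integral>\<^sup>+w. ennreal (J w) \<partial>lborel) = 1"
  proof -
    have d1: "(\<integral>\<^sup>+x. ennreal (d x) \<partial>lborel) = 1"
      using nn_integral_eq_integral[OF mollifier_integrable[OF d]] dn di by simp
    have [measurable]: "d \<in> borel_measurable borel" by (rule bump_measurable[OF bd])
    have "(\<integral>\<^sup>+w. ennreal (J w) \<partial>lborel) = (\<integral>\<^sup>+x. \<integral>\<^sup>+t. ennreal (J (x, t)) \<partial>lborel \<partial>lborel)"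
      by (subst lborel.nn_integral_fst) (simp_all add: lborel_prod borel_prod)
    also have "\<dots> = (\<integral>\<^sup>+x. ennreal (d x) * (\<integral>\<^sup>+t. ennreal (d t) \<partial>lborel) \<partial>lborel)"
      by (simp add: J_def ennreal_mult dn nn_integral_cmult)
    finally show ?thesis by (simp add: d1)
  qed
  have Ji2: "(\<integral>q. J (p - q) \<partial>lborel) = 1" for p
  proof -
    have "(\<integral>\<^sup>+q. ennreal (J (p - q)) \<partial>lborel) = 1"
      using nn_integral_lborel_reflect[of "\<lambda>w. ennreal (J w)" p] Ji by simp
    then show ?thesis by (simp add: integral_eq_nn_integral Jn)
  qed
  have err: "integrable lborel (\<lambda>z. \<bar>Y (snd z) - Y (fst z)\<bar> * J (fst z - snd z))"
      "(\<integral>z. \<bar>Y (snd z) - Y (fst z)\<bar> * J (fst z - snd z) \<partial>lborel) \<le> e'"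
    if [measurable]: "Y \<in> borel_measurable borel"
      and Y: "\<And>h. norm h < r \<Longrightarrow> (\<integral>\<^sup>+x. ennreal \<bar>Y (x + h) - Y x\<bar> \<partial>lborel) \<le> ennreal e'"
    for Y :: "real \<times> real \<Rightarrow> real"
  proof -
    let ?E = "\<lambda>z. \<bar>Y (snd z) - Y (fst z)\<bar> * J (fst z - snd z)"
    note [measurable] = borel_measurable_comp_fst[of Y] borel_measurable_comp_snd[of Y]
    have Em[measurable]: "?E \<in> borel_measurable borel" by measurable
    have "(\<integral>\<^sup>+z. ennreal (?E z) \<partial>lborel) = (\<integral>\<^sup>+p. \<integral>\<^sup>+q. ennreal (?E (p, q)) \<partial>lborel \<partial>lborel)"
      by (subst lborel.nn_integral_fst) (simp_all add: lborel_prod borel_prod)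
    also have "\<dots> \<le> ennreal e' * (\<integral>\<^sup>+w. ennreal (J w) \<partial>lborel)"
      using mollification_error[of Y J r "ennreal e'"] Jn Jz Y by simp
    finally have le: "(\<integral>\<^sup>+z. ennreal (?E z) \<partial>lborel) \<le> ennreal e'" by (simp add: Ji)
    then show i: "integrable lborel ?E"
      by (intro integrableI_nonneg) (auto simp: Jn intro: order.strict_trans1)
    show "(\<integral>z. ?E z \<partial>lborel) \<le> e'"
      using le e' by (subst integral_eq_nn_integral) (auto simp: Jn enn2real_leI)
  qed
  note errV = err[of V, OF _ r1(2)] and errZ = err[of Z, OF _ r2(2)]
  have err': "integrable lborel (\<lambda>z. \<bar>V (snd z) - V (fst z)\<bar> * J (fst z - snd z))"
      "(\<integral>z. \<bar>V (snd z) - V (fst z)\<bar> * J (fst z - snd z) \<partial>lborel) \<le> e'"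
      "integrable lborel (\<lambda>z. \<bar>Z (snd z) - Z (fst z)\<bar> * J (fst z - snd z))"
      "(\<integral>z. \<bar>Z (snd z) - Z (fst z)\<bar> * J (fst z - snd z) \<partial>lborel) \<le> e'"
    by (rule errV errZ; simp add: r_def)+

  define h1 where "h1 z = \<bar>U (fst z) - V (fst z)\<bar>" for z :: "(real \<times> real) \<times> (real \<times> real)"
  define h2 where "h2 z = kruzkov_flux f (U (fst z)) (V (fst z))" for z :: "(real \<times> real) \<times> (real \<times> real)"
  define h3 where "h3 z = \<bar>S (fst z) - Z (fst z)\<bar>" for z :: "(real \<times> real) \<times> (real \<times> real)"
  have hm[measurable]: "h1 \<in> borel_measurable borel" "h2 \<in> borel_measurable borel" "h3 \<in> borel_measurable borel"
    unfolding h1_def[abs_def] h2_def[abs_def] h3_def[abs_def] kruzkov_flux_def by measurable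
  have hb1: "\<bar>h1 z\<bar> \<le> 2 * M" for z using M(1)[of "fst z"] M(2)[of "fst z"] by (auto simp: h1_def)
  have hb2: "\<bar>h2 z\<bar> \<le> L * (2 * M)" for z using gb2[of "(fst z, fst z)"] by (simp add: h2_def g2_def)
  have hb3: "\<bar>h3 z\<bar> \<le> 2 * N" for z using M(3)[of "fst z"] M(4)[of "fst z"] by (auto simp: h3_def)
  have iG: "integrable lborel (\<lambda>z. ?G (fst z) * J (fst z - snd z))"
  proof -
    have "integrable lborel (\<lambda>z. h1 z * ?kt z + h2 z * ?kx z + h3 z * ?k z)"
      by (intro Bochner_Integration.integrable_add integrable_pair_kernel[OF hm(1) hb1] integrable_pair_kernel[OF hm(2) hb2]
          integrable_pair_kernel[OF hm(3) hb3]) (rule a b a' b' bd)+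
    moreover have "(\<lambda>z. h1 z * ?kt z + h2 z * ?kx z + h3 z * ?k z) = (\<lambda>z. ?G (fst z) * J (fst z - snd z))"
      by (auto simp: h1_def h2_def h3_def J_def pair_kernel_def algebra_simps)
    ultimately show ?thesis by simp
  qed
  \<comment> \<open>The sign in front of the source difference is bounded by \<open>1\<close>; this is where \<open>\<bar>S - Z\<bar>\<close> arises.\<close>
  have main: "H1 z + H2 z \<le> ?G (fst z) * J (fst z - snd z)
      + C1 * (\<bar>V (snd z) - V (fst z)\<bar> * J (fst z - snd z)) + C2 * (\<bar>Z (snd z) - Z (fst z)\<bar> * J (fst z - snd z))" for z
  proof -
    obtain p q where z: "z = (p, q)" by (cases z)
    let ?a = "a (fst p)" and ?b = "b (snd p)" and ?a' = "deriv a (fst p)" and ?b' = "deriv b (snd p)"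
    have m3: "x * y \<le> c * w" if "\<bar>x\<bar> \<le> c" "\<bar>y\<bar> \<le> w" for x y c w :: real
    proof -
      have "\<bar>x\<bar> * \<bar>y\<bar> \<le> c * w" by (rule mult_mono) (use that in auto)
      then show ?thesis using abs_ge_self[of "x * y"] by (simp add: abs_mult)
    qed
    have "H1 z + H2 z = (g1 z * (?a * ?b') + g2 z * (?a' * ?b) + sgn (U p - V q) * (S p - Z q) * (?a * ?b)) * J (p - q)"
      by (simp add: H1_def H2_def z g3_def g4_def pair_kernel_def J_def algebra_simps)
    also have "\<dots> \<le> (?G p + C1 * \<bar>V q - V p\<bar> + C2 * \<bar>Z q - Z p\<bar>) * J (p - q)"
    proof (rule mult_right_mono[OF _ Jn])
      have "(g1 z - \<bar>U p - V p\<bar>) * (?a * ?b') \<le> \<bar>V q - V p\<bar> * (Ca * Cb')"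
        by (rule m3) (auto simp: g1_def z abs_mult intro!: mult_mono Ca Cb' less_imp_le[OF Ca(1)])
      moreover have "(g2 z - kruzkov_flux f (U p) (V p)) * (?a' * ?b) \<le> (L * \<bar>V q - V p\<bar>) * (Ca' * Cb)"
        by (rule m3) (auto simp: g2_def z abs_mult intro!: mult_mono Ca' Cb less_imp_le[OF Ca'(1)] kruzkov_flux_Lipschitz[OF lip] M)
      moreover have "sgn (U p - V q) * (S p - Z q) * (?a * ?b) \<le> \<bar>S p - Z p\<bar> * (?a * ?b) + \<bar>Z q - Z p\<bar> * (Ca * Cb)"
      proof -
        have "sgn (U p - V q) * (S p - Z q) * (?a * ?b) \<le> \<bar>S p - Z q\<bar> * (?a * ?b)"
          by (intro mult_right_mono) (auto simp: a b sgn_real_def)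
        also have "\<dots> \<le> (\<bar>S p - Z p\<bar> + \<bar>Z q - Z p\<bar>) * (?a * ?b)"
          by (intro mult_right_mono) (auto simp: a b)
        also have "\<dots> \<le> \<bar>S p - Z p\<bar> * (?a * ?b) + \<bar>Z q - Z p\<bar> * (Ca * Cb)"
          unfolding distrib_right using Ca(2)[of "fst p"] Cb(2)[of "snd p"]
          by (intro add_left_mono mult_left_mono mult_mono) (auto simp: a b less_imp_le[OF Ca(1)])
        finally show ?thesis .
      qed
      ultimately show "g1 z * (?a * ?b') + g2 z * (?a' * ?b) + sgn (U p - V q) * (S p - Z q) * (?a * ?b)
          \<le> ?G p + C1 * \<bar>V q - V p\<bar> + C2 * \<bar>Z q - Z p\<bar>"
        by (simp add: C1_def C2_def algebra_simps)
    qed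
    finally show ?thesis by (simp add: z algebra_simps)
  qed
  note H
  also have "(\<integral>z. H1 z + H2 z \<partial>lborel) \<le> (\<integral>z. ?G (fst z) * J (fst z - snd z)
      + C1 * (\<bar>V (snd z) - V (fst z)\<bar> * J (fst z - snd z)) + C2 * (\<bar>Z (snd z) - Z (fst z)\<bar> * J (fst z - snd z)) \<partial>lborel)"
    by (rule integral_mono) (use iH iG err' main in auto)
  also have "\<dots> = (\<integral>z. ?G (fst z) * J (fst z - snd z) \<partial>lborel)
      + C1 * (\<integral>z. \<bar>V (snd z) - V (fst z)\<bar> * J (fst z - snd z) \<partial>lborel)
      + C2 * (\<integral>z. \<bar>Z (snd z) - Z (fst z)\<bar> * J (fst z - snd z) \<partial>lborel)"
    using iG err' by simp
  also have "\<dots> \<le> (\<integral>z. ?G (fst z) * J (fst z - snd z) \<partial>lborel) + C1 * e' + C2 * e'"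
    using err' C0 by (intro add_mono mult_left_mono) auto
  also have "(\<integral>z. ?G (fst z) * J (fst z - snd z) \<partial>lborel) = (\<integral>p. \<integral>q. ?G p * J (p - q) \<partial>lborel \<partial>lborel)"
    using integral_plane(2)[OF iG] by simp
  also have "\<dots> = (\<integral>p. ?G p \<partial>lborel)"
    by (simp add: Ji2)
  finally show "0 \<le> (\<integral>p. ?G p \<partial>lborel) + e" using e'e by linarith
qed

section \<open>The boundary conditions\<close>

text \<open>
  A sign condition on the derivative with strict inequality at one interior point \<open>k\<close> already makes the
  increment strict.
\<close>

lemma nondecreasing_strict:
  fixes \<psi> :: "real \<Rightarrow> real"
  assumes D: "\<And>x. (\<psi> has_real_derivative \<psi>' x) (at x)"
    and nn: "\<And>x. a \<le> x \<Longrightarrow> x \<le> b \<Longrightarrow> 0 \<le> \<psi>' x" and k: "a < k" "k < b" "0 < \<psi>' k"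
  shows "\<psi> a < \<psi> b"
proof -
  obtain d where d: "0 < d" "\<And>h. 0 < h \<Longrightarrow> h < d \<Longrightarrow> \<psi> k < \<psi> (k + h)"
    using DERIV_pos_inc_right[OF D k(3)] by blast
  define h where "h = min (d / 2) (b - k)"
  have h: "0 < h" "h < d" "k + h \<le> b" using d(1) k by (auto simp: h_def min_def)
  have "\<psi> a \<le> \<psi> k"
    by (rule DERIV_nonneg_imp_nondecreasing) (use k D nn in \<open>auto intro!: exI[of _ "\<psi>' _"]\<close>)
  also have "\<dots> < \<psi> (k + h)" using d h by blast
  also have "\<dots> \<le> \<psi> b"
    by (rule DERIV_nonneg_imp_nondecreasing) (use k h D nn in \<open>auto intro!: exI[of _ "\<psi>' _"]\<close>)
  finally show ?thesis .
qed

text \<open>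
  The boundary entropy condition at \<open>x = 0\<close> for entropies whose second derivative is a tent, with \<open>p\<close>
  for the derivative of the entropy. The exceptional null set of times depends on the entropy;
  rational data leave a countable family, hence one null set. The condition at \<open>x = 1\<close> is the same
  for the flux \<open>-f\<close>.
\<close>

definition tent_condition :: "(real \<Rightarrow> real) \<Rightarrow> (real \<Rightarrow> real) \<Rightarrow> real \<Rightarrow> real \<Rightarrow> bool" where
  "tent_condition f f' \<alpha> \<tau> \<longleftrightarrow> (\<forall>k\<in>\<rat>. \<forall>r\<in>\<rat>. 0 < r \<longrightarrow>
     (\<exists>p q. (\<forall>x. (p has_real_derivative max 0 (r - \<bar>x - k\<bar>)) (at x)) \<and>
        (\<forall>x. (q has_real_derivative p x * f' x) (at x)) \<and>
        q \<tau> - q \<alpha> - p \<alpha> * (f \<tau> - f \<alpha>) \<le> 0))"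

text \<open>
  Integration by parts turns the boundary expression into \<open>\<integral> p'(x) (f \<tau> - f x) dx\<close> over \<open>[\<alpha>, \<tau>]\<close>. If
  \<open>f s < f \<tau>\<close>, then \<open>f < f \<tau>\<close> on an interval to the right of \<open>s\<close>, and a tent \<open>p'\<close> supported there makes the
  integral positive.
\<close>

lemma tent_condition_right:
  assumes f: "\<And>x. (f has_real_derivative f' x) (at x)" and tent: "tent_condition f f' \<alpha> \<tau>"
    and s: "\<alpha> \<le> s" "s < \<tau>"
  shows "f \<tau> \<le> f s"
proof (rule ccontr)
  assume "\<not> f \<tau> \<le> f s"
  then have lt: "f s < f \<tau>" by simp
  have "isCont f s" using f by (rule DERIV_isCont)
  then have "eventually (\<lambda>x. f x < f \<tau>) (nhds s)"
    using lt by (metis isCont_def order_tendstoD(2) tendsto_at_iff_tendsto_nhds)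
  then obtain d where d: "0 < d" "\<And>x. dist x s < d \<Longrightarrow> f x < f \<tau>"
    by (auto simp: eventually_nhds_metric)
  define m where "m = s + min d (\<tau> - s)"
  have m: "s < m" "m \<le> \<tau>" using d(1) s by (auto simp: m_def)
  have fm: "f x < f \<tau>" if "s < x" "x < m" for x
    using that d(2)[of x] by (auto simp: m_def dist_real_def)
  obtain k where k: "k \<in> \<rat>" "s < k" "k < m" using Rats_dense_in_real[OF m(1)] by blast
  obtain r where r: "r \<in> \<rat>" "0 < r" "r < min (k - s) (m - k)"
    using Rats_dense_in_real[of 0 "min (k - s) (m - k)"] k by auto
  obtain p q where p: "\<And>x. (p has_real_derivative max 0 (r - \<bar>x - k\<bar>)) (at x)"
    and q: "\<And>x. (q has_real_derivative p x * f' x) (at x)"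
    and E: "q \<tau> - q \<alpha> - p \<alpha> * (f \<tau> - f \<alpha>) \<le> 0"
    using tent k(1) r(1,2) unfolding tent_condition_def by blast
  \<comment> \<open>The increment of \<open>\<psi>\<close> from \<open>\<alpha>\<close> to \<open>\<tau>\<close> is the boundary expression.\<close>
  define \<psi> where "\<psi> x = q x - p x * (f x - f \<tau>)" for x
  have "\<psi> \<alpha> < \<psi> \<tau>"
  proof (rule nondecreasing_strict[where \<psi>=\<psi> and a=\<alpha> and b=\<tau> and \<psi>'="\<lambda>x. max 0 (r - \<bar>x - k\<bar>) * (f \<tau> - f x)" and k=k])
    show "(\<psi> has_real_derivative max 0 (r - \<bar>x - k\<bar>) * (f \<tau> - f x)) (at x)" for x
      unfolding \<psi>_def by (auto intro!: derivative_eq_intros p q f simp: algebra_simps)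
    show "0 \<le> max 0 (r - \<bar>x - k\<bar>) * (f \<tau> - f x)" for x
    proof (cases "\<bar>x - k\<bar> < r")
      case True
      then have "s < x" "x < m" using r(3) by linarith+
      then show ?thesis using fm[of x] by (intro mult_nonneg_nonneg) auto
    qed simp
    show "0 < max 0 (r - \<bar>k - k\<bar>) * (f \<tau> - f k)" using r fm[OF k(2,3)] by simp
  qed (use k s m in auto)
  then show False using E by (simp add: \<psi>_def algebra_simps)
qed

text \<open>
  The substitution \<open>x \<mapsto> -x\<close> together with \<open>f \<mapsto> -f\<close> leaves the boundary expression unchanged and
  exchanges the two sides of \<open>\<alpha>\<close>.
\<close>

lemma tent_condition_left:
  assumes f: "\<And>x. (f has_real_derivative f' x) (at x)" and tent: "tent_condition f f' \<alpha> \<tau>"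
    and s: "\<tau> < s" "s \<le> \<alpha>"
  shows "f s \<le> f \<tau>"
proof -
  have "- f (- (- \<tau>)) \<le> - f (- (- s))"
  proof (rule tent_condition_right[where f="\<lambda>x. - f (- x)" and f'="\<lambda>x. f' (- x)" and \<alpha>="- \<alpha>"])
    show "((\<lambda>x. - f (- x)) has_real_derivative f' (- x)) (at x)" for x
      by (auto intro!: derivative_eq_intros DERIV_cong[OF DERIV_chain2[OF f]])
    show "tent_condition (\<lambda>x. - f (- x)) (\<lambda>x. f' (- x)) (- \<alpha>) (- \<tau>)"
      unfolding tent_condition_def
    proof (intro ballI impI)
      fix k r :: real assume kr: "k \<in> \<rat>" "r \<in> \<rat>" "0 < r"
      then have "- k \<in> \<rat>" by simp
      then obtain p q where p: "\<And>x. (p has_real_derivative max 0 (r - \<bar>x - (- k)\<bar>)) (at x)"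
        and q: "\<And>x. (q has_real_derivative p x * f' x) (at x)"
        and E: "q \<tau> - q \<alpha> - p \<alpha> * (f \<tau> - f \<alpha>) \<le> 0"
        using tent kr unfolding tent_condition_def by blast
      have "((\<lambda>x. - p (- x)) has_real_derivative max 0 (r - \<bar>x - k\<bar>)) (at x)" for x
        by (auto intro!: derivative_eq_intros DERIV_cong[OF DERIV_chain2[OF p]] simp: abs_minus_commute)
      moreover have "((\<lambda>x. q (- x)) has_real_derivative - p (- x) * f' (- x)) (at x)" for x
        by (auto intro!: derivative_eq_intros DERIV_cong[OF DERIV_chain2[OF q]])
      ultimately show "\<exists>p q. (\<forall>x. (p has_real_derivative max 0 (r - \<bar>x - k\<bar>)) (at x)) \<and>
        (\<forall>x. (q has_real_derivative p x * f' (- x)) (at x)) \<and>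
        q (- \<tau>) - q (- \<alpha>) - p (- \<alpha>) * (- f (- (- \<tau>)) - - f (- (- \<alpha>))) \<le> 0"
        using E by (intro exI[of _ "\<lambda>x. - p (- x)"] exI[of _ "\<lambda>x. q (- x)"]) (auto simp: algebra_simps)
    qed
  qed (use s in auto)
  then show ?thesis by simp
qed

text \<open>
  For \<open>b < a\<close> the claim is \<open>f a \<le> f b\<close>. If \<open>\<alpha>\<close> lies on one side of both traces, it is the extremality of
  the farther one at the nearer one; if \<open>b < \<alpha> < a\<close>, both are compared with \<open>f \<alpha>\<close>.
\<close>

lemma tent_condition_flux:
  assumes f: "\<And>x. (f has_real_derivative f' x) (at x)"
    and tent: "tent_condition f f' \<alpha> a" "tent_condition f f' \<alpha> b"
  shows "kruzkov_flux f a b \<le> 0"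
proof -
  have *: "f x \<le> f y" if "tent_condition f f' \<alpha> x" "tent_condition f f' \<alpha> y" "y < x" for x y
  proof -
    consider "\<alpha> \<le> y" | "x \<le> \<alpha>" | "y < \<alpha>" "\<alpha> < x" by linarith
    then show ?thesis
    proof cases
      case 1 then show ?thesis using tent_condition_right[OF f that(1)] that(3) by simp
    next
      case 2 then show ?thesis using tent_condition_left[OF f that(2)] that(3) by simp
    next
      case 3
      then have "f x \<le> f \<alpha>" "f \<alpha> \<le> f y"
        using tent_condition_right[OF f that(1)] tent_condition_left[OF f that(2)] by auto
      then show ?thesis by simp
    qed
  qed
  show ?thesis
    using *[OF tent] *[OF tent(2,1)] by (auto simp: kruzkov_flux_def sgn_real_def not_less le_less)
qed

lemma tent_entropy_pair:
  assumes f: "C_k 2 f" and r: "0 < r"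
  obtains g q where "entropy_pair f g q"
    "\<And>x. (deriv g has_real_derivative max 0 (r - \<bar>x - k\<bar>)) (at x)"
    "\<And>x. (q has_real_derivative deriv g x * deriv f x) (at x)"
proof -
  have c: "continuous_on UNIV (\<lambda>x. max 0 (r - \<bar>x - k\<bar>))" by (intro continuous_intros)
  obtain p where p: "\<And>x. (p has_real_derivative max 0 (r - \<bar>x - k\<bar>)) (at x)"
    using continuous_antiderivative[OF c] by blast
  obtain g where g: "\<And>x. (g has_real_derivative p x) (at x)"
    using continuous_antiderivative[OF continuous_on_real_derivative[OF p]] by blast
  obtain q where "entropy_pair f g q" "deriv g = p" "\<And>x. (q has_real_derivative p x * deriv f x) (at x)"
    using entropy_pair_exists[OF f g p c] by (metis max.cobounded1)
  then show ?thesis using that p by metis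
qed

lemma AE_countable_implies:
  assumes "countable I" "\<And>i. i \<in> I \<Longrightarrow> AE t in M. P t \<longrightarrow> Q i t"
  shows "AE t in M. P t \<longrightarrow> (\<forall>i\<in>I. Q i t)"
proof -
  have "AE t in M. \<forall>i\<in>I. P t \<longrightarrow> Q i t"
    using assms by (subst AE_ball_countable) auto
  then show ?thesis by eventually_elim auto
qed

lemma boundary_tent_condition:
  assumes f: "C_k 2 f"
    and bc: "\<And>g q. entropy_pair f g q \<Longrightarrow> AE t in lborel. t \<in> {0<..<T} \<longrightarrow>
              q (\<tau>\<^sub>0 t) - q (\<alpha> t) - deriv g (\<alpha> t) * (f (\<tau>\<^sub>0 t) - f (\<alpha> t)) \<le> 0 \<and>
              0 \<le> q (\<tau>\<^sub>1 t) - q (\<beta> t) - deriv g (\<beta> t) * (f (\<tau>\<^sub>1 t) - f (\<beta> t))"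
  shows "AE t in lborel. t \<in> {0<..<T} \<longrightarrow> tent_condition f (deriv f) (\<alpha> t) (\<tau>\<^sub>0 t)
     \<and> tent_condition (\<lambda>x. - f x) (\<lambda>x. - deriv f x) (\<beta> t) (\<tau>\<^sub>1 t)"
proof -
  define I where "I = (\<rat> :: real set) \<times> {r \<in> \<rat>. (0::real) < r}"
  have "countable ({r \<in> \<rat>. (0::real) < r})" by (rule countable_subset[OF _ countable_rat]) auto
  then have cI: "countable I" unfolding I_def by (intro countable_SIGMA countable_rat)
  have ex: "\<forall>i\<in>I. \<exists>gq. entropy_pair f (fst gq) (snd gq) \<and>
      (\<forall>x. (deriv (fst gq) has_real_derivative max 0 (snd i - \<bar>x - fst i\<bar>)) (at x)) \<and>
      (\<forall>x. (snd gq has_real_derivative deriv (fst gq) x * deriv f x) (at x))"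
  proof
    fix i assume "i \<in> I"
    then have "0 < snd i" by (auto simp: I_def)
    then obtain g q where "entropy_pair f g q"
      "\<And>x. (deriv g has_real_derivative max 0 (snd i - \<bar>x - fst i\<bar>)) (at x)"
      "\<And>x. (q has_real_derivative deriv g x * deriv f x) (at x)"
      using tent_entropy_pair[OF f, of "snd i" "fst i"] by metis
    then show "\<exists>gq. entropy_pair f (fst gq) (snd gq) \<and>
      (\<forall>x. (deriv (fst gq) has_real_derivative max 0 (snd i - \<bar>x - fst i\<bar>)) (at x)) \<and>
      (\<forall>x. (snd gq has_real_derivative deriv (fst gq) x * deriv f x) (at x))"
      by (intro exI[of _ "(g, q)"]) simp
  qed
  from bchoice[OF ex] obtain gq where gq: "\<And>i. i \<in> I \<Longrightarrow> entropy_pair f (fst (gq i)) (snd (gq i))"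
     "\<And>i x. i \<in> I \<Longrightarrow> (deriv (fst (gq i)) has_real_derivative max 0 (snd i - \<bar>x - fst i\<bar>)) (at x)"
     "\<And>i x. i \<in> I \<Longrightarrow> (snd (gq i) has_real_derivative deriv (fst (gq i)) x * deriv f x) (at x)"
    by blast
  have "AE t in lborel. t \<in> {0<..<T} \<longrightarrow> (\<forall>i\<in>I.
              snd (gq i) (\<tau>\<^sub>0 t) - snd (gq i) (\<alpha> t) - deriv (fst (gq i)) (\<alpha> t) * (f (\<tau>\<^sub>0 t) - f (\<alpha> t)) \<le> 0 \<and>
              0 \<le> snd (gq i) (\<tau>\<^sub>1 t) - snd (gq i) (\<beta> t) - deriv (fst (gq i)) (\<beta> t) * (f (\<tau>\<^sub>1 t) - f (\<beta> t)))"
    by (rule AE_countable_implies[OF cI bc[OF gq(1)]])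
  then show ?thesis
  proof eventually_elim
    case (elim t)
    show ?case
    proof
      assume t: "t \<in> {0<..<T}"
      show "tent_condition f (deriv f) (\<alpha> t) (\<tau>\<^sub>0 t) \<and> tent_condition (\<lambda>x. - f x) (\<lambda>x. - deriv f x) (\<beta> t) (\<tau>\<^sub>1 t)"
        unfolding tent_condition_def
      proof (intro conjI ballI impI)
        fix k r :: real assume "k \<in> \<rat>" "r \<in> \<rat>" "0 < r"
        then have i: "(k, r) \<in> I" by (simp add: I_def)
        note g = gq(2)[OF i, simplified] gq(3)[OF i]
        show "\<exists>p q. (\<forall>x. (p has_real_derivative max 0 (r - \<bar>x - k\<bar>)) (at x)) \<and>
            (\<forall>x. (q has_real_derivative p x * deriv f x) (at x)) \<and>
            q (\<tau>\<^sub>0 t) - q (\<alpha> t) - p (\<alpha> t) * (f (\<tau>\<^sub>0 t) - f (\<alpha> t)) \<le> 0"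
          using g elim t i by (intro exI[of _ "deriv (fst (gq (k, r)))"] exI[of _ "snd (gq (k, r))"]) auto
        have "((\<lambda>x. - snd (gq (k, r)) x) has_real_derivative deriv (fst (gq (k, r))) x * - deriv f x) (at x)" for x
          using DERIV_minus[OF g(2), of x] by simp
        moreover have "- snd (gq (k, r)) (\<tau>\<^sub>1 t) - - snd (gq (k, r)) (\<beta> t)
            - deriv (fst (gq (k, r))) (\<beta> t) * (- f (\<tau>\<^sub>1 t) - - f (\<beta> t)) \<le> 0"
          using elim[rule_format, OF t i] by (simp add: algebra_simps)
        ultimately show "\<exists>p q. (\<forall>x. (p has_real_derivative max 0 (r - \<bar>x - k\<bar>)) (at x)) \<and>
            (\<forall>x. (q has_real_derivative p x * - deriv f x) (at x)) \<and>
            q (\<tau>\<^sub>1 t) - q (\<beta> t) - p (\<beta> t) * (- f (\<tau>\<^sub>1 t) - - f (\<beta> t)) \<le> 0"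
          using g by (intro exI[of _ "deriv (fst (gq (k, r)))"] exI[of _ "\<lambda>x. - snd (gq (k, r)) x"]) auto
      qed
    qed
  qed
qed

lemma AE_interval_ex:
  fixes a b :: real
  assumes "a < b" "AE x in lborel. x \<in> {a<..<b} \<longrightarrow> P x"
  shows "\<exists>x\<in>{a<..<b}. P x"
proof (rule ccontr)
  assume "\<not> ?thesis"
  then have "AE x in lborel. x \<notin> {a<..<b}" using assms(2) by (auto elim: eventually_mono)
  then have "{a<..<b} \<in> null_sets lborel" by (simp add: AE_iff_null_sets)
  then show False using assms(1) by (auto simp: null_sets_def)
qed

text \<open>
  The strong trace of a representative. Its slices agree with those of the solution only for almost every
  \<open>x\<close>, whence the quantifier on \<open>x\<close>.
\<close>

definition has_trace :: "real \<Rightarrow> (real \<times> real \<Rightarrow> real) \<Rightarrow> (real \<Rightarrow> real) \<Rightarrow> bool" where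
  "has_trace a U \<sigma> \<longleftrightarrow> integrable lborel \<sigma> \<and>
     (\<forall>e>0. \<exists>\<delta>>0. AE x in lborel. x \<in> {0<..<1} \<and> \<bar>x - a\<bar> < \<delta> \<longrightarrow>
        (\<integral>t. \<bar>U (x, t) - \<sigma> t\<bar> \<partial>lborel) \<le> e)"

lemma slice_integrable_t:
  assumes "bounded_on_rect T M U" shows "integrable lborel (\<lambda>t. U (x, t))"
proof -
  have [measurable]: "U \<in> borel_measurable borel" using assms by (simp add: bounded_on_rect_def)
  show ?thesis
    by (rule integrable_bounded_support[where C=M and S="{0<..<T}"])
      (use assms in \<open>auto simp: bounded_on_rect_def rect_def intro: borel_measurable_slice_snd\<close>)
qed

lemma strong_trace_has_trace:
  assumes tr: "strong_trace T a u \<tau>" and U: "representative T M u U"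
  shows "has_trace a U (\<lambda>t. indicator {0<..<T} t * \<tau> t)"
  unfolding has_trace_def
proof (intro conjI allI impI)
  show i: "integrable lborel (\<lambda>t. indicator {0<..<T} t * \<tau> t)"
    using tr by (simp add: strong_trace_def set_integrable_def)
  fix e :: real assume e: "0 < e"
  obtain N where N: "N \<in> null_sets lborel"
    "\<And>x. x \<in> {0<..<1} - N \<Longrightarrow> set_integrable lborel {0<..<T} (\<lambda>t. u x t)"
    and lim: "((\<lambda>x. L1_norm {0<..<T} (\<lambda>t. u x t - \<tau> t)) \<longlongrightarrow> 0) (at a within {0<..<1} - N)"
    using tr by (auto simp: strong_trace_def)
  have "eventually (\<lambda>x. L1_norm {0<..<T} (\<lambda>t. u x t - \<tau> t) < e) (at a within {0<..<1} - N)"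
    by (rule order_tendstoD(2)[OF lim e])
  then obtain d where d: "0 < d"
    "\<And>x. x \<in> {0<..<1} - N \<Longrightarrow> x \<noteq> a \<Longrightarrow> dist x a < d \<Longrightarrow> L1_norm {0<..<T} (\<lambda>t. u x t - \<tau> t) < e"
    by (auto simp: eventually_at)
  have bU: "bounded_on_rect T M U" and ae: "AE p in lborel. p \<in> rect T \<longrightarrow> U p = u (fst p) (snd p)"
    using U by (auto simp: representative_def)
  have "AE x in lborel. x \<in> {0<..<1} \<and> \<bar>x - a\<bar> < d \<longrightarrow>
        (\<integral>t. \<bar>U (x, t) - indicator {0<..<T} t * \<tau> t\<bar> \<partial>lborel) \<le> e"
    using AE_slices(1)[OF ae] AE_not_in[OF N(1)] AE_lborel_singleton[of a]
  proof eventually_elim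
    case (elim x)
    show ?case
    proof
      assume x: "x \<in> {0<..<1} \<and> \<bar>x - a\<bar> < d"
      then have ux: "set_integrable lborel {0<..<T} (\<lambda>t. u x t)" using N(2) elim by auto
      then have [measurable]: "(\<lambda>t. indicator {0<..<T} t * u x t) \<in> borel_measurable borel"
        by (auto simp: set_integrable_def dest: borel_measurable_integrable)
      have [measurable]: "(\<lambda>t. indicator {0<..<T} t * \<tau> t) \<in> borel_measurable borel"
        using i by (auto dest: borel_measurable_integrable)
      have "(\<integral>t. \<bar>U (x, t) - indicator {0<..<T} t * \<tau> t\<bar> \<partial>lborel)
          = (\<integral>t. \<bar>indicator {0<..<T} t * u x t - indicator {0<..<T} t * \<tau> t\<bar> \<partial>lborel)"
      proof (rule integral_cong_AE)
        show "AE t in lborel. \<bar>U (x, t) - indicator {0<..<T} t * \<tau> t\<bar>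
            = \<bar>indicator {0<..<T} t * u x t - indicator {0<..<T} t * \<tau> t\<bar>"
          using elim(1) 
        proof eventually_elim
          case (elim t)
          then show ?case using x bU by (cases "t \<in> {0<..<T}") (auto simp: rect_def bounded_on_rect_def)
        qed
      qed (use slice_integrable_t[OF bU, of x] in \<open>auto dest: borel_measurable_integrable\<close>)
      also have "\<dots> = L1_norm {0<..<T} (\<lambda>t. u x t - \<tau> t)"
        unfolding L1_norm_def set_lebesgue_integral_def
        by (rule Bochner_Integration.integral_cong) (auto simp: indicator_def)
      also have "\<dots> \<le> e" using d(2)[of x] x elim by (auto simp: dist_real_def)
      finally show "(\<integral>t. \<bar>U (x, t) - indicator {0<..<T} t * \<tau> t\<bar> \<partial>lborel) \<le> e" .
    qed
  qed
  with d(1) show "\<exists>\<delta>>0. AE x in lborel. x \<in> {0<..<1} \<and> \<bar>x - a\<bar> < \<delta> \<longrightarrow>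
        (\<integral>t. \<bar>U (x, t) - indicator {0<..<T} t * \<tau> t\<bar> \<partial>lborel) \<le> e" by blast
qed

text \<open>
  Where \<open>\<bar>\<sigma> t\<bar> > M\<close>, the excess is at most \<open>\<bar>U (x, t) - \<sigma> t\<bar>\<close>, whose integral over \<open>t\<close> is as small as one
  likes for suitable \<open>x\<close>.
\<close>

lemma trace_bounded:
  assumes tr: "has_trace a U \<sigma>" and a: "a = 0 \<or> a = 1" and bU: "bounded_on_rect T M U"
  shows "AE t in lborel. \<bar>\<sigma> t\<bar> \<le> M"
proof -
  have i: "integrable lborel \<sigma>" using tr by (simp add: has_trace_def)
  then have [measurable]: "\<sigma> \<in> borel_measurable borel" by (auto dest: borel_measurable_integrable)
  have [measurable]: "U \<in> borel_measurable borel" and M: "\<And>p. \<bar>U p\<bar> \<le> M"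
    using bU unfolding bounded_on_rect_def by blast+
  have M0: "0 \<le> M" using M[of 0] by linarith
  have im: "integrable lborel (\<lambda>t. max 0 (\<bar>\<sigma> t\<bar> - M))"
    by (rule Bochner_Integration.integrable_bound[OF i]) (use M0 in auto)
  have "(\<integral>t. max 0 (\<bar>\<sigma> t\<bar> - M) \<partial>lborel) \<le> 0 + e" if e: "0 < e" for e
  proof -
    obtain d where d: "0 < d" "AE x in lborel. x \<in> {0<..<1} \<and> \<bar>x - a\<bar> < d \<longrightarrow>
        (\<integral>t. \<bar>U (x, t) - \<sigma> t\<bar> \<partial>lborel) \<le> e"
      using tr e unfolding has_trace_def by blast
    have "\<exists>l r. l < r \<and> (\<forall>x\<in>{l<..<r}. x \<in> {0<..<1} \<and> \<bar>x - a\<bar> < d)"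
    proof (cases "a = 0")
      case True
      then show ?thesis using d(1) by (intro exI[of _ 0] exI[of _ "min 1 d"]) auto
    next
      case False
      then show ?thesis using a d(1) by (intro exI[of _ "max 0 (1 - d)"] exI[of _ 1]) auto
    qed
    then obtain l r where lr: "l < r" "\<And>x. x \<in> {l<..<r} \<Longrightarrow> x \<in> {0<..<1} \<and> \<bar>x - a\<bar> < d" by blast
    have "AE x in lborel. x \<in> {l<..<r} \<longrightarrow> (\<integral>t. \<bar>U (x, t) - \<sigma> t\<bar> \<partial>lborel) \<le> e"
      using d(2) by eventually_elim (use lr(2) in blast)
    from AE_interval_ex[OF lr(1) this] obtain x where x: "(\<integral>t. \<bar>U (x, t) - \<sigma> t\<bar> \<partial>lborel) \<le> e" by blast
    have "(\<integral>t. max 0 (\<bar>\<sigma> t\<bar> - M) \<partial>lborel) \<le> (\<integral>t. \<bar>U (x, t) - \<sigma> t\<bar> \<partial>lborel)"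
    proof (rule integral_mono[OF im])
      show "integrable lborel (\<lambda>t. \<bar>U (x, t) - \<sigma> t\<bar>)"
        using slice_integrable_t[OF bU, of x] i by auto
      show "max 0 (\<bar>\<sigma> t\<bar> - M) \<le> \<bar>U (x, t) - \<sigma> t\<bar>" for t using M[of "(x, t)"] by linarith
    qed
    with x show ?thesis by simp
  qed
  then have "(\<integral>t. max 0 (\<bar>\<sigma> t\<bar> - M) \<partial>lborel) \<le> 0" by (rule field_le_epsilon)
  then have "(\<integral>t. max 0 (\<bar>\<sigma> t\<bar> - M) \<partial>lborel) = 0"
    by (intro antisym Bochner_Integration.integral_nonneg) auto
  then have "AE t in lborel. max 0 (\<bar>\<sigma> t\<bar> - M) = 0"
    using im by (subst (asm) integral_nonneg_eq_0_iff_AE) auto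
  then show ?thesis by eventually_elim (auto simp: max_def split: if_splits)
qed

section \<open>From the interior inequality to the L1 distance\<close>

lemma flux_trace_limit:
  assumes trU: "has_trace a U \<sigma>" and trV: "has_trace a V \<rho>" and a: "a = 0 \<or> a = 1"
    and bU: "bounded_on_rect T M U" and bV: "bounded_on_rect T M V"
    and f[measurable]: "f \<in> borel_measurable borel" and lip: "L-lipschitz_on {-M..M} f"
    and b: "bump 0 T b" and e: "0 < e"
  shows "\<exists>\<delta>>0. AE x in lborel. x \<in> {0<..<1} \<and> \<bar>x - a\<bar> < \<delta> \<longrightarrow>
     \<bar>(\<integral>t. kruzkov_flux f (U (x, t)) (V (x, t)) * b t \<partial>lborel) - (\<integral>t. kruzkov_flux f (\<sigma> t) (\<rho> t) * b t \<partial>lborel)\<bar> \<le> e"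
proof -
  obtain C where C: "0 < C" "\<And>t. \<bar>b t\<bar> \<le> C" using bump_bounded[OF b] by metis
  have [measurable]: "U \<in> borel_measurable borel" "V \<in> borel_measurable borel"
    and M: "\<And>p. \<bar>U p\<bar> \<le> M" "\<And>p. \<bar>V p\<bar> \<le> M"
    using bU bV unfolding bounded_on_rect_def by blast+
  have L0: "0 \<le> L" using lip by (rule lipschitz_on_nonneg)
  have LM0: "0 \<le> L * (2 * M)" using L0 M(1)[of 0] by (intro mult_nonneg_nonneg) auto
  have [measurable]: "b \<in> borel_measurable borel" by (rule bump_measurable[OF b])
  have i: "integrable lborel \<sigma>" "integrable lborel \<rho>" using trU trV by (auto simp: has_trace_def)
  then have [measurable]: "\<sigma> \<in> borel_measurable borel" "\<rho> \<in> borel_measurable borel"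
    by (auto dest: borel_measurable_integrable)
  have M\<sigma>: "AE t in lborel. \<bar>\<sigma> t\<bar> \<le> M" "AE t in lborel. \<bar>\<rho> t\<bar> \<le> M"
    by (rule trace_bounded[OF trU a bU], rule trace_bounded[OF trV a bV])
  have bz: "b t = 0" if "t \<notin> {0<..<T}" for t using bump_zero[OF b that] .
  have i\<sigma>: "integrable lborel (\<lambda>t. kruzkov_flux f (\<sigma> t) (\<rho> t) * b t)"
  proof (rule integrableI_bounded_set[where A="{0<..<T}" and B="L * (2 * M) * C"])
    show "(\<lambda>t. kruzkov_flux f (\<sigma> t) (\<rho> t) * b t) \<in> borel_measurable lborel"
      unfolding kruzkov_flux_def by measurable
    show "AE t in lborel. t \<in> {0<..<T} \<longrightarrow> norm (kruzkov_flux f (\<sigma> t) (\<rho> t) * b t) \<le> L * (2 * M) * C"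
      using M\<sigma> by eventually_elim
        (auto simp: abs_mult intro!: mult_mono C kruzkov_flux_bound[OF lip] LM0)
    show "AE t in lborel. t \<notin> {0<..<T} \<longrightarrow> kruzkov_flux f (\<sigma> t) (\<rho> t) * b t = 0" using bz by auto
  qed (use emeasure_bounded_finite[of "{0<..<T}"] in auto)
  have iU: "integrable lborel (\<lambda>t. kruzkov_flux f (U (x, t)) (V (x, t)) * b t)" for x
  proof (rule integrable_bounded_support[where C="L * (2 * M) * C" and S="{0<..<T}"])
    show "(\<lambda>t. kruzkov_flux f (U (x, t)) (V (x, t)) * b t) \<in> borel_measurable borel"
      unfolding kruzkov_flux_def by measurable
    show "\<bar>kruzkov_flux f (U (x, t)) (V (x, t)) * b t\<bar> \<le> L * (2 * M) * C" for t
      unfolding abs_mult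
      by (intro mult_mono C kruzkov_flux_bound[OF lip] M LM0) auto
  qed (use bz in auto)
  define e' where "e' = e / (2 * L * C + 1)"
  have "0 < 2 * L * C + 1" using L0 C(1) by (simp add: add_nonneg_pos)
  then have e': "0 < e'" "(2 * L * C + 1) * e' = e" using e by (auto simp: e'_def)
  obtain d1 where d1: "0 < d1" "AE x in lborel. x \<in> {0<..<1} \<and> \<bar>x - a\<bar> < d1 \<longrightarrow> (\<integral>t. \<bar>U (x, t) - \<sigma> t\<bar> \<partial>lborel) \<le> e'"
    using trU e'(1) unfolding has_trace_def by blast
  obtain d2 where d2: "0 < d2" "AE x in lborel. x \<in> {0<..<1} \<and> \<bar>x - a\<bar> < d2 \<longrightarrow> (\<integral>t. \<bar>V (x, t) - \<rho> t\<bar> \<partial>lborel) \<le> e'"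
    using trV e'(1) unfolding has_trace_def by blast
  show ?thesis
  proof (intro exI[of _ "min d1 d2"] conjI)
    show "AE x in lborel. x \<in> {0<..<1} \<and> \<bar>x - a\<bar> < min d1 d2 \<longrightarrow>
     \<bar>(\<integral>t. kruzkov_flux f (U (x, t)) (V (x, t)) * b t \<partial>lborel) - (\<integral>t. kruzkov_flux f (\<sigma> t) (\<rho> t) * b t \<partial>lborel)\<bar> \<le> e"
      using d1(2) d2(2)
    proof eventually_elim
      case (elim x)
      show ?case
      proof
        assume x: "x \<in> {0<..<1} \<and> \<bar>x - a\<bar> < min d1 d2"
        have iUs: "integrable lborel (\<lambda>t. \<bar>U (x, t) - \<sigma> t\<bar>)" "integrable lborel (\<lambda>t. \<bar>V (x, t) - \<rho> t\<bar>)"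
          using slice_integrable_t[OF bU, of x] slice_integrable_t[OF bV, of x] i by auto
        have "\<bar>(\<integral>t. kruzkov_flux f (U (x, t)) (V (x, t)) * b t \<partial>lborel) - (\<integral>t. kruzkov_flux f (\<sigma> t) (\<rho> t) * b t \<partial>lborel)\<bar>
          = norm (\<integral>t. kruzkov_flux f (U (x, t)) (V (x, t)) * b t - kruzkov_flux f (\<sigma> t) (\<rho> t) * b t \<partial>lborel)"
          using iU i\<sigma> by simp
        also have "\<dots> \<le> (\<integral>t. norm (kruzkov_flux f (U (x, t)) (V (x, t)) * b t - kruzkov_flux f (\<sigma> t) (\<rho> t) * b t) \<partial>lborel)"
          by (rule integral_norm_bound)
        also have "\<dots> \<le> (\<integral>t. (L * C) * (\<bar>U (x, t) - \<sigma> t\<bar> + \<bar>V (x, t) - \<rho> t\<bar>) \<partial>lborel)"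
        proof (rule integral_mono_AE)
          show "AE t in lborel. norm (kruzkov_flux f (U (x, t)) (V (x, t)) * b t - kruzkov_flux f (\<sigma> t) (\<rho> t) * b t)
             \<le> (L * C) * (\<bar>U (x, t) - \<sigma> t\<bar> + \<bar>V (x, t) - \<rho> t\<bar>)"
            using M\<sigma>
          proof eventually_elim
            case (elim t)
            have "\<bar>kruzkov_flux f (U (x, t)) (V (x, t)) - kruzkov_flux f (U (x, t)) (\<rho> t)\<bar> \<le> L * \<bar>V (x, t) - \<rho> t\<bar>"
              by (rule kruzkov_flux_Lipschitz[OF lip]) (auto intro: M elim)
            moreover have "\<bar>kruzkov_flux f (\<rho> t) (U (x, t)) - kruzkov_flux f (\<rho> t) (\<sigma> t)\<bar> \<le> L * \<bar>U (x, t) - \<sigma> t\<bar>"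
              by (rule kruzkov_flux_Lipschitz[OF lip]) (auto intro: M elim)
            ultimately have "\<bar>kruzkov_flux f (U (x, t)) (V (x, t)) - kruzkov_flux f (\<sigma> t) (\<rho> t)\<bar>
                \<le> L * (\<bar>U (x, t) - \<sigma> t\<bar> + \<bar>V (x, t) - \<rho> t\<bar>)"
              unfolding kruzkov_flux_commute[of f "\<rho> t"] by (simp add: distrib_left)
            then have "\<bar>kruzkov_flux f (U (x, t)) (V (x, t)) - kruzkov_flux f (\<sigma> t) (\<rho> t)\<bar> * \<bar>b t\<bar>
                \<le> L * (\<bar>U (x, t) - \<sigma> t\<bar> + \<bar>V (x, t) - \<rho> t\<bar>) * C"
              using C L0 by (intro mult_mono) auto
            then show ?case unfolding real_norm_def left_diff_distrib[symmetric] abs_mult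
              by (simp only: mult_ac)
          qed
        qed (use iU i\<sigma> iUs in auto)
        also have "\<dots> = (L * C) * ((\<integral>t. \<bar>U (x, t) - \<sigma> t\<bar> \<partial>lborel) + (\<integral>t. \<bar>V (x, t) - \<rho> t\<bar> \<partial>lborel))"
          using iUs by simp
        also have "\<dots> \<le> (L * C) * (e' + e')"
          using x elim L0 C(1) by (intro mult_left_mono add_mono) auto
        also have "\<dots> \<le> e" using e' by (simp add: algebra_simps)
        finally show "\<bar>(\<integral>t. kruzkov_flux f (U (x, t)) (V (x, t)) * b t \<partial>lborel) - (\<integral>t. kruzkov_flux f (\<sigma> t) (\<rho> t) * b t \<partial>lborel)\<bar> \<le> e" .
      qed
    qed
  qed (use d1 d2 in auto)
qed

lemma mollifier_shift:
  assumes "mollifier h d"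
  shows "integrable lborel (\<lambda>x. d (x - c))" "(\<integral>x. d (x - c) \<partial>lborel) = 1"
proof -
  show "integrable lborel (\<lambda>x. d (x - c))"
    using lborel_integrable_real_affine[OF mollifier_integrable[OF assms], of 1 "- c"] by simp
  show "(\<integral>x. d (x - c) \<partial>lborel) = 1"
    using lborel_integral_real_affine[of 1 d "- c"] assms by (simp add: mollifier_def)
qed

text \<open>
  The spatial cut-off in \<open>kruzkov_doubling\<close> is a plateau whose slopes lie in \<open>(h, 3h)\<close> and
  \<open>(1 - 3h, 1 - h)\<close>. Its derivative is a mollifier near \<open>0\<close> minus a mollifier near \<open>1\<close>, so the flux term
  tends to the flux of the traces at \<open>0\<close> minus that at \<open>1\<close>, which is not positive.
\<close>

lemma boundary_flux_inequality:
  assumes lip: "L-lipschitz_on {-M..M} f" and U: "bounded_on_rect T M U" and V: "bounded_on_rect T M V"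
    and S: "bounded_on_rect T N S" and Z: "bounded_on_rect T N Z"
    and kU: "kruzkov_solution T f U S" and kV: "kruzkov_solution T f V Z"
    and f[measurable]: "f \<in> borel_measurable borel"
    and tr0: "has_trace 0 U \<sigma>0" "has_trace 0 V \<rho>0" and tr1: "has_trace 1 U \<sigma>1" "has_trace 1 V \<rho>1"
    and sign: "AE t in lborel. t \<in> {0<..<T} \<longrightarrow> kruzkov_flux f (\<sigma>0 t) (\<rho>0 t) \<le> 0 \<and> 0 \<le> kruzkov_flux f (\<sigma>1 t) (\<rho>1 t)"
    and b: "bump 0 T b" "\<And>t. 0 \<le> b t"
  shows "0 \<le> (\<integral>p. \<bar>U p - V p\<bar> * deriv b (snd p) + \<bar>S p - Z p\<bar> * b (snd p) \<partial>lborel)"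
    (is "0 \<le> (\<integral>p. ?G p \<partial>lborel)")
proof (rule field_le_epsilon)
  fix e2 :: real assume "0 < e2"
  define e where "e = e2 / 2"
  have e: "0 < e" "2 * e = e2" using \<open>0 < e2\<close> by (auto simp: e_def)
  have [measurable]: "U \<in> borel_measurable borel" "V \<in> borel_measurable borel"
      "S \<in> borel_measurable borel" "Z \<in> borel_measurable borel"
    and M: "\<And>p. \<bar>U p\<bar> \<le> M" "\<And>p. \<bar>V p\<bar> \<le> M" "\<And>p. \<bar>S p\<bar> \<le> N" "\<And>p. \<bar>Z p\<bar> \<le> N"
    and z: "\<And>p. p \<notin> rect T \<Longrightarrow> U p = 0" "\<And>p. p \<notin> rect T \<Longrightarrow> V p = 0"
       "\<And>p. p \<notin> rect T \<Longrightarrow> S p = 0" "\<And>p. p \<notin> rect T \<Longrightarrow> Z p = 0"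
    using U V S Z unfolding bounded_on_rect_def by blast+
  have M0: "0 \<le> M" using M(1)[of 0] by linarith
  have N0: "0 \<le> N" using M(3)[of 0] by linarith
  have b': "bump 0 T (deriv b)" using b by (auto intro: bump_deriv)
  note [measurable] = borel_measurable_comp_snd[OF bump_measurable[OF b(1)]] borel_measurable_comp_snd[OF bump_measurable[OF b']]
  obtain Cb where Cb: "0 < Cb" "\<And>x. \<bar>b x\<bar> \<le> Cb" using bump_bounded[OF b(1)] by metis
  obtain Cb' where Cb': "0 < Cb'" "\<And>x. \<bar>deriv b x\<bar> \<le> Cb'" using bump_bounded[OF b'] by metis
  define \<Phi> where "\<Phi> x = (\<integral>t. kruzkov_flux f (U (x, t)) (V (x, t)) * b t \<partial>lborel)" for x
  have sg0: "(\<integral>t. kruzkov_flux f (\<sigma>0 t) (\<rho>0 t) * b t \<partial>lborel) \<le> 0"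
  proof -
    have "0 \<le> (\<integral>t. - (kruzkov_flux f (\<sigma>0 t) (\<rho>0 t) * b t) \<partial>lborel)"
    proof (rule integral_nonneg_AE)
      show "AE t in lborel. 0 \<le> - (kruzkov_flux f (\<sigma>0 t) (\<rho>0 t) * b t)"
        using sign
      proof eventually_elim
        case (elim t)
        then show ?case using bump_zero[OF b(1), of t] b(2)[of t]
          by (cases "t \<in> {0<..<T}") (auto simp: mult_le_0_iff)
      qed
    qed
    then show ?thesis by simp
  qed
  have sg1: "0 \<le> (\<integral>t. kruzkov_flux f (\<sigma>1 t) (\<rho>1 t) * b t \<partial>lborel)"
  proof (rule integral_nonneg_AE)
    show "AE t in lborel. 0 \<le> kruzkov_flux f (\<sigma>1 t) (\<rho>1 t) * b t"
      using sign
    proof eventually_elim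
      case (elim t)
      then show ?case using bump_zero[OF b(1), of t] b(2)[of t]
        by (cases "t \<in> {0<..<T}") auto
    qed
  qed
  obtain d0 where d0: "0 < d0" "AE x in lborel. x \<in> {0<..<1} \<and> \<bar>x - 0\<bar> < d0 \<longrightarrow>
       \<bar>\<Phi> x - (\<integral>t. kruzkov_flux f (\<sigma>0 t) (\<rho>0 t) * b t \<partial>lborel)\<bar> \<le> e"
    using flux_trace_limit[OF tr0 disjI1[OF refl] U V f lip b(1) e(1)] unfolding \<Phi>_def by blast
  obtain d1 where d1: "0 < d1" "AE x in lborel. x \<in> {0<..<1} \<and> \<bar>x - 1\<bar> < d1 \<longrightarrow>
       \<bar>\<Phi> x - (\<integral>t. kruzkov_flux f (\<sigma>1 t) (\<rho>1 t) * b t \<partial>lborel)\<bar> \<le> e"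
    using flux_trace_limit[OF tr1 disjI2[OF refl] U V f lip b(1) e(1)] unfolding \<Phi>_def by blast
  \<comment> \<open>The slopes reach up to \<open>3 h\<close> from the ends; there the traces must be good approximations,
    and the two slopes must be disjoint.\<close>
  define h where "h n = min (1/8) (min d0 d1 / 4) * (1 / real (Suc n))" for n
  have hb: "h n \<le> 1 / 8" "4 * h n \<le> d0" "4 * h n \<le> d1" "0 < h n" for n
  proof -
    have h1: "h n \<le> min (1/8) (min d0 d1 / 4) * 1" unfolding h_def
      by (rule mult_left_mono) (use d0(1) d1(1) in auto)
    then show "h n \<le> 1 / 8" "4 * h n \<le> d0" "4 * h n \<le> d1" by auto
    show "0 < h n" using d0(1) d1(1) by (simp add: h_def)
  qed
  have h_lim: "h \<longlonglongrightarrow> 0"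
    unfolding h_def[abs_def] using tendsto_mult_left[OF LIMSEQ_Suc[OF lim_1_over_n]] by simp
  have "\<forall>n. \<exists>d. mollifier (h n) d" using mollifier_exists hb(4) by blast
  then obtain d where d: "\<And>n. mollifier (h n) (d n)" by metis
  have "\<exists>c. smooth c \<and> (\<forall>x. (c has_real_derivative d n (x - 2 * h n) - d n (x - (1 - 2 * h n))) (at x)) \<and>
      (\<forall>x. 0 \<le> c x \<and> c x \<le> 1) \<and> (\<forall>x. x \<notin> {h n..1 - h n} \<longrightarrow> c x = 0) \<and>
      (\<forall>x. x \<in> {3 * h n..1 - 3 * h n} \<longrightarrow> c x = 1)" for n
  proof -
    have "2 * h n + 2 * h n \<le> 1 - 2 * h n" using hb(1)[of n] by simp
    from plateau[OF d this] obtain c where c: "smooth c" "\<And>x. (c has_real_derivative d n (x - 2 * h n) - d n (x - (1 - 2 * h n))) (at x)"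
      "\<And>x. 0 \<le> c x" "\<And>x. c x \<le> 1" "\<And>x. x \<notin> {2 * h n - h n..1 - 2 * h n + h n} \<Longrightarrow> c x = 0"
      "\<And>x. x \<in> {2 * h n + h n..1 - 2 * h n - h n} \<Longrightarrow> c x = 1" by metis
    show ?thesis
      using c(1-4) c(5,6) by (intro exI[of _ c]) auto
  qed
  then obtain c where c: "\<And>n. smooth (c n)"
      "\<And>n x. (c n has_real_derivative d n (x - 2 * h n) - d n (x - (1 - 2 * h n))) (at x)"
      "\<And>n x. 0 \<le> c n x" "\<And>n x. c n x \<le> 1" "\<And>n x. x \<notin> {h n..1 - h n} \<Longrightarrow> c n x = 0"
      "\<And>n x. x \<in> {3 * h n..1 - 3 * h n} \<Longrightarrow> c n x = 1" by metis
  have bc: "bump 0 1 (c n)" for n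
    unfolding bump_def using c(1,5) hb(1,4)[of n] by (intro conjI exI[of _ "h n"] exI[of _ "1 - h n"]) auto
  have c': "deriv (c n) x = d n (x - 2 * h n) - d n (x - (1 - 2 * h n))" for n x
    by (rule DERIV_imp_deriv[OF c(2)])
  note [measurable] = borel_measurable_comp_fst[OF bump_measurable[OF bc]]
    borel_measurable_comp_fst[OF bump_measurable[OF bump_deriv[OF bc]]]
  have Gb: "\<bar>?G p\<bar> \<le> 2 * M * Cb' + 2 * N * Cb" for p
    using M(1)[of p] M(2)[of p] M(3)[of p] M(4)[of p]
    by (intro order_trans[OF abs_triangle_ineq] add_mono abs_mult_le Cb Cb') auto
  have Gz: "?G p = 0" if "p \<notin> rect T" for p using z that by simp
  have iG: "integrable lborel ?G"
    by (rule integrable_bounded_support[OF _ Gb bounded_rect[of T]]) (simp, use Gz in blast)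
  have iX: "integrable lborel (\<lambda>p. ?G p * c n (fst p))" for n
  proof (rule Bochner_Integration.integrable_bound[OF iG])
    have "\<bar>?G p\<bar> * \<bar>c n (fst p)\<bar> \<le> \<bar>?G p\<bar>" for p
      using c(3,4)[of n "fst p"] by (intro mult_left_le) auto
    then show "AE p in lborel. norm (?G p * c n (fst p)) \<le> norm (?G p)" by (simp add: abs_mult)
  qed simp
  have iY: "integrable lborel (\<lambda>p. kruzkov_flux f (U p) (V p) * (deriv (c n) (fst p) * b (snd p)))" for n
  proof -
    obtain Cc where Cc: "0 < Cc" "\<And>x. \<bar>deriv (c n) x\<bar> \<le> Cc" using bump_bounded[OF bump_deriv[OF bc]] by metis
    show ?thesis
    proof (rule integrable_bounded_support[OF _ _ bounded_rect[of T]])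
      show "\<bar>kruzkov_flux f (U p) (V p) * (deriv (c n) (fst p) * b (snd p))\<bar> \<le> L * (2 * M) * (Cc * Cb)" for p
        by (intro abs_mult_le kruzkov_flux_bound[OF lip] M Cc Cb)
      show "kruzkov_flux f (U p) (V p) * (deriv (c n) (fst p) * b (snd p)) = 0" if "p \<notin> rect T" for p
        using z(1,2)[OF that] by (simp add: kruzkov_flux_def)
    qed (simp add: kruzkov_flux_def)
  qed
  have Y: "(\<integral>p. kruzkov_flux f (U p) (V p) * (deriv (c n) (fst p) * b (snd p)) \<partial>lborel) \<le> 2 * e" for n
  proof -
    have "(\<integral>p. kruzkov_flux f (U p) (V p) * (deriv (c n) (fst p) * b (snd p)) \<partial>lborel)
        = (\<integral>x. \<integral>t. kruzkov_flux f (U (x, t)) (V (x, t)) * (deriv (c n) x * b t) \<partial>lborel \<partial>lborel)"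
      using integral_plane(2)[OF iY] by simp
    also have "\<dots> = (\<integral>x. deriv (c n) x * \<Phi> x \<partial>lborel)"
      unfolding \<Phi>_def by (simp add: mult_ac flip: integral_mult_right_zero)
    also have "\<dots> \<le> (\<integral>x. d n (x - 2 * h n) * e + d n (x - (1 - 2 * h n)) * e \<partial>lborel)"
    proof (rule integral_mono_AE)
      show "integrable lborel (\<lambda>x. deriv (c n) x * \<Phi> x)"
        using integral_plane(4)[OF iY[of n]] unfolding \<Phi>_def by (simp add: mult_ac flip: integral_mult_right_zero)
      show "integrable lborel (\<lambda>x. d n (x - 2 * h n) * e + d n (x - (1 - 2 * h n)) * e)"
        using mollifier_shift(1)[OF d] by simp
      show "AE x in lborel. deriv (c n) x * \<Phi> x \<le> d n (x - 2 * h n) * e + d n (x - (1 - 2 * h n)) * e"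
        using d0(2) d1(2)
      proof eventually_elim
        case (elim x)
        have dn: "0 \<le> d n y" and dz: "h n \<le> \<bar>y\<bar> \<Longrightarrow> d n y = 0" for y using d[of n] by (auto simp: mollifier_def)
        have "d n (x - 2 * h n) * \<Phi> x \<le> d n (x - 2 * h n) * e"
        proof (cases "\<bar>x - 2 * h n\<bar> < h n")
          case True
          then have "x \<in> {0<..<1} \<and> \<bar>x - 0\<bar> < d0" using hb[of n] by (auto simp: abs_less_iff)
          then have "\<Phi> x \<le> e" using elim sg0 by (auto simp: abs_le_iff)
          then show ?thesis using dn by (intro mult_left_mono)
        qed (use dz in auto)
        moreover have "d n (x - (1 - 2 * h n)) * (- \<Phi> x) \<le> d n (x - (1 - 2 * h n)) * e"
        proof (cases "\<bar>x - (1 - 2 * h n)\<bar> < h n")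
          case True
          then have "x \<in> {0<..<1} \<and> \<bar>x - 1\<bar> < d1" using hb[of n] by (auto simp: abs_less_iff)
          then have "- \<Phi> x \<le> e" using elim sg1 by (auto simp: abs_le_iff)
          then show ?thesis using dn by (intro mult_left_mono)
        qed (use dz in auto)
        ultimately show ?case by (simp add: c' algebra_simps)
      qed
    qed
    also have "\<dots> = 2 * e" using mollifier_shift[OF d[of n]] by simp
    finally show ?thesis .
  qed
  have X: "- (2 * e) \<le> (\<integral>p. ?G p * c n (fst p) \<partial>lborel)" for n
  proof -
    have "0 \<le> (\<integral>p. weak_form (c n) b \<bar>U p - V p\<bar> (kruzkov_flux f (U p) (V p)) \<bar>S p - Z p\<bar> p \<partial>lborel)"
      by (rule kruzkov_doubling[OF lip U V S Z kU kV f bc c(3) b])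
    also have "\<dots> = (\<integral>p. ?G p * c n (fst p) + kruzkov_flux f (U p) (V p) * (deriv (c n) (fst p) * b (snd p)) \<partial>lborel)"
      by (rule Bochner_Integration.integral_cong) (simp_all add: algebra_simps)
    also have "\<dots> = (\<integral>p. ?G p * c n (fst p) \<partial>lborel)
        + (\<integral>p. kruzkov_flux f (U p) (V p) * (deriv (c n) (fst p) * b (snd p)) \<partial>lborel)"
      by (rule Bochner_Integration.integral_add[OF iX iY])
    finally show ?thesis using Y[of n] by linarith
  qed
  have "(\<lambda>n. \<integral>p. ?G p * c n (fst p) \<partial>lborel) \<longlonglongrightarrow> (\<integral>p. ?G p \<partial>lborel)"
  proof (rule integral_dominated_convergence[where w="\<lambda>p. \<bar>?G p\<bar>"])
    show "integrable lborel (\<lambda>p. \<bar>?G p\<bar>)" using iG by (rule integrable_abs)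
    show "AE p in lborel. norm (?G p * c n (fst p)) \<le> \<bar>?G p\<bar>" for n
    proof (rule AE_I2)
      fix p show "norm (?G p * c n (fst p)) \<le> \<bar>?G p\<bar>"
        using c(3,4)[of n "fst p"] unfolding real_norm_def abs_mult by (intro mult_left_le) auto
    qed
    show "AE p in lborel. (\<lambda>n. ?G p * c n (fst p)) \<longlonglongrightarrow> ?G p"
    proof (rule AE_I2)
      fix p
      show "(\<lambda>n. ?G p * c n (fst p)) \<longlonglongrightarrow> ?G p"
      proof (cases "p \<in> rect T")
        case True
        then have "0 < min (fst p) (1 - fst p) / 3" by (auto simp: rect_def)
        then have "eventually (\<lambda>n. h n < min (fst p) (1 - fst p) / 3) sequentially"
          using h_lim by (rule order_tendstoD(2)[rotated])
        then have "eventually (\<lambda>n. ?G p * c n (fst p) = ?G p) sequentially"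
          by eventually_elim (subst c(6), auto simp: min_def split: if_splits)
        then show ?thesis by (rule tendsto_eventually)
      next
        case False
        then show ?thesis using Gz[OF False] by (simp only: mult_zero_left tendsto_const)
      qed
    qed
  qed simp_all
  then have "- (2 * e) \<le> (\<integral>p. ?G p \<partial>lborel)" by (rule LIMSEQ_le_const) (use X in auto)
  then show "0 \<le> (\<integral>p. ?G p \<partial>lborel) + e2" using e by simp
qed

text \<open>
  At time \<open>t\<close> the two primitives differ by at most \<open>w t\<close>, whatever \<open>x\<close> is.
\<close>

lemma L1_distance_inequality:
  assumes U: "bounded_on_rect T M U" and V: "bounded_on_rect T M V" and g: "0 \<le> \<gamma>"
    and b: "bump 0 T b" "\<And>t. 0 \<le> b t"
    and ineq: "0 \<le> (\<integral>p. \<bar>U p - V p\<bar> * deriv b (snd p)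
      + \<bar>\<gamma> * primitive_x T U p - \<gamma> * primitive_x T V p\<bar> * b (snd p) \<partial>lborel)"
  defines "w \<equiv> \<lambda>t. \<integral>x. \<bar>U (x, t) - V (x, t)\<bar> \<partial>lborel"
  shows "0 \<le> (\<integral>t. w t * (deriv b t + \<gamma> * b t) \<partial>lborel)" and "w \<in> borel_measurable borel"
    and "\<And>t. \<bar>w t\<bar> \<le> 2 * M"
proof -
  have [measurable]: "U \<in> borel_measurable borel" "V \<in> borel_measurable borel"
    and M: "\<And>p. \<bar>U p\<bar> \<le> M" "\<And>p. \<bar>V p\<bar> \<le> M"
    and z: "\<And>p. p \<notin> rect T \<Longrightarrow> U p = 0" "\<And>p. p \<notin> rect T \<Longrightarrow> V p = 0"
    using U V unfolding bounded_on_rect_def by blast+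
  have M0: "0 \<le> M" using M(1)[of 0] by linarith
  have b': "bump 0 T (deriv b)" using b by (auto intro: bump_deriv)
  note [measurable] = bump_measurable[OF b(1)] bump_measurable[OF b']
    borel_measurable_comp_snd[OF bump_measurable[OF b(1)]] borel_measurable_comp_snd[OF bump_measurable[OF b']]
  obtain Cb where Cb: "0 < Cb" "\<And>x. \<bar>b x\<bar> \<le> Cb" using bump_bounded[OF b(1)] by metis
  obtain Cb' where Cb': "0 < Cb'" "\<And>x. \<bar>deriv b x\<bar> \<le> Cb'" using bump_bounded[OF b'] by metis
  have D: "\<bar>U p - V p\<bar> \<le> 2 * M" for p using M(1)[of p] M(2)[of p] by linarith
  show wm[measurable]: "w \<in> borel_measurable borel"
    unfolding w_def by (rule borel_measurable_integral_fst[where F="\<lambda>p. \<bar>U p - V p\<bar>"]) measurable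
  have iD: "integrable lborel (\<lambda>x. \<bar>U (x, t) - V (x, t)\<bar>)" for t
    using slice_integrable[OF U, of t] slice_integrable[OF V, of t] by auto
  have wb: "\<bar>w t\<bar> \<le> 2 * M" for t
  proof -
    have "w t \<le> (\<integral>x. indicator {0<..<1::real} x * (2 * M) \<partial>lborel)"
      unfolding w_def
    proof (rule integral_mono[OF iD])
      show "\<bar>U (x, t) - V (x, t)\<bar> \<le> indicator {0<..<1} x * (2 * M)" for x
        using D[of "(x, t)"] z[of "(x, t)"] by (auto simp: rect_def indicator_def)
    qed simp
    moreover have "0 \<le> w t" unfolding w_def by simp
    ultimately show ?thesis by simp
  qed
  then show "\<And>t. \<bar>w t\<bar> \<le> 2 * M" by simp
  have wnn: "0 \<le> w t" for t unfolding w_def by simp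
  have src: "\<bar>\<gamma> * primitive_x T U p - \<gamma> * primitive_x T V p\<bar> \<le> \<gamma> * (indicator (rect T) p * w (snd p))" for p
  proof (cases "p \<in> rect T")
    case True
    define Iu where "Iu y = indicator {0<..<fst p} y * U (y, snd p)" for y
    define Iv where "Iv y = indicator {0<..<fst p} y * V (y, snd p)" for y
    have i: "integrable lborel Iu" "integrable lborel Iv"
      using integrable_real_mult_indicator[OF _ slice_integrable[OF U, of "snd p"], of "{0<..<fst p}"]
        integrable_real_mult_indicator[OF _ slice_integrable[OF V, of "snd p"], of "{0<..<fst p}"]
      unfolding Iu_def Iv_def by (simp_all add: mult.commute)
    have "\<bar>primitive_x T U p - primitive_x T V p\<bar> = norm (\<integral>y. Iu y - Iv y \<partial>lborel)"
      using True i by (simp add: primitive_x_def Iu_def[symmetric] Iv_def[symmetric])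
    also have "\<dots> \<le> (\<integral>y. norm (Iu y - Iv y) \<partial>lborel)" by (rule integral_norm_bound)
    also have "\<dots> \<le> w (snd p)"
      unfolding w_def
    proof (rule integral_mono[OF _ iD])
      show "integrable lborel (\<lambda>y. norm (Iu y - Iv y))" using i by auto
      show "norm (Iu y - Iv y) \<le> \<bar>U (y, snd p) - V (y, snd p)\<bar>" for y
        by (simp add: Iu_def Iv_def indicator_def)
    qed
    finally have "\<bar>primitive_x T U p - primitive_x T V p\<bar> \<le> w (snd p)" .
    then have "\<gamma> * \<bar>primitive_x T U p - primitive_x T V p\<bar> \<le> \<gamma> * w (snd p)" using g by (rule mult_left_mono)
    then show ?thesis using True g by (simp add: right_diff_distrib[symmetric] abs_mult)
  qed (simp add: primitive_x_def)
  have i1: "integrable lborel (\<lambda>p. \<bar>U p - V p\<bar> * deriv b (snd p))"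
  proof (rule integrable_bounded_support[OF _ _ bounded_rect[of T]])
    show "\<bar>\<bar>U p - V p\<bar> * deriv b (snd p)\<bar> \<le> 2 * M * Cb'" for p by (intro abs_mult_le Cb') (use D in auto)
  qed (use z in auto)
  have i2: "integrable lborel (\<lambda>p. indicator (rect T) p * (\<gamma> * (w (snd p) * b (snd p))))"
  proof (rule integrable_bounded_support[OF _ _ bounded_rect[of T]])
    show "\<bar>indicator (rect T) p * (\<gamma> * (w (snd p) * b (snd p)))\<bar> \<le> 1 * (\<bar>\<gamma>\<bar> * ((2 * M) * Cb))" for p
      by (intro abs_mult_le Cb wb) auto
    note [measurable] = borel_measurable_comp_snd[OF wm]
    show "(\<lambda>p. indicator (rect T) p * (\<gamma> * (w (snd p) * b (snd p)))) \<in> borel_measurable borel" by measurable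
  qed auto
  have i3: "integrable lborel (\<lambda>p. \<bar>\<gamma> * primitive_x T U p - \<gamma> * primitive_x T V p\<bar> * b (snd p))"
  proof (rule Bochner_Integration.integrable_bound[OF i2])
    show "AE p in lborel. norm (\<bar>\<gamma> * primitive_x T U p - \<gamma> * primitive_x T V p\<bar> * b (snd p))
       \<le> norm (indicator (rect T) p * (\<gamma> * (w (snd p) * b (snd p))))"
    proof (rule AE_I2)
      fix p
      show "norm (\<bar>\<gamma> * primitive_x T U p - \<gamma> * primitive_x T V p\<bar> * b (snd p))
         \<le> norm (indicator (rect T) p * (\<gamma> * (w (snd p) * b (snd p))))"
        using mult_right_mono[OF src[of p] b(2)[of "snd p"]] b(2)[of "snd p"] wnn[of "snd p"] g
        by (simp add: abs_mult mult_ac)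
    qed
  qed measurable
  have wint: "integrable lborel (\<lambda>t. w t * k t)" if k: "bump 0 T k" for k
  proof -
    obtain C where "0 < C" "\<And>x. \<bar>k x\<bar> \<le> C" using bump_bounded[OF k] by metis
    with wb show ?thesis
      by (intro integrable_bounded_support[where C="2 * M * C" and S="{0<..<T}"])
        (use bump_measurable[OF k] bump_zero[OF k] in \<open>auto intro!: abs_mult_le simp: wb\<close>)
  qed
  note ineq
  also have "(\<integral>p. \<bar>U p - V p\<bar> * deriv b (snd p) + \<bar>\<gamma> * primitive_x T U p - \<gamma> * primitive_x T V p\<bar> * b (snd p) \<partial>lborel)
      \<le> (\<integral>p. \<bar>U p - V p\<bar> * deriv b (snd p) + indicator (rect T) p * (\<gamma> * (w (snd p) * b (snd p))) \<partial>lborel)"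
  proof (rule integral_mono)
    fix p
    have "\<bar>\<gamma> * primitive_x T U p - \<gamma> * primitive_x T V p\<bar> * b (snd p) \<le> \<gamma> * (indicator (rect T) p * w (snd p)) * b (snd p)"
      by (intro mult_right_mono src b)
    then show "\<bar>U p - V p\<bar> * deriv b (snd p) + \<bar>\<gamma> * primitive_x T U p - \<gamma> * primitive_x T V p\<bar> * b (snd p)
      \<le> \<bar>U p - V p\<bar> * deriv b (snd p) + indicator (rect T) p * (\<gamma> * (w (snd p) * b (snd p)))" by (simp add: mult_ac)
  qed (use i1 i2 i3 in auto)
  also have "\<dots> = (\<integral>p. \<bar>U p - V p\<bar> * deriv b (snd p) \<partial>lborel) + (\<integral>p. indicator (rect T) p * (\<gamma> * (w (snd p) * b (snd p))) \<partial>lborel)"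
    by (rule Bochner_Integration.integral_add[OF i1 i2])
  also have "(\<integral>p. \<bar>U p - V p\<bar> * deriv b (snd p) \<partial>lborel) = (\<integral>t. w t * deriv b t \<partial>lborel)"
    using integral_plane(1)[OF i1] by (simp add: w_def)
  also have "(\<integral>p. indicator (rect T) p * (\<gamma> * (w (snd p) * b (snd p))) \<partial>lborel) = (\<integral>t. \<gamma> * (w t * b t) \<partial>lborel)"
  proof -
    have "(\<integral>p. indicator (rect T) p * (\<gamma> * (w (snd p) * b (snd p))) \<partial>lborel) =
        (\<integral>t. (\<integral>x. indicator (rect T) (x, t) \<partial>lborel) * (\<gamma> * (w t * b t)) \<partial>lborel)"
      using integral_plane(1)[OF i2] by simp
    also have "\<dots> = (\<integral>t. \<gamma> * (w t * b t) \<partial>lborel)"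
    proof (rule Bochner_Integration.integral_cong)
      fix t
      have "(\<lambda>x. indicator (rect T) (x, t)) = (\<lambda>x. indicator {0<..<1} x * indicator {0<..<T} t :: real)"
        by (auto simp: rect_def indicator_def)
      then have "(\<integral>x. indicator (rect T) (x, t) \<partial>lborel) = (indicator {0<..<T} t :: real)" by simp
      then show "(\<integral>x. indicator (rect T) (x, t) \<partial>lborel) * (\<gamma> * (w t * b t)) = \<gamma> * (w t * b t)"
        using bump_zero[OF b(1), of t] by (cases "t \<in> {0<..<T}") auto
    qed simp
    finally show ?thesis .
  qed
  also have "(\<integral>t. w t * deriv b t \<partial>lborel) + (\<integral>t. \<gamma> * (w t * b t) \<partial>lborel) = (\<integral>t. w t * deriv b t + \<gamma> * (w t * b t) \<partial>lborel)"
    using wint[OF b'] wint[OF b(1)] by simp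
  finally show "0 \<le> (\<integral>t. w t * (deriv b t + \<gamma> * b t) \<partial>lborel)" by (simp add: algebra_simps)
qed

text \<open>
  The test functions \<open>b(t) = exp(-\<gamma> t) c(t)\<close> absorb the zeroth order term:
  \<open>b' + \<gamma> b = exp(-\<gamma> t) c'\<close>. With a plateau \<open>c\<close> between \<open>t1\<close> and \<open>t2\<close> the inequality says that
  \<open>exp(-\<gamma> t) \<omega>(t)\<close> does not increase from \<open>t1\<close> to \<open>t2\<close>; continuity extends this to the end points.
\<close>

lemma weak_gronwall:
  assumes g: "\<And>b. bump 0 T b \<Longrightarrow> (\<And>t. 0 \<le> b t) \<Longrightarrow> 0 \<le> (\<integral>t. w t * (deriv b t + \<gamma> * b t) \<partial>lborel)"
    and w[measurable]: "w \<in> borel_measurable borel" "\<And>t. \<bar>w t\<bar> \<le> C"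
    and \<omega>: "continuous_on {0..T} \<omega>" and ae: "AE t in lborel. t \<in> {0<..<T} \<longrightarrow> w t = \<omega> t" and T: "0 < T"
    and t: "t \<in> {0..T}"
  shows "\<omega> t \<le> exp (\<gamma> * t) * \<omega> 0"
proof -
  define k where "k t = exp (- \<gamma> * t) * \<omega> t" for t
  have kc: "continuous_on {0..T} k" unfolding k_def by (intro continuous_intros \<omega>)
  have mono: "k t2 \<le> k t1" if t12: "0 < t1" "t1 < t2" "t2 < T" for t1 t2
  proof (rule field_le_epsilon)
    fix e2 :: real assume "0 < e2"
    define e where "e = e2 / 2"
    have e: "0 < e" "e + e = e2" using \<open>0 < e2\<close> by (auto simp: e_def)
    have "t1 \<in> {0..T}" "t2 \<in> {0..T}" using t12 by auto
    then obtain \<delta>1 \<delta>2 where \<delta>: "0 < \<delta>1" "0 < \<delta>2"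
      "\<And>t. t \<in> {0..T} \<Longrightarrow> dist t t1 < \<delta>1 \<Longrightarrow> dist (k t) (k t1) < e"
      "\<And>t. t \<in> {0..T} \<Longrightarrow> dist t t2 < \<delta>2 \<Longrightarrow> dist (k t) (k t2) < e"
      using kc e(1) unfolding continuous_on_iff by metis
    define h where "h = Min {\<delta>1, \<delta>2, t1 / 2, (t2 - t1) / 2, (T - t2) / 2}"
    have h0: "0 < h" using \<delta> t12 by (simp add: h_def)
    have hl: "h \<le> \<delta>1" "h \<le> \<delta>2" "h \<le> t1 / 2" "h \<le> (t2 - t1) / 2" "h \<le> (T - t2) / 2"
      unfolding h_def by (rule Min_le; simp)+
    obtain d where d: "mollifier h d" using mollifier_exists[OF h0] by blast
    have dn: "0 \<le> d y" and dz: "h \<le> \<bar>y\<bar> \<Longrightarrow> d y = 0" for y using d by (auto simp: mollifier_def)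
    have "t1 + 2 * h \<le> t2" using hl by simp
    from plateau[OF d this] obtain c where c: "smooth c" "\<And>x. (c has_real_derivative d (x - t1) - d (x - t2)) (at x)"
      "\<And>x. 0 \<le> c x" "\<And>x. x \<notin> {t1 - h..t2 + h} \<Longrightarrow> c x = 0" by metis
    define b where "b t = exp (- \<gamma> * t) * c t" for t
    have bb: "bump 0 T b"
      unfolding bump_def b_def[abs_def] using c(4) hl t12
      by (intro conjI smooth_mult smooth_exp c(1) exI[of _ "t1 - h"] exI[of _ "t2 + h"]) (auto simp: field_simps)
    have b': "deriv b t = exp (- \<gamma> * t) * (d (t - t1) - d (t - t2)) - \<gamma> * b t" for t
      unfolding b_def by (rule DERIV_imp_deriv) (auto intro!: derivative_eq_intros c(2) simp: algebra_simps)
    have "0 \<le> (\<integral>t. w t * (deriv b t + \<gamma> * b t) \<partial>lborel)"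
      by (rule g[OF bb]) (simp add: b_def c(3))
    also have "\<dots> \<le> (\<integral>t. d (t - t1) * (k t1 + e) - d (t - t2) * (k t2 - e) \<partial>lborel)"
    proof (rule integral_mono_AE)
      have e1: "bump 0 T (\<lambda>t. deriv b t + \<gamma> * b t)"
      proof -
        have "deriv b x + \<gamma> * b x = 0" if "x \<notin> {t1 - h..t2 + h}" for x
          using that dz[of "x - t1"] dz[of "x - t2"] c(4)[OF that] t12
          by (auto simp: b' b_def abs_if split: if_splits)
        moreover have "smooth (\<lambda>t. deriv b t + \<gamma> * b t)"
          using bb by (intro smooth_add smooth_mult smooth_const smooth_DERIV(2)) (auto simp: bump_def)
        ultimately show ?thesis unfolding bump_def using hl t12
          by (intro conjI exI[of _ "t1 - h"] exI[of _ "t2 + h"]) (auto simp: field_simps)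
      qed
      obtain C' where C': "0 < C'" "\<And>x. \<bar>deriv b x + \<gamma> * b x\<bar> \<le> C'" using bump_bounded[OF e1] by metis
      show "integrable lborel (\<lambda>t. w t * (deriv b t + \<gamma> * b t))"
      proof (rule integrable_bounded_support[where C="C * C'" and S="{0<..<T}"])
        show "\<bar>w t * (deriv b t + \<gamma> * b t)\<bar> \<le> C * C'" for t
          unfolding abs_mult using w(2)[of t] C'(2)[of t] by (intro mult_mono) auto
      qed (use bump_measurable[OF e1] bump_zero[OF e1] in auto)
      show "integrable lborel (\<lambda>t. d (t - t1) * (k t1 + e) - d (t - t2) * (k t2 - e))"
        using mollifier_shift(1)[OF d] by simp
      show "AE t in lborel. w t * (deriv b t + \<gamma> * b t) \<le> d (t - t1) * (k t1 + e) - d (t - t2) * (k t2 - e)"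
        using ae
      proof eventually_elim
        case (elim t)
        have "d (t - t1) * (exp (- \<gamma> * t) * w t) \<le> d (t - t1) * (k t1 + e)"
        proof (cases "\<bar>t - t1\<bar> < h")
          case True
          then have tt: "t \<in> {0<..<T}" "dist t t1 < \<delta>1" using hl t12 by (auto simp: dist_real_def abs_less_iff field_simps)
          then have "dist (k t) (k t1) < e" using \<delta>(3) by auto
          then have "exp (- \<gamma> * t) * w t \<le> k t1 + e" using elim tt by (auto simp: k_def dist_real_def abs_less_iff)
          then show ?thesis using dn by (rule mult_left_mono)
        qed (use dz in auto)
        moreover have "d (t - t2) * (k t2 - e) \<le> d (t - t2) * (exp (- \<gamma> * t) * w t)"
        proof (cases "\<bar>t - t2\<bar> < h")
          case True
          then have tt: "t \<in> {0<..<T}" "dist t t2 < \<delta>2" using hl t12 by (auto simp: dist_real_def abs_less_iff field_simps)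
          then have "dist (k t) (k t2) < e" using \<delta>(4) by auto
          then have "k t2 - e \<le> exp (- \<gamma> * t) * w t" using elim tt by (auto simp: k_def dist_real_def abs_less_iff)
          then show ?thesis using dn by (rule mult_left_mono)
        qed (use dz in auto)
        ultimately show ?case by (simp add: b' algebra_simps)
      qed
    qed
    also have "\<dots> = (k t1 + e) - (k t2 - e)" using mollifier_shift[OF d] by simp
    finally show "k t2 \<le> k t1 + e2" using e by linarith
  qed
  have lim0: "(k \<longlongrightarrow> k 0) (at_right 0)" and limT: "(k \<longlongrightarrow> k T) (at_left T)"
    using kc T by (auto simp: continuous_on_def at_within_Icc_at_right at_within_Icc_at_left dest: bspec[of _ _ 0] bspec[of _ _ T])
  have interior: "k s \<le> k 0" if "0 < s" "s < T" for s
  proof (rule tendsto_lowerbound[OF lim0])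
    show "eventually (\<lambda>r. k s \<le> k r) (at_right 0)"
      using eventually_at_right_real[OF that(1)] by eventually_elim (use mono that in auto)
  qed simp
  have "k t \<le> k 0"
  proof -
    consider "t = 0" | "t = T" | "0 < t" "t < T" using t by fastforce
    then show ?thesis
    proof cases
      case 2
      have "k T \<le> k 0"
      proof (rule tendsto_upperbound[OF limT])
        show "eventually (\<lambda>r. k r \<le> k 0) (at_left T)"
          using eventually_at_left_real[OF T] by eventually_elim (use interior in auto)
      qed simp
      then show ?thesis using 2 by simp
    qed (use interior in auto)
  qed
  then have "exp (\<gamma> * t) * (exp (- \<gamma> * t) * \<omega> t) \<le> exp (\<gamma> * t) * \<omega> 0"
    unfolding k_def by (intro mult_left_mono) auto
  then show ?thesis by (simp add: mult.assoc[symmetric] exp_add[symmetric])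
qed

section \<open>The initial datum and the conclusion\<close>

text \<open>
  Testing with \<open>q \<mapsto> d(p - q)\<close> shows that the mollification of \<open>g\<close> vanishes at every \<open>p\<close> away from the ends.
  The \<open>L\<^sup>1\<close> norm of \<open>g\<close> there is therefore at most the mollification error, which is arbitrarily small.
\<close>

lemma zero_of_vanishing_tests:
  fixes g :: "real \<Rightarrow> real"
  assumes g: "integrable lborel g"
    and test: "\<And>A. bump 0 1 A \<Longrightarrow> (\<And>x. 0 \<le> A x) \<Longrightarrow> (\<integral>x. g x * A x \<partial>lborel) = 0"
  shows "AE x in lborel. x \<in> {0<..<1} \<longrightarrow> g x = 0"
proof -
  have [measurable]: "g \<in> borel_measurable borel" using g by (auto dest: borel_measurable_integrable)
  have small: "(\<integral>\<^sup>+y. indicator {\<eta>..1 - \<eta>} y * ennreal \<bar>g y\<bar> \<partial>lborel) \<le> ennreal e"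
    if \<eta>: "0 < \<eta>" and e: "0 < e" for \<eta> e :: real
  proof -
    obtain r where r: "0 < r" "\<And>h. norm h < r \<Longrightarrow> (\<integral>\<^sup>+x. ennreal \<bar>g (x + h) - g x\<bar> \<partial>lborel) \<le> ennreal e"
      using translation_continuousD[OF integrable_translation_continuous[OF g] e] by blast
    define h where "h = min r (\<eta> / 2)"
    have h: "0 < h" "h \<le> r" "h < \<eta>" using r(1) \<eta> by (auto simp: h_def min_def)
    obtain d where d: "mollifier h d" using mollifier_exists[OF h(1)] by blast
    have sd: "smooth d" and dn: "\<And>y. 0 \<le> d y" and dz: "\<And>y. h \<le> \<bar>y\<bar> \<Longrightarrow> d y = 0"
      and di: "(\<integral>x. d x \<partial>lborel) = 1" using d by (auto simp: mollifier_def)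
    note bd = mollifier_bump[OF d]
    have [measurable]: "d \<in> borel_measurable borel" by (rule bump_measurable[OF bd])
    have idp: "integrable lborel (\<lambda>q. d (p - q))" "(\<integral>q. d (p - q) \<partial>lborel) = 1" for p
      using lborel_integrable_real_affine[OF mollifier_integrable[OF d], of "-1" p]
        lborel_integral_real_affine[of "-1" d p] di by simp_all
    have "(\<integral>\<^sup>+y. indicator {\<eta>..1 - \<eta>} y * ennreal \<bar>g y\<bar> \<partial>lborel)
        \<le> (\<integral>\<^sup>+p. \<integral>\<^sup>+q. ennreal (\<bar>g q - g p\<bar> * d (p - q)) \<partial>lborel \<partial>lborel)"
    proof (rule nn_integral_mono)
      fix p
      show "indicator {\<eta>..1 - \<eta>} p * ennreal \<bar>g p\<bar> \<le> (\<integral>\<^sup>+q. ennreal (\<bar>g q - g p\<bar> * d (p - q)) \<partial>lborel)"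
      proof (cases "p \<in> {\<eta>..1 - \<eta>}")
        case True
        have bp: "bump 0 1 (\<lambda>q. d (p - q))"
        proof -
          have "smooth (\<lambda>q. d (p - q))" using smooth_affine[OF sd, of "-1" p] by simp
          moreover have "d (p - q) = 0" if "q \<notin> {p - h..p + h}" for q
            by (rule dz) (use that in \<open>auto simp: abs_if\<close>)
          ultimately show ?thesis unfolding bump_def using True h
            by (intro conjI exI[of _ "p - h"] exI[of _ "p + h"]) auto
        qed
        have ig: "integrable lborel (\<lambda>q. g q * d (p - q))" by (rule integrable_mult_bump[OF g bp])
        have "(\<integral>q. g q * d (p - q) \<partial>lborel) = 0" by (rule test[OF bp dn])
        moreover have "(\<integral>q. g p * d (p - q) - g q * d (p - q) \<partial>lborel) = g p * 1 - (\<integral>q. g q * d (p - q) \<partial>lborel)"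
          using idp ig by simp
        ultimately have "g p = (\<integral>q. g p * d (p - q) - g q * d (p - q) \<partial>lborel)" by simp
        then have "ennreal \<bar>g p\<bar> = ennreal (norm (\<integral>q. g p * d (p - q) - g q * d (p - q) \<partial>lborel))" by simp
        also have "\<dots> \<le> (\<integral>\<^sup>+q. ennreal (norm (g p * d (p - q) - g q * d (p - q))) \<partial>lborel)"
          by (rule integral_norm_bound_ennreal) (use idp ig in simp)
        also have "\<dots> = (\<integral>\<^sup>+q. ennreal (\<bar>g q - g p\<bar> * d (p - q)) \<partial>lborel)"
          using dn by (intro nn_integral_cong) (simp add: left_diff_distrib[symmetric] abs_mult abs_minus_commute)
        finally show ?thesis using True by simp
      qed simp
    qed
    also have "\<dots> \<le> ennreal e * (\<integral>\<^sup>+z. ennreal (d z) \<partial>lborel)"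
      by (rule mollification_error[of g d r]) (use dn dz h r in auto)
    also have "(\<integral>\<^sup>+z. ennreal (d z) \<partial>lborel) = 1"
      using nn_integral_eq_integral[OF mollifier_integrable[OF d]] dn di by simp
    finally show ?thesis by simp
  qed
  have "AE y in lborel. y \<in> {\<eta>..1 - \<eta>} \<longrightarrow> g y = 0" if "0 < \<eta>" for \<eta>
  proof -
    have "(\<integral>\<^sup>+y. indicator {\<eta>..1 - \<eta>} y * ennreal \<bar>g y\<bar> \<partial>lborel) \<le> 0"
      by (rule ennreal_le_epsilon) (use small[OF that] in auto)
    then have "(\<integral>\<^sup>+y. indicator {\<eta>..1 - \<eta>} y * ennreal \<bar>g y\<bar> \<partial>lborel) = 0" by simp
    then have "AE y in lborel. indicator {\<eta>..1 - \<eta>} y * ennreal \<bar>g y\<bar> = 0"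
      by (subst (asm) nn_integral_0_iff_AE) auto
    then show ?thesis by eventually_elim (auto simp: indicator_def split: if_splits)
  qed
  then have "AE y in lborel. \<forall>n. y \<in> {1 / real (Suc n)..1 - 1 / real (Suc n)} \<longrightarrow> g y = 0"
    by (subst AE_all_countable) auto
  then show ?thesis
  proof eventually_elim
    case (elim y)
    show ?case
    proof
      assume y: "y \<in> {0<..<1}"
      then obtain n where "1 / real (Suc n) < min y (1 - y)"
        using nat_approx_posE[of "min y (1 - y)"] by auto
      then show "g y = 0" using elim[rule_format, of n] by auto
    qed
  qed
qed

lemma entropy_solution_plane:
  assumes u: "entropy_solution T \<gamma> f \<alpha> \<beta> u0 u" and U: "representative T M u U"
    and gq: "entropy_pair f g q" and A: "bump 0 1 A" and B: "bump a b B"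
    and nn: "\<And>x. 0 \<le> A x" "\<And>t. 0 \<le> B t"
  shows "0 \<le> (\<integral>p. indicator (rect T) p * (weak_form A B (g (U p)) (q (U p)) (\<gamma> * deriv g (U p) * primitive_x T U p) p) \<partial>lborel)
      + (LINT x:{0<..<1}|lborel. g (u0 x) * (A x * B 0)) - (LINT x:{0<..<1}|lborel. g (u x T) * (A x * B T))"
proof -
  have g: "C_k 2 g" and q: "\<And>x. (q has_real_derivative deriv g x * deriv f x) (at x)"
    using gq by (auto simp: entropy_pair_def)
  have "in_Linf T u" and "entropy_inequality T \<gamma> u0 u g q (\<lambda>x t. A x * B t)"
    using u gq test_function_product[OF A B] nn by (auto simp: entropy_solution_def)
  then show ?thesis
    using entropy_integral_plane(1)[OF _ U C_k_2D(3)[OF g] continuous_on_real_derivative[OF q] C_k_2D(4)[OF g] A B, of \<gamma>]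
    by (simp add: entropy_inequality_def)
qed

lemma entropy_solution_kruzkov:
  assumes u: "entropy_solution T \<gamma> f \<alpha> \<beta> u0 u" and U: "representative T M u U" and f: "C_k 2 f"
  shows "kruzkov_solution T f U (\<lambda>p. \<gamma> * primitive_x T U p)"
proof (rule kruzkov_solution_of_entropy[OF f])
  show bU: "bounded_on_rect T M U" using U by (simp add: representative_def)
  show "bounded_on_rect T (\<bar>\<gamma>\<bar> * M) (\<lambda>p. \<gamma> * primitive_x T U p)"
    using primitive_x_bounded[OF bU] by (auto simp: bounded_on_rect_def abs_mult intro!: mult_left_mono)
  fix g q A B
  assume *: "entropy_pair f g q" "bump 0 1 A" "bump 0 T B" "\<And>x. 0 \<le> A x" "\<And>t. 0 \<le> B t"
  have "B 0 = 0" "B T = 0" using bump_zero[OF *(3)] by auto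
  with entropy_solution_plane[OF u U *]
  show "0 \<le> (\<integral>p. indicator (rect T) p * (weak_form A B (g (U p)) (q (U p)) (deriv g (U p) * (\<gamma> * primitive_x T U p)) p) \<partial>lborel)"
    by (simp add: mult_ac)
qed

lemma L1_distance_integrable:
  fixes a b :: "'a::euclidean_space \<Rightarrow> real"
  assumes "set_integrable lborel S a" "set_integrable lborel S b"
  shows "set_integrable lborel S (\<lambda>x. \<bar>a x - b x\<bar>)"
  using set_integrable_abs[OF set_integral_diff(1)[OF assms]] .

lemma L1_norm_representative:
  assumes u: "in_C_L1 T u" and v: "in_C_L1 T v"
    and U: "representative T M u U" and V: "representative T M v V"
  shows "AE t in lborel. t \<in> {0<..<T} \<longrightarrow>
    (\<integral>x. \<bar>U (x, t) - V (x, t)\<bar> \<partial>lborel) = L1_norm {0<..<1} (\<lambda>x. u x t - v x t)"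
proof -
  have bU: "bounded_on_rect T M U" and aU: "AE p in lborel. p \<in> rect T \<longrightarrow> U p = u (fst p) (snd p)"
    and bV: "bounded_on_rect T M V" and aV: "AE p in lborel. p \<in> rect T \<longrightarrow> V p = v (fst p) (snd p)"
    using U V by (auto simp: representative_def)
  show ?thesis
    using AE_slices(2)[OF aU] AE_slices(2)[OF aV]
  proof eventually_elim
    case (elim t)
    show ?case
    proof
      assume t: "t \<in> {0<..<T}"
      have "set_integrable lborel {0<..<1} (\<lambda>x. u x t)" "set_integrable lborel {0<..<1} (\<lambda>x. v x t)"
        using u v t by (auto simp: in_C_L1_def)
      note i = L1_distance_integrable[OF this]
      have "(\<integral>x. \<bar>U (x, t) - V (x, t)\<bar> \<partial>lborel) = (\<integral>x. indicator {0<..<1} x *\<^sub>R \<bar>u x t - v x t\<bar> \<partial>lborel)"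
      proof (rule integral_cong_AE)
        show "(\<lambda>x. indicator {0<..<1} x *\<^sub>R \<bar>u x t - v x t\<bar>) \<in> borel_measurable lborel"
          using i unfolding set_integrable_def by (rule borel_measurable_integrable)
        show "(\<lambda>x. \<bar>U (x, t) - V (x, t)\<bar>) \<in> borel_measurable lborel"
          using slice_integrable[OF bU, of t] slice_integrable[OF bV, of t] by (auto dest: borel_measurable_integrable)
        show "AE x in lborel. \<bar>U (x, t) - V (x, t)\<bar> = indicator {0<..<1} x *\<^sub>R \<bar>u x t - v x t\<bar>"
          using elim
        proof eventually_elim
          case (elim x)
          moreover have "(x, t) \<notin> rect T \<Longrightarrow> U (x, t) = 0" "(x, t) \<notin> rect T \<Longrightarrow> V (x, t) = 0"
            using bU bV unfolding bounded_on_rect_def by blast+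
          ultimately show ?case using t by (cases "x \<in> {0<..<1}") (auto simp: rect_def)
        qed
      qed
      then show "(\<integral>x. \<bar>U (x, t) - V (x, t)\<bar> \<partial>lborel) = L1_norm {0<..<1} (\<lambda>x. u x t - v x t)"
        by (simp add: L1_norm_def set_lebesgue_integral_def)
    qed
  qed
qed

lemma L1_distance_continuous:
  assumes u: "in_C_L1 T u" and v: "in_C_L1 T v"
  shows "continuous_on {0..T} (\<lambda>t. L1_norm {0<..<1} (\<lambda>x. u x t - v x t))"
proof -
  have iu: "set_integrable lborel {0<..<1} (\<lambda>x. u x t)" "set_integrable lborel {0<..<1} (\<lambda>x. v x t)" if "t \<in> {0..T}" for t
    using u v that by (auto simp: in_C_L1_def)
  define D where "D a b = L1_norm {0<..<1} (\<lambda>x. a x - b x)" for a b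
  have tri: "D a b \<le> D a c + D c b" if abc: "set_integrable lborel {0<..<1} a" "set_integrable lborel {0<..<1} b"
    "set_integrable lborel {0<..<1} c" for a b c
  proof -
    have "D a b \<le> (LINT x:{0<..<1}|lborel. \<bar>a x - c x\<bar> + \<bar>c x - b x\<bar>)"
      unfolding D_def L1_norm_def
      by (rule set_integral_mono[OF L1_distance_integrable[OF abc(1,2)]
            set_integral_add(1)[OF L1_distance_integrable[OF abc(1,3)] L1_distance_integrable[OF abc(3,2)]]]) simp
    also have "\<dots> = D a c + D c b" unfolding D_def L1_norm_def
      by (rule set_integral_add(2)[OF L1_distance_integrable[OF abc(1,3)] L1_distance_integrable[OF abc(3,2)]])
    finally show ?thesis .
  qed
  have sym: "D a b = D b a" for a b unfolding D_def L1_norm_def by (simp add: abs_minus_commute)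
  show ?thesis
    unfolding continuous_on_def
  proof (intro ballI)
    fix s assume s: "s \<in> {0..T}"
    have "((\<lambda>t. D (\<lambda>x. u x t) (\<lambda>x. u x s) + D (\<lambda>x. v x t) (\<lambda>x. v x s)) \<longlongrightarrow> 0 + 0) (at s within {0..T})"
      unfolding D_def using u v s by (intro tendsto_add) (auto simp: in_C_L1_def)
    then have lim: "((\<lambda>t. D (\<lambda>x. u x t) (\<lambda>x. u x s) + D (\<lambda>x. v x t) (\<lambda>x. v x s)) \<longlongrightarrow> 0) (at s within {0..T})" by simp
    have "((\<lambda>t. D (\<lambda>x. u x t) (\<lambda>x. v x t) - D (\<lambda>x. u x s) (\<lambda>x. v x s)) \<longlongrightarrow> 0) (at s within {0..T})"
    proof (rule Lim_null_comparison[OF _ lim])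
      show "eventually (\<lambda>t. norm (D (\<lambda>x. u x t) (\<lambda>x. v x t) - D (\<lambda>x. u x s) (\<lambda>x. v x s))
          \<le> D (\<lambda>x. u x t) (\<lambda>x. u x s) + D (\<lambda>x. v x t) (\<lambda>x. v x s)) (at s within {0..T})"
        unfolding eventually_at_filter
      proof (intro always_eventually allI impI)
        fix t assume "t \<in> {0..T}"
        note i = iu[OF this] iu[OF s]
        show "norm (D (\<lambda>x. u x t) (\<lambda>x. v x t) - D (\<lambda>x. u x s) (\<lambda>x. v x s))
          \<le> D (\<lambda>x. u x t) (\<lambda>x. u x s) + D (\<lambda>x. v x t) (\<lambda>x. v x s)"
          using tri[OF i(1,2,3)] tri[OF i(3,2,4)] tri[OF i(3,4,1)] tri[OF i(1,4,2)]
            sym[of "\<lambda>x. u x s" "\<lambda>x. u x t"] sym[of "\<lambda>x. v x s" "\<lambda>x. v x t"]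
          by (simp add: abs_le_iff)
      qed
    qed
    then show "((\<lambda>t. L1_norm {0<..<1} (\<lambda>x. u x t - v x t)) \<longlongrightarrow> L1_norm {0<..<1} (\<lambda>x. u x s - v x s)) (at s within {0..T})"
      unfolding D_def by (rule LIM_zero_cancel)
  qed
qed

lemma emeasure_rect: "0 \<le> s \<Longrightarrow> emeasure lborel (rect s) = ennreal s"
  by (simp add: rect_def lborel_prod[symmetric] lborel.emeasure_pair_measure_Times)

text \<open>
  With the linear entropy \<open>s w\<close> and a factor \<open>B\<close> that falls from \<open>1\<close> to \<open>0\<close> on \<open>[0, 4h]\<close>, the flux and source terms
  are of order \<open>h\<close>, and the term with \<open>B'\<close> averages \<open>\<integral> u(x,t) A(x) dx\<close> over small times. By continuity
  of \<open>u\<close> in time it tends to the integral at time \<open>0\<close>. The two signs \<open>s\<close> together give equality.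
\<close>

lemma initial_datum_tested:
  assumes u: "entropy_solution T \<gamma> f \<alpha> \<beta> u0 u" and f: "C_k 2 f" and T: "0 < T"
    and A: "bump 0 1 A" "\<And>x. 0 \<le> A x" and s: "s = 1 \<or> s = -1"
  shows "0 \<le> s * ((LINT x:{0<..<1}|lborel. u0 x * A x) - (LINT x:{0<..<1}|lborel. u x 0 * A x))"
proof (rule field_le_epsilon)
  fix e2 :: real assume "0 < e2"
  define e where "e = e2 / 2"
  have e: "0 < e" "e + e = e2" using \<open>0 < e2\<close> by (auto simp: e_def)
  have uC: "in_C_L1 T u" and uL: "in_Linf T u" using u by (auto simp: entropy_solution_def)
  obtain M U where U: "representative T M u U" using representative_exists[OF uL] by blast
  have bU: "bounded_on_rect T M U" and aU: "AE p in lborel. p \<in> rect T \<longrightarrow> U p = u (fst p) (snd p)"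
    using U by (auto simp: representative_def)
  have [measurable]: "U \<in> borel_measurable borel" and UM: "\<And>p. \<bar>U p\<bar> \<le> M"
    and Uz: "\<And>p. p \<notin> rect T \<Longrightarrow> U p = 0"
    using bU unfolding bounded_on_rect_def by blast+
  have WM: "\<And>p. \<bar>primitive_x T U p\<bar> \<le> M"
    using primitive_x_bounded[OF bU] unfolding bounded_on_rect_def by blast
  have A': "bump 0 1 (deriv A)" using A(1) by (rule bump_deriv)
  obtain CA where CA: "0 < CA" "\<And>x. \<bar>A x\<bar> \<le> CA" using bump_bounded[OF A(1)] by metis
  obtain CA' where CA': "0 < CA'" "\<And>x. \<bar>deriv A x\<bar> \<le> CA'" using bump_bounded[OF A'] by metis
  obtain q where gq: "entropy_pair f (\<lambda>w. s * w) q" and dg: "deriv (\<lambda>w. s * w) = (\<lambda>w. s)"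
    and qc: "continuous_on UNIV q"
    using entropy_pair_exists[OF f, of "\<lambda>w. s * w" "\<lambda>w. s" "\<lambda>w. 0" 0]
    by (auto intro!: derivative_eq_intros)
  obtain Q where "\<And>w. \<bar>w\<bar> \<le> M \<Longrightarrow> \<bar>q w\<bar> \<le> Q" using continuous_bounded[OF qc] by metis
  then have qQ: "\<bar>q (U p)\<bar> \<le> Q" for p using UM by blast
  define I1 where "I1 = (LINT x:{0<..<1}|lborel. u x 0 * A x)"
  define K where "K = \<bar>Q * (CA' * 1) + \<bar>\<gamma>\<bar> * 1 * M * (CA * 1)\<bar> + 1"
  have K: "0 < K" by (simp add: K_def)
  define m where "m t = (\<integral>x. U (x, t) * A x \<partial>lborel)" for t
  note [measurable] = bump_measurable[OF A(1)]
  have "((\<lambda>t. L1_norm {0<..<1} (\<lambda>x. u x t - u x 0)) \<longlongrightarrow> 0) (at 0 within {0..T})"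
    using uC T by (auto simp: in_C_L1_def)
  then have "eventually (\<lambda>t. L1_norm {0<..<1} (\<lambda>x. u x t - u x 0) < e / CA) (at 0 within {0..T})"
    by (rule order_tendstoD(2)) (use e CA in auto)
  then obtain \<delta> where \<delta>: "0 < \<delta>" "\<And>t. t \<in> {0..T} \<Longrightarrow> t \<noteq> 0 \<Longrightarrow> dist t 0 < \<delta> \<Longrightarrow> L1_norm {0<..<1} (\<lambda>x. u x t - u x 0) < e / CA"
    by (auto simp: eventually_at)
  have m: "AE t in lborel. t \<in> {0<..<T} \<and> t < \<delta> \<longrightarrow> \<bar>m t - I1\<bar> \<le> e"
    using AE_slices(2)[OF aU]
  proof eventually_elim
    case (elim t)
    show ?case
    proof
      assume t: "t \<in> {0<..<T} \<and> t < \<delta>"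
      have su: "set_integrable lborel {0<..<1} (\<lambda>x. u x t)" "set_integrable lborel {0<..<1} (\<lambda>x. u x 0)"
        using uC t T by (auto simp: in_C_L1_def)
      have iA: "integrable lborel (\<lambda>x. indicator {0<..<1} x *\<^sub>R (a x * A x))"
        if "set_integrable lborel {0<..<1} a" for a
        using integrable_mult_bump[OF that[unfolded set_integrable_def] A(1)] by (simp add: mult.assoc)
      have "m t = (\<integral>x. indicator {0<..<1} x *\<^sub>R (u x t * A x) \<partial>lborel)"
        unfolding m_def
      proof (rule integral_cong_AE)
        show "(\<lambda>x. U (x, t) * A x) \<in> borel_measurable lborel"
          using borel_measurable_slice_fst[of U t] by simp
        show "(\<lambda>x. indicator {0<..<1} x *\<^sub>R (u x t * A x)) \<in> borel_measurable lborel"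
          using iA[OF su(1)] by (rule borel_measurable_integrable)
        show "AE x in lborel. U (x, t) * A x = indicator {0<..<1} x *\<^sub>R (u x t * A x)"
          using elim
        proof eventually_elim
          case (elim x)
          then show ?case using Uz[of "(x, t)"] t by (cases "x \<in> {0<..<1}") (auto simp: rect_def)
        qed
      qed
      then have "m t - I1 = (\<integral>x. indicator {0<..<1} x *\<^sub>R (u x t * A x) - indicator {0<..<1} x *\<^sub>R (u x 0 * A x) \<partial>lborel)"
        using iA[OF su(1)] iA[OF su(2)] by (simp add: I1_def set_lebesgue_integral_def)
      then have "\<bar>m t - I1\<bar> = norm (\<integral>x. indicator {0<..<1} x *\<^sub>R (u x t * A x) - indicator {0<..<1} x *\<^sub>R (u x 0 * A x) \<partial>lborel)"
        by simp
      also have "\<dots> \<le> (\<integral>x. norm (indicator {0<..<1} x *\<^sub>R (u x t * A x) - indicator {0<..<1} x *\<^sub>R (u x 0 * A x)) \<partial>lborel)"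
        by (rule integral_norm_bound)
      also have "\<dots> \<le> (\<integral>x. CA * (indicator {0<..<1} x *\<^sub>R \<bar>u x t - u x 0\<bar>) \<partial>lborel)"
      proof (rule integral_mono)
        show "integrable lborel (\<lambda>x. norm (indicator {0<..<1} x *\<^sub>R (u x t * A x) - indicator {0<..<1} x *\<^sub>R (u x 0 * A x)))"
          using iA[OF su(1)] iA[OF su(2)] by (intro integrable_norm Bochner_Integration.integrable_diff)
        show "integrable lborel (\<lambda>x. CA * (indicator {0<..<1} x *\<^sub>R \<bar>u x t - u x 0\<bar>))"
          using L1_distance_integrable[OF su] unfolding set_integrable_def by (rule integrable_mult_right)
        show "norm (indicator {0<..<1} x *\<^sub>R (u x t * A x) - indicator {0<..<1} x *\<^sub>R (u x 0 * A x))
           \<le> CA * (indicator {0<..<1} x *\<^sub>R \<bar>u x t - u x 0\<bar>)" for x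
        proof -
          have "norm (indicator {0<..<1} x *\<^sub>R (u x t * A x) - indicator {0<..<1} x *\<^sub>R (u x 0 * A x))
              = \<bar>indicator {0<..<1} x * (u x t - u x 0)\<bar> * \<bar>A x\<bar>"
            by (simp add: abs_mult[symmetric] algebra_simps)
          also have "\<dots> \<le> \<bar>indicator {0<..<1} x * (u x t - u x 0)\<bar> * CA"
            by (rule mult_left_mono[OF CA(2)]) simp
          finally show ?thesis by (simp add: abs_mult mult_ac)
        qed
      qed
      also have "\<dots> = CA * L1_norm {0<..<1} (\<lambda>x. u x t - u x 0)"
        by (simp add: L1_norm_def set_lebesgue_integral_def)
      also have "\<dots> \<le> CA * (e / CA)"
        using \<delta>(2)[of t] t CA(1) by (intro mult_left_mono) (auto simp: dist_real_def)
      also have "\<dots> = e" using CA(1) by simp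
      finally show "\<bar>m t - I1\<bar> \<le> e" .
    qed
  qed
  \<comment> \<open>The factor \<open>B\<close> vanishes from \<open>3 h\<close> on; by then \<open>m\<close> is still close to its initial value, and
    the remaining terms contribute at most \<open>4 h K\<close>.\<close>
  define h where "h = Min {1 / 4, T / 4, \<delta> / 4, e / (4 * K)}"
  have h0: "0 < h" using T \<delta>(1) e K by (simp add: h_def)
  have hl: "h \<le> 1 / 4" "h \<le> T / 4" "h \<le> \<delta> / 4" "h \<le> e / (4 * K)"
    unfolding h_def by (rule Min_le; simp)+
  obtain d where d: "mollifier h d" using mollifier_exists[OF h0] by blast
  have dn: "0 \<le> d y" and dz: "h \<le> \<bar>y\<bar> \<Longrightarrow> d y = 0" for y using d by (auto simp: mollifier_def)
  \<comment> \<open>The rising slope of the plateau is put at \<open>t = -1\<close>, before the initial time.\<close>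
  have "- 1 + 2 * h \<le> 2 * h" by simp
  from plateau[OF d this] obtain B where B: "smooth B" "\<And>x. (B has_real_derivative d (x - - 1) - d (x - 2 * h)) (at x)"
      "\<And>x. 0 \<le> B x" "\<And>x. B x \<le> 1" "\<And>x. x \<notin> {- 1 - h..2 * h + h} \<Longrightarrow> B x = 0"
      "\<And>x. x \<in> {- 1 + h..2 * h - h} \<Longrightarrow> B x = 1" by metis
  have bB: "bump (- 3) (T + 3) B"
    unfolding bump_def using B(1,5) hl T by (intro conjI exI[of _ "- 1 - h"] exI[of _ "2 * h + h"]) auto
  have B0: "B 0 = 1" and BT: "B T = 0" using B(6)[of 0] B(5)[of T] h0 hl by auto
  have B': "deriv B t = - d (t - 2 * h)" if "0 < t" for t
    using DERIV_imp_deriv[OF B(2)[of t]] dz[of "t + 1"] hl that by simp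
  have Bz: "B t = 0" if "4 * h \<le> t" for t using B(5)[of t] that h0 by simp
  have bd: "bump (- (2 * h)) (2 * h) d" by (rule mollifier_bump[OF d])
  have d_shift: "smooth (\<lambda>t. d (t - 2 * h))"
    using smooth_affine[of d 1 "- (2 * h)"] bd by (simp add: bump_def)
  have [measurable]: "(\<lambda>t. d (t - 2 * h)) \<in> borel_measurable borel"
    using smooth_continuous[OF d_shift] by (rule borel_measurable_continuous_onI)
  note [measurable] = borel_measurable_comp_snd[of "\<lambda>t. d (t - 2 * h)"] borel_measurable_comp_fst[OF bump_measurable[OF A(1)]]
  obtain Cd where Cd: "0 < Cd" "\<And>x. \<bar>d x\<bar> \<le> Cd" using bump_bounded[OF bd] by metis
  define E where "E p = U p * (A (fst p) * - d (snd p - 2 * h))" for p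
  have iE: "integrable lborel E"
  proof (rule integrable_bounded_support[OF _ _ bounded_rect[of T]])
    show "\<bar>E p\<bar> \<le> M * (CA * Cd)" for p unfolding E_def by (intro abs_mult_le UM CA) (simp add: Cd)
    show "E p = 0" if "p \<notin> rect T" for p using Uz[OF that] by (simp add: E_def)
    show "E \<in> borel_measurable borel" unfolding E_def[abs_def] by measurable
  qed
  have u0s: "(LINT x:{0<..<1}|lborel. s * u0 x * (A x * B 0)) = s * (LINT x:{0<..<1}|lborel. u0 x * A x)"
    by (simp add: B0 mult.assoc)
  have "0 \<le> (\<integral>p. indicator (rect T) p * (weak_form A B (s * U p) (q (U p)) (\<gamma> * s * primitive_x T U p) p) \<partial>lborel)
      + s * (LINT x:{0<..<1}|lborel. u0 x * A x)" (is "0 \<le> (\<integral>p. ?F p \<partial>lborel) + _")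
    using entropy_solution_plane[OF u U gq A(1) bB A(2) B(3)] unfolding dg u0s BT by simp
  also have "(\<integral>p. ?F p \<partial>lborel) \<le> (\<integral>p. s * E p + K * indicator (rect (4 * h)) p \<partial>lborel)"
  proof (rule integral_mono)
    show "integrable lborel ?F"
      using entropy_integral_plane(2)[OF uL U, of "\<lambda>w. s * w" q "\<lambda>w. s" A "-3" "T + 3" B \<gamma>] qc A(1) bB
      by (simp add: continuous_intros)
    have "integrable lborel (indicator (rect (4 * h)) :: _ \<Rightarrow> real)"
      by (rule integrable_real_indicator) (use emeasure_rect[of "4 * h"] h0 in auto)
    then show "integrable lborel (\<lambda>p. s * E p + K * indicator (rect (4 * h)) p)" using iE by simp
    fix p
    show "?F p \<le> s * E p + K * indicator (rect (4 * h)) p"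
    proof (cases "p \<in> rect T")
      case False
      then show ?thesis using Uz[OF False] K by (simp add: E_def)
    next
      case True
      then have t0: "0 < snd p" and x0: "0 < fst p" "fst p < 1" by (auto simp: rect_def)
      have "q (U p) * (deriv A (fst p) * B (snd p)) + \<gamma> * s * primitive_x T U p * (A (fst p) * B (snd p))
          \<le> K * indicator (rect (4 * h)) p"
      proof (cases "snd p < 4 * h")
        case True
        have "\<bar>q (U p) * (deriv A (fst p) * B (snd p)) + \<gamma> * s * primitive_x T U p * (A (fst p) * B (snd p))\<bar>
          \<le> Q * (CA' * 1) + \<bar>\<gamma>\<bar> * 1 * M * (CA * 1)"
          by (intro order_trans[OF abs_triangle_ineq] add_mono abs_mult_le qQ CA CA' WM)
            (use s B(3,4)[of "snd p"] in auto)
        moreover have "p \<in> rect (4 * h)" using True t0 x0 by (cases p) (simp add: rect_def)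
        ultimately show ?thesis by (simp add: K_def)
      next
        case False
        then show ?thesis using Bz[of "snd p"] K by simp
      qed
      then show ?thesis using True by (simp add: E_def B'[OF t0] algebra_simps)
    qed
  qed
  also have "(\<integral>p. s * E p + K * indicator (rect (4 * h)) p \<partial>lborel) = s * (\<integral>p. E p \<partial>lborel) + K * (4 * h)"
  proof -
    have "measure lborel (rect (4 * h)) = 4 * h" using emeasure_rect[of "4 * h"] h0 by (simp add: measure_def)
    moreover have "integrable lborel (indicator (rect (4 * h)) :: _ \<Rightarrow> real)"
      by (rule integrable_real_indicator) (use emeasure_rect[of "4 * h"] h0 in auto)
    ultimately show ?thesis using iE by simp
  qed
  also have "s * (\<integral>p. E p \<partial>lborel) \<le> - (s * I1) + e"
  proof -
    have "(\<integral>p. E p \<partial>lborel) = (\<integral>t. - d (t - 2 * h) * m t \<partial>lborel)"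
      using integral_plane(1)[OF iE] unfolding E_def m_def by (simp add: mult_ac flip: integral_mult_right_zero)
    have im: "integrable lborel (\<lambda>t. - d (t - 2 * h) * m t)"
      using integral_plane(3)[OF iE] unfolding E_def m_def by (simp add: mult_ac flip: integral_mult_right_zero)
    have "(\<integral>t. s * (- d (t - 2 * h) * m t) \<partial>lborel) \<le> (\<integral>t. d (t - 2 * h) * (- (s * I1) + e) \<partial>lborel)"
    proof (rule integral_mono_AE)
      show "integrable lborel (\<lambda>t. s * (- d (t - 2 * h) * m t))" using im by (rule integrable_mult_right)
      show "integrable lborel (\<lambda>t. d (t - 2 * h) * (- (s * I1) + e))" using mollifier_shift(1)[OF d] by simp
      show "AE t in lborel. s * (- d (t - 2 * h) * m t) \<le> d (t - 2 * h) * (- (s * I1) + e)"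
        using m
      proof eventually_elim
        case (elim t)
        show ?case
        proof (cases "\<bar>t - 2 * h\<bar> < h")
          case True
          then have "t \<in> {0<..<T} \<and> t < \<delta>" using hl h0 by (auto simp: abs_less_iff)
          then have "\<bar>m t - I1\<bar> \<le> e" using elim by blast
          then have "- (s * m t) \<le> - (s * I1) + e" using s by (auto simp: abs_le_iff)
          then have "d (t - 2 * h) * - (s * m t) \<le> d (t - 2 * h) * (- (s * I1) + e)"
            using dn by (rule mult_left_mono)
          then show ?thesis by (simp add: mult_ac)
        qed (use dz in auto)
      qed
    qed
    also have "\<dots> = - (s * I1) + e" using mollifier_shift(2)[OF d] by simp
    finally show ?thesis using \<open>(\<integral>p. E p \<partial>lborel) = (\<integral>t. - d (t - 2 * h) * m t \<partial>lborel)\<close> by simp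
  qed
  finally have "0 \<le> - (s * I1) + e + K * (4 * h) + s * (LINT x:{0<..<1}|lborel. u0 x * A x)" by simp
  moreover have "K * (4 * h) \<le> e" using hl(4) K by (simp add: field_simps)
  ultimately show "0 \<le> s * ((LINT x:{0<..<1}|lborel. u0 x * A x) - (LINT x:{0<..<1}|lborel. u x 0 * A x)) + e2"
    using e by (simp add: I1_def algebra_simps)
qed

lemma initial_datum_attained:
  assumes u: "entropy_solution T \<gamma> f \<alpha> \<beta> u0 u" and f: "C_k 2 f" and T: "0 < T"
    and u0: "set_integrable lborel {0<..<1} u0"
  shows "AE x in lborel. x \<in> {0<..<1} \<longrightarrow> u x 0 = u0 x"
proof -
  define g where "g x = indicator {0<..<1} x * u0 x - indicator {0<..<1} x * u x 0" for x
  have u1: "set_integrable lborel {0<..<1} (\<lambda>x. u x 0)"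
    using u T by (auto simp: entropy_solution_def in_C_L1_def)
  have i: "integrable lborel (\<lambda>x. indicator {0<..<1} x * u0 x)" "integrable lborel (\<lambda>x. indicator {0<..<1} x * u x 0)"
    using u0 u1 by (simp_all add: set_integrable_def)
  have "AE x in lborel. x \<in> {0<..<1} \<longrightarrow> g x = 0"
  proof (rule zero_of_vanishing_tests)
    show "integrable lborel g" unfolding g_def[abs_def] using i by simp
    fix A :: "real \<Rightarrow> real" assume A: "bump 0 1 A" "\<And>x. 0 \<le> A x"
    have "(\<integral>x. g x * A x \<partial>lborel) = (LINT x:{0<..<1}|lborel. u0 x * A x) - (LINT x:{0<..<1}|lborel. u x 0 * A x)"
      using integrable_mult_bump[OF i(1) A(1)] integrable_mult_bump[OF i(2) A(1)] by (simp add: g_def left_diff_distrib set_lebesgue_integral_def mult.assoc)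
    then show "(\<integral>x. g x * A x \<partial>lborel) = 0"
      using initial_datum_tested[OF u f T A, of 1] initial_datum_tested[OF u f T A, of "-1"] by simp
  qed
  then show ?thesis by eventually_elim (auto simp: g_def)
qed

lemma C_k_2_lipschitz:
  assumes "C_k 2 f" obtains L where "L-lipschitz_on {-M..M} f"
proof -
  obtain L where L: "0 \<le> L" "\<And>x. \<bar>x\<bar> \<le> M \<Longrightarrow> \<bar>deriv f x\<bar> \<le> L"
    using continuous_bounded[OF C_k_2D(4)[OF assms]] by metis
  have "L-lipschitz_on {-M..M} f"
  proof (rule lipschitz_onI)
    fix x y assume xy: "x \<in> {-M..M}" "y \<in> {-M..M}"
    have "norm (f x - f y) \<le> L * norm (x - y)"
      by (rule field_differentiable_bound[where f'="deriv f" and S="{-M..M}"])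
        (use C_k_2D(1)[OF assms] L xy in \<open>auto simp: abs_le_iff intro: has_field_derivative_at_within\<close>)
    then show "dist (f x) (f y) \<le> L * dist x y" by (simp add: dist_norm)
  qed (rule L(1))
  then show ?thesis by (rule that)
qed

text \<open>
  The two representatives are given a common bound \<open>M\<close>, and the flux is Lipschitz on \<open>[-M, M]\<close>.
  The entropy and boundary conditions then give the weak inequality for the distance of the
  representatives, which agrees with the distance of the solutions at almost every time.
\<close>

lemma L1_contraction:
  assumes T: "0 < T" and g: "0 \<le> \<gamma>" and f: "C_k 2 f"
    and u: "entropy_solution T \<gamma> f \<alpha> \<beta> u0 u" and v: "entropy_solution T \<gamma> f \<alpha> \<beta> v0 v"
    and t: "t \<in> {0..T}"
  shows "L1_norm {0<..<1} (\<lambda>x. u x t - v x t) \<le> exp (\<gamma> * t) * L1_norm {0<..<1} (\<lambda>x. u x 0 - v x 0)"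
proof -
  have uC: "in_C_L1 T u" "in_Linf T u" and vC: "in_C_L1 T v" "in_Linf T v"
    using u v by (auto simp: entropy_solution_def)
  obtain Mu U where U: "representative T Mu u U" using representative_exists[OF uC(2)] by blast
  obtain Mv V where V: "representative T Mv v V" using representative_exists[OF vC(2)] by blast
  define M where "M = max Mu Mv"
  have U: "representative T M u U" and V: "representative T M v V"
    using U V bounded_on_rect_mono[of T _ _ M] by (auto simp: representative_def M_def)
  have bU: "bounded_on_rect T M U" and bV: "bounded_on_rect T M V" using U V by (auto simp: representative_def)
  have bS: "bounded_on_rect T (\<gamma> * M) (\<lambda>p. \<gamma> * primitive_x T Y p)" if "bounded_on_rect T M Y" for Y
    using primitive_x_bounded[OF that] g by (auto simp: bounded_on_rect_def abs_mult intro!: mult_left_mono)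
  obtain L where lip: "L-lipschitz_on {-M..M} f" using C_k_2_lipschitz[OF f] by blast
  have fm: "f \<in> borel_measurable borel" using C_k_2D(3)[OF f] by (rule borel_measurable_continuous_onI)
  obtain u0' u1' where tu: "strong_trace T 0 u u0'" "strong_trace T 1 u u1'"
    and bu: "\<And>g q. entropy_pair f g q \<Longrightarrow> AE t in lborel. t \<in> {0<..<T} \<longrightarrow>
              q (u0' t) - q (\<alpha> t) - deriv g (\<alpha> t) * (f (u0' t) - f (\<alpha> t)) \<le> 0 \<and>
              0 \<le> q (u1' t) - q (\<beta> t) - deriv g (\<beta> t) * (f (u1' t) - f (\<beta> t))"
    using u unfolding entropy_solution_def by blast
  obtain v0' v1' where tv: "strong_trace T 0 v v0'" "strong_trace T 1 v v1'"
    and bv: "\<And>g q. entropy_pair f g q \<Longrightarrow> AE t in lborel. t \<in> {0<..<T} \<longrightarrow>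
              q (v0' t) - q (\<alpha> t) - deriv g (\<alpha> t) * (f (v0' t) - f (\<alpha> t)) \<le> 0 \<and>
              0 \<le> q (v1' t) - q (\<beta> t) - deriv g (\<beta> t) * (f (v1' t) - f (\<beta> t))"
    using v unfolding entropy_solution_def by blast
  let ?r = "\<lambda>\<tau> t. indicator {0<..<T} t * \<tau> t"
  have tent_u: "AE t in lborel. t \<in> {0<..<T} \<longrightarrow> tent_condition f (deriv f) (\<alpha> t) (u0' t)
     \<and> tent_condition (\<lambda>x. - f x) (\<lambda>x. - deriv f x) (\<beta> t) (u1' t)"
    by (rule boundary_tent_condition[OF f]) (rule bu)
  have tent_v: "AE t in lborel. t \<in> {0<..<T} \<longrightarrow> tent_condition f (deriv f) (\<alpha> t) (v0' t)
     \<and> tent_condition (\<lambda>x. - f x) (\<lambda>x. - deriv f x) (\<beta> t) (v1' t)"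
    by (rule boundary_tent_condition[OF f]) (rule bv)
  have sign: "AE t in lborel. t \<in> {0<..<T} \<longrightarrow> kruzkov_flux f (?r u0' t) (?r v0' t) \<le> 0
      \<and> 0 \<le> kruzkov_flux f (?r u1' t) (?r v1' t)"
    using tent_u tent_v
  proof eventually_elim
    case (elim t)
    show ?case
    proof
      assume t: "t \<in> {0<..<T}"
      have "kruzkov_flux f (u0' t) (v0' t) \<le> 0"
        by (rule tent_condition_flux[OF C_k_2D(1)[OF f]]) (use elim t in blast)+
      moreover have "kruzkov_flux (\<lambda>x. - f x) (u1' t) (v1' t) \<le> 0"
        by (rule tent_condition_flux[OF DERIV_minus[OF C_k_2D(1)[OF f]]]) (use elim t in blast)+
      moreover have "kruzkov_flux (\<lambda>x. - f x) (u1' t) (v1' t) = - kruzkov_flux f (u1' t) (v1' t)"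
        by (simp add: kruzkov_flux_def algebra_simps)
      ultimately show "kruzkov_flux f (?r u0' t) (?r v0' t) \<le> 0 \<and> 0 \<le> kruzkov_flux f (?r u1' t) (?r v1' t)"
        using t by simp
    qed
  qed
  have ineq: "0 \<le> (\<integral>p. \<bar>U p - V p\<bar> * deriv b (snd p)
      + \<bar>\<gamma> * primitive_x T U p - \<gamma> * primitive_x T V p\<bar> * b (snd p) \<partial>lborel)"
    if "bump 0 T b" "\<And>t. 0 \<le> b t" for b
    by (rule boundary_flux_inequality[OF lip bU bV bS[OF bU] bS[OF bV] entropy_solution_kruzkov[OF u U f]
        entropy_solution_kruzkov[OF v V f] fm strong_trace_has_trace[OF tu(1) U] strong_trace_has_trace[OF tv(1) V]
        strong_trace_has_trace[OF tu(2) U] strong_trace_has_trace[OF tv(2) V] sign that])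
  \<comment> \<open>Measurability and boundedness of the distance come with the inequality for any test function.\<close>
  have z: "bump 0 T (\<lambda>t. 0)" using T by (auto simp: bump_def smooth_const intro!: exI[of _ "T / 2"])
  note w = L1_distance_inequality[OF bU bV g]
  have zi: "0 \<le> (\<integral>p. \<bar>U p - V p\<bar> * deriv (\<lambda>t. 0) (snd p)
      + \<bar>\<gamma> * primitive_x T U p - \<gamma> * primitive_x T V p\<bar> * 0 \<partial>lborel)" by simp
  show ?thesis
  proof (rule weak_gronwall[OF _ w(2)[OF z _ zi] w(3)[OF z _ zi] L1_distance_continuous[OF uC(1) vC(1)]
        L1_norm_representative[OF uC(1) vC(1) U V] T t])
    fix b assume "bump 0 T b" "\<And>t. 0 \<le> b t"
    then show "0 \<le> (\<integral>t. (\<integral>x. \<bar>U (x, t) - V (x, t)\<bar> \<partial>lborel) * (deriv b t + \<gamma> * b t) \<partial>lborel)"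
      using w(1) ineq by blast
  qed auto
qed

lemma L1_norm_cong_AE:
  assumes i: "set_integrable lborel S a" "set_integrable lborel S b" "set_integrable lborel S a'" "set_integrable lborel S b'"
    and ae: "AE x in lborel. x \<in> S \<longrightarrow> a x = a' x" "AE x in lborel. x \<in> S \<longrightarrow> b x = b' x"
  shows "L1_norm S (\<lambda>x. a x - b x) = L1_norm S (\<lambda>x. a' x - b' x)"
  unfolding L1_norm_def set_lebesgue_integral_def
proof (rule integral_cong_AE)
  show "(\<lambda>x. indicator S x *\<^sub>R \<bar>a x - b x\<bar>) \<in> borel_measurable lborel"
    using L1_distance_integrable[OF i(1,2)] unfolding set_integrable_def by (rule borel_measurable_integrable)
  show "(\<lambda>x. indicator S x *\<^sub>R \<bar>a' x - b' x\<bar>) \<in> borel_measurable lborel"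
    using L1_distance_integrable[OF i(3,4)] unfolding set_integrable_def by (rule borel_measurable_integrable)
  show "AE x in lborel. indicator S x *\<^sub>R \<bar>a x - b x\<bar> = indicator S x *\<^sub>R \<bar>a' x - b' x\<bar>"
    using ae by eventually_elim (auto simp: indicator_def)
qed

lemma L1_norm_eq_0_iff:
  assumes "set_integrable lborel S a" "set_integrable lborel S b"
  shows "L1_norm S (\<lambda>x. a x - b x) = 0 \<longleftrightarrow> (AE x in lborel. x \<in> S \<longrightarrow> a x = b x)"
proof -
  have "L1_norm S (\<lambda>x. a x - b x) = 0 \<longleftrightarrow> (AE x in lborel. indicator S x *\<^sub>R \<bar>a x - b x\<bar> = 0)"
    unfolding L1_norm_def set_lebesgue_integral_def
    using L1_distance_integrable[OF assms] unfolding set_integrable_def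
    by (intro integral_nonneg_eq_0_iff_AE) auto
  also have "\<dots> \<longleftrightarrow> (AE x in lborel. x \<in> S \<longrightarrow> a x = b x)"
    by (intro AE_cong) (auto simp: indicator_def)
  finally show ?thesis .
qed

theorem theorem10:
  fixes T \<gamma> :: real
    and f \<alpha> \<beta> u0 v0 :: "real \<Rightarrow> real"
    and u v :: "real \<Rightarrow> real \<Rightarrow> real"
  assumes "T > 0" and "\<gamma> > 0" and "C_k 2 f"
    and "BV 0 T \<alpha>" and "BV 0 T \<beta>"
    and "BV 0 1 u0" and "BV 0 1 v0"
    and "entropy_solution T \<gamma> f \<alpha> \<beta> u0 u"
    and "entropy_solution T \<gamma> f \<alpha> \<beta> v0 v"
  shows "L1_norm {0<..<1} (\<lambda>x. u x T - v x T) \<le> exp (\<gamma> * T) * L1_norm {0<..<1} (\<lambda>x. u0 x - v0 x)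
    \<and> ((AE x in lborel. x \<in> {0<..<1} \<longrightarrow> u0 x = v0 x) \<longrightarrow>
         (\<forall>t\<in>{0..T}. AE x in lborel. x \<in> {0<..<1} \<longrightarrow> u x t = v x t))"
proof -
  have i0: "set_integrable lborel {0<..<1} u0" "set_integrable lborel {0<..<1} v0"
    using assms(6,7) by (auto simp: BV_def)
  have i: "set_integrable lborel {0<..<1} (\<lambda>x. u x t)" "set_integrable lborel {0<..<1} (\<lambda>x. v x t)" if "t \<in> {0..T}" for t
    using assms(8,9) that by (auto simp: entropy_solution_def in_C_L1_def)
  have "L1_norm {0<..<1} (\<lambda>x. u x 0 - v x 0) = L1_norm {0<..<1} (\<lambda>x. u0 x - v0 x)"
    using assms(1) i[of 0] i0 initial_datum_attained[OF assms(8,3,1) i0(1)] initial_datum_attained[OF assms(9,3,1) i0(2)]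
    by (intro L1_norm_cong_AE) auto
  then have est: "L1_norm {0<..<1} (\<lambda>x. u x t - v x t) \<le> exp (\<gamma> * t) * L1_norm {0<..<1} (\<lambda>x. u0 x - v0 x)"
    if "t \<in> {0..T}" for t
    using L1_contraction[OF assms(1) less_imp_le[OF assms(2)] assms(3,8,9) that] by simp
  have nonneg: "0 \<le> L1_norm {0<..<1} g" for g
    unfolding L1_norm_def set_lebesgue_integral_def by (rule Bochner_Integration.integral_nonneg) simp
  show ?thesis
  proof (intro conjI impI ballI)
    show "L1_norm {0<..<1} (\<lambda>x. u x T - v x T) \<le> exp (\<gamma> * T) * L1_norm {0<..<1} (\<lambda>x. u0 x - v0 x)"
      using est assms(1) by simp
    fix t assume ae: "AE x in lborel. x \<in> {0<..<1} \<longrightarrow> u0 x = v0 x" and t: "t \<in> {0..T}"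
    have "L1_norm {0<..<1} (\<lambda>x. u0 x - v0 x) = 0" using ae L1_norm_eq_0_iff[OF i0] by blast
    then have "L1_norm {0<..<1} (\<lambda>x. u x t - v x t) = 0"
      using est[OF t] nonneg[of "\<lambda>x. u x t - v x t"] by simp
    then show "AE x in lborel. x \<in> {0<..<1} \<longrightarrow> u x t = v x t"
      using L1_norm_eq_0_iff[OF i[OF t]] by blast
  qed
qed

end
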